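(* Let $\alpha,\alpha_M>0$, let $m\geq1$ be an integer, and let $u^{in},\mathcal B^{in}\in H^m(\mathbb T^3)\cap V$. Then the unique solution $(u,\mathcal B)\in C^1((-\infty,\infty),V)$ of the inviscid, irresistive MHD-Voigt system $$-\alpha^2\partial_t\triangle u+\partial_tu+(u\cdot\nabla)u+\nabla p+\tfrac12\nabla|\mathcal B|^2=(\mathcal B\cdot\nabla)\mathcal B,$$ $$-\alpha_M^2\partial_t\triangle\mathcal B+\partial_t\mathcal B+(u\cdot\nabla)\mathcal B-(\mathcal B\cdot\nabla)u+\nabla q=0,$$ $$\nabla\cdot\mathcal B=\nabla\cdot u=0,\qquad \mathcal B(0)=\mathcal B^{in},\quad u(0)=u^{in},$$ with periodic boundary conditions on $\mathbb T^3$, lies in $C((-\infty,\infty),H^m(\mathbb T^3)\cap V)$.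
   Context: $\mathbb T^3=[0,1]^3$ is the periodic unit torus, and $H^m$ is the usual Sobolev space on $\mathbb T^3$. $\mathcal V$ is the set of $\mathbb R^3$-valued trigonometric polynomials $\varphi$ on $\mathbb T^3$ with $\nabla\cdot\varphi=0$ and $\int_{\mathbb T^3}\varphi\,dx=0$. $H$ and $V$ are the closures of $\mathcal V$ in $L^2(\mathbb T^3)$ and $H^1(\mathbb T^3)$, respectively, and $V'$ is the dual of $V$. $P_\sigma:L^2\to H$ is the Leray-Helmholtz (orthogonal) projection, $A=-P_\sigma\triangle$ (here $A=-\triangle$) is extended to a bounded operator $V\to V'$, and $B(w_1,w_2)=P_\sigma((w_1\cdot\nabla)w_2)$ for $w_1,w_2\in\mathcal V$, extended to a continuous bilinear map $B:V\times V\to V'$. Solutions are understood in the equivalent functional form, with equalities in $V'$: $\frac{d}{dt}(\alpha^2Au+u)=B(\mathcal B,\mathcal B)-B(u,u)$, $\frac{d}{dt}(\alpha_M^2A\mathcal B+\mathcal B)=B(\mathcal B,u)-B(u,\mathcal B)$, $u(0)=u^{in}$, $\mathcal B(0)=\mathcal B^{in}$. For $u^{in},\mathcal B^{in}\in V$ this system has a unique solution $(u,\mathcal B)\in C^1((-\infty,\infty),V)$ (both components in that space). *)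

theory Defs
  imports "HOL-Analysis.Analysis"
begin

(* Vector fields on the torus [0,1]^3 are represented by functions on R^3 of which only the
   restriction to the unit cube matters, up to null sets.  Hence equality of elements of L^2
   is equality almost everywhere with respect to torus3, and the norms below are seminorms on
   representatives. *)

type_synonym vfield = "real^3 \<Rightarrow> real^3"

definition torus3 :: "(real^3) measure" where
  "torus3 = lebesgue_on (cbox 0 One)"

definition L2 :: "vfield set" where
  "L2 = {f. f \<in> borel_measurable torus3 \<and> integrable torus3 (\<lambda>x. (norm (f x))\<^sup>2)}"

definition l2_inner :: "vfield \<Rightarrow> vfield \<Rightarrow> real" where
  "l2_inner f g = (\<integral>x. f x \<bullet> g x \<partial>torus3)"

definition l2_norm :: "vfield \<Rightarrow> real" where
  "l2_norm f = sqrt (l2_inner f f)"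


subsection \<open>Classical and weak derivatives\<close>

definition pd :: "3 \<Rightarrow> (real^3 \<Rightarrow> 'b::real_normed_vector) \<Rightarrow> real^3 \<Rightarrow> 'b" where
  "pd i f x = frechet_derivative f (at x) (axis i 1)"

(* A multi-index is given by the list of the directions of differentiation. *)
definition pds :: "3 list \<Rightarrow> (real^3 \<Rightarrow> 'b::real_normed_vector) \<Rightarrow> real^3 \<Rightarrow> 'b" where
  "pds js f = foldr pd js f"

definition divergence :: "vfield \<Rightarrow> real^3 \<Rightarrow> real" where
  "divergence f x = (\<Sum>i\<in>UNIV. pd i f x $ i)"

definition laplacian :: "vfield \<Rightarrow> vfield" where
  "laplacian f x = (\<Sum>i\<in>UNIV. pd i (pd i f) x)"

definition advection :: "vfield \<Rightarrow> vfield \<Rightarrow> vfield" where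
  "advection w1 w2 x = (\<Sum>i\<in>UNIV. (w1 x $ i) *\<^sub>R pd i w2 x)"

definition periodic :: "(real^3 \<Rightarrow> 'b) \<Rightarrow> bool" where
  "periodic f \<longleftrightarrow> (\<forall>i x. f (x + axis i 1) = f x)"

(* Differentiability of all iterated partial derivatives makes them all continuous, so these
   are exactly the periodic C-infinity functions. *)
definition test_functions :: "(real^3 \<Rightarrow> real) set" where
  "test_functions = {\<phi>. periodic \<phi> \<and> (\<forall>js x. pds js \<phi> differentiable (at x))}"

definition is_weak_deriv :: "3 list \<Rightarrow> vfield \<Rightarrow> vfield \<Rightarrow> bool" where
  "is_weak_deriv js f g \<longleftrightarrow>
     (\<forall>\<phi>\<in>test_functions.
        (\<integral>x. pds js \<phi> x *\<^sub>R f x \<partial>torus3) =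
        (-1) ^ length js *\<^sub>R (\<integral>x. \<phi> x *\<^sub>R g x \<partial>torus3))"

definition weak_deriv :: "3 list \<Rightarrow> vfield \<Rightarrow> vfield" where
  "weak_deriv js f = (SOME g. g \<in> L2 \<and> is_weak_deriv js f g)"


subsection \<open>Sobolev spaces\<close>

definition Hm :: "nat \<Rightarrow> vfield set" where
  "Hm m = {f \<in> L2. \<forall>js. length js \<le> m \<longrightarrow> (\<exists>g\<in>L2. is_weak_deriv js f g)}"

(* Summing over lists of directions gives the sum over l <= m of the squared L^2 norms of the
   full derivative tensors of order l, a mixed derivative being counted once for each ordering. *)
definition Hm_norm :: "nat \<Rightarrow> vfield \<Rightarrow> real" where
  "Hm_norm m f = sqrt (\<Sum>js\<in>{js :: 3 list. length js \<le> m}. (l2_norm (weak_deriv js f))\<^sup>2)"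

definition trig_polynomial :: "vfield \<Rightarrow> bool" where
  "trig_polynomial \<phi> \<longleftrightarrow>
     (\<exists>(K :: (int^3) set) a b. finite K \<and>
        \<phi> = (\<lambda>x. \<Sum>k\<in>K. cos (2 * pi * ((\<chi> i. real_of_int (k $ i)) \<bullet> x)) *\<^sub>R a k
                      + sin (2 * pi * ((\<chi> i. real_of_int (k $ i)) \<bullet> x)) *\<^sub>R b k))"

definition calV :: "vfield set" where
  "calV = {\<phi>. trig_polynomial \<phi> \<and> (\<forall>x. divergence \<phi> x = 0) \<and> (\<integral>x. \<phi> x \<partial>torus3) = 0}"

definition spaceH :: "vfield set" where
  "spaceH = {f \<in> L2. \<forall>\<epsilon>>0. \<exists>\<phi>\<in>calV. l2_norm (\<lambda>x. \<phi> x - f x) < \<epsilon>}"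

definition spaceV :: "vfield set" where
  "spaceV = {f \<in> Hm 1. \<forall>\<epsilon>>0. \<exists>\<phi>\<in>calV. Hm_norm 1 (\<lambda>x. \<phi> x - f x) < \<epsilon>}"


subsection \<open>The dual of V\<close>

(* Only the values of a functional on spaceV matter. *)
type_synonym functional = "vfield \<Rightarrow> real"

(* Extended-valued, so that the norm of an unbounded functional is infinite. *)
definition dual_norm :: "functional \<Rightarrow> ennreal" where
  "dual_norm F = (SUP v\<in>{v \<in> spaceV. Hm_norm 1 v \<le> 1}. ennreal \<bar>F v\<bar>)"

definition dualV :: "functional set" where
  "dualV = {F. (\<forall>v\<in>spaceV. \<forall>w\<in>spaceV. F (\<lambda>x. v x + w x) = F v + F w) \<and>
               (\<forall>c. \<forall>v\<in>spaceV. F (\<lambda>x. c *\<^sub>R v x) = c * F v) \<and>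
               dual_norm F < \<infinity>}"


subsection \<open>The operators A and B\<close>

definition leray :: "vfield \<Rightarrow> vfield" where
  "leray f = (SOME g. g \<in> spaceH \<and> (\<forall>h\<in>spaceH. l2_inner (\<lambda>x. f x - g x) h = 0))"

(* Elements f of L^2 act on V by the functional l2_inner f. *)

definition A_smooth :: "vfield \<Rightarrow> functional" where
  "A_smooth \<phi> = l2_inner (leray (\<lambda>x. - laplacian \<phi> x))"

definition B_smooth :: "vfield \<Rightarrow> vfield \<Rightarrow> functional" where
  "B_smooth \<phi> \<psi> = l2_inner (leray (advection \<phi> \<psi>))"

definition approximates :: "(nat \<Rightarrow> vfield) \<Rightarrow> vfield \<Rightarrow> bool" where
  "approximates \<phi> w \<longleftrightarrow>
     (\<forall>n. \<phi> n \<in> calV) \<and> (\<lambda>n. Hm_norm 1 (\<lambda>x. \<phi> n x - w x)) \<longlonglongrightarrow> 0"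

(* Extensions by continuity from calV to V; the value is determined on V, which is all
   that matters. *)

definition opA :: "vfield \<Rightarrow> functional" where
  "opA w = (SOME F. F \<in> dualV \<and>
     (\<forall>\<phi>. approximates \<phi> w \<longrightarrow>
        (\<lambda>n. dual_norm (\<lambda>v. A_smooth (\<phi> n) v - F v)) \<longlonglongrightarrow> 0))"

definition opB :: "vfield \<Rightarrow> vfield \<Rightarrow> functional" where
  "opB w1 w2 = (SOME F. F \<in> dualV \<and>
     (\<forall>\<phi> \<psi>. approximates \<phi> w1 \<longrightarrow> approximates \<psi> w2 \<longrightarrow>
        (\<lambda>n. dual_norm (\<lambda>v. B_smooth (\<phi> n) (\<psi> n) v - F v)) \<longlonglongrightarrow> 0))"


subsection \<open>Curves and solutions\<close>

definition cont_curve :: "vfield set \<Rightarrow> (vfield \<Rightarrow> real) \<Rightarrow> (real \<Rightarrow> vfield) \<Rightarrow> bool" where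
  "cont_curve S N u \<longleftrightarrow>
     (\<forall>t. u t \<in> S) \<and> (\<forall>t. ((\<lambda>s. N (\<lambda>x. u s x - u t x)) \<longlongrightarrow> 0) (at t))"

definition C1_curve :: "vfield set \<Rightarrow> (vfield \<Rightarrow> real) \<Rightarrow> (real \<Rightarrow> vfield) \<Rightarrow> bool" where
  "C1_curve S N u \<longleftrightarrow> (\<forall>t. u t \<in> S) \<and>
     (\<exists>u'. cont_curve S N u' \<and>
        (\<forall>t. ((\<lambda>h. N (\<lambda>x. (1 / h) *\<^sub>R (u (t + h) x - u t x) - u' t x)) \<longlongrightarrow> 0) (at 0)))"

definition has_dual_deriv :: "(real \<Rightarrow> functional) \<Rightarrow> functional \<Rightarrow> real \<Rightarrow> bool" where
  "has_dual_deriv F G t \<longleftrightarrow>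
     ((\<lambda>h. dual_norm (\<lambda>v. (F (t + h) v - F t v) / h - G v)) \<longlongrightarrow> 0) (at 0)"

definition mhd_voigt_solution ::
  "real \<Rightarrow> real \<Rightarrow> vfield \<Rightarrow> vfield \<Rightarrow> (real \<Rightarrow> vfield) \<Rightarrow> (real \<Rightarrow> vfield) \<Rightarrow> bool" where
  "mhd_voigt_solution \<alpha> \<alpha>\<^sub>M u_in b_in u b \<longleftrightarrow>
     C1_curve spaceV (Hm_norm 1) u \<and> C1_curve spaceV (Hm_norm 1) b \<and>
     (\<forall>t. has_dual_deriv (\<lambda>s v. \<alpha>\<^sup>2 * opA (u s) v + l2_inner (u s) v)
            (\<lambda>v. opB (b t) (b t) v - opB (u t) (u t) v) t) \<and>
     (\<forall>t. has_dual_deriv (\<lambda>s v. \<alpha>\<^sub>M\<^sup>2 * opA (b s) v + l2_inner (b s) v)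
            (\<lambda>v. opB (b t) (u t) v - opB (u t) (b t) v) t) \<and>
     (AE x in torus3. u 0 x = u_in x) \<and> (AE x in torus3. b 0 x = b_in x)"

end

theory Submission
  imports Defs
begin

text \<open>
The solution keeps the regularity of its initial data, because inverting
\<open>1 + \<alpha>\<^sup>2 A\<close> regains two derivatives while \<open>B\<close> costs only one, so that the system behaves like an ordinary
differential equation in every space \<open>H\<^sup>m \<inter> V\<close>. Moreover the nonlinearity is tame. If \<open>Z\<close> bounds the
\<open>H\<^sup>m\<close> norms and \<open>M\<close> the norms in \<open>V\<close> of \<open>u\<close> and \<open>b\<close>, the time derivative is bounded in \<open>H\<^sup>m\<close> by a
multiple of \<open>M Z\<close>. As \<open>M\<close> is bounded on compact time intervals, this is a linear differential
inequality for \<open>Z\<close>, which neither blows up nor needs small data.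

The proof works with Fourier coefficients. The divergence-free condition turns the advection term into
a convolution in which the derivative falls on the test field, and its basic bound (\<open>trilinear_bound\<close>)
is a Cauchy-Schwarz argument that rests on the convergence of the sum of \<open>1 / |k|\<^sup>4\<close> over the nonzero
lattice points. Since a power of \<open>|l + p|\<close> is at most a constant times the sum of the same powers of
\<open>|l|\<close> and \<open>|p|\<close>, a weight \<open>|k|\<^sup>m\<^sup>-\<^sup>1\<close> can be moved to one of the two factors, which gives the tame bound
(\<open>opB_weighted_bound\<close>). The missing power of \<open>|k|\<close> in the \<open>H\<^sup>m\<close> norm comes from the pairing with \<open>A\<close>.

The \<open>H\<^sup>m\<close> norm of the solution is not known to be finite in advance. Therefore the weight is first cut off
at a level \<open>N\<close>, which keeps the property just mentioned with a constant independent of \<open>N\<close>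
(\<open>cut_weight_add\<close>). Testing the equation with the weighted increment of the solution between two
times \<open>t\<close> and \<open>s\<close> (\<open>voigt_increment_bound\<close>) shows that the weighted norm of the increment is at most a
multiple of \<open>|s - t|\<close> times the weighted norm at time \<open>t\<close>, if \<open>|s - t|\<close> is below a threshold that
depends only on \<open>M\<close>, \<open>m\<close> and the coefficients of the system
(\<open>voigt_increment_regular\<close>). Letting \<open>N\<close> grow, this carries the regularity from \<open>t\<close> to
\<open>s\<close> and makes the solution locally Lipschitz continuous in \<open>H\<^sup>m\<close>. Finitely many steps lead from time 0
to any other time.

Before that, the objects of the problem have to be identified. Weak derivatives and the operators \<open>A\<close>
and \<open>B\<close> are specified by a choice operator, so nothing is known about them until existence and uniqueness are
established. For weak derivatives this follows from the completeness of the trigonometric system in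
\<open>L\<^sup>2\<close> (\<open>AE_zero_of_orthogonal_waves\<close>, \<open>Riesz_Fischer\<close>), which makes them Fourier multipliers
(\<open>is_weak_deriv_iff\<close>). The operators are extended by continuity from smooth fields
(\<open>dual_extension\<close>, \<open>opA_works\<close>, \<open>opB_works\<close>), and only their values on trigonometric test fields
enter the argument.
\<close>

section \<open>Integration over the torus\<close>

lemma space_torus3 [simp]: "space torus3 = cbox 0 One"
  by (simp add: torus3_def)

lemma emeasure_torus3_space: "emeasure torus3 (cbox 0 One) = 1"
  by (simp add: torus3_def emeasure_restrict_space)

lemma measure_torus3_space: "measure torus3 (cbox 0 One) = 1"
  by (simp add: Sigma_Algebra.measure_def emeasure_torus3_space)

interpretation torus3: finite_measure torus3
  by standard (simp add: emeasure_torus3_space)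

lemma integrable_torus3_continuous:
  fixes f :: "real^3 \<Rightarrow> 'b::euclidean_space"
  assumes "continuous_on UNIV f"
  shows "integrable torus3 f"
  unfolding torus3_def
  by (rule continuous_imp_integrable) (use assms continuous_on_subset in blast)

lemma borel_measurable_torus3_continuous:
  fixes f :: "real^3 \<Rightarrow> 'b::euclidean_space"
  assumes "continuous_on UNIV f"
  shows "f \<in> borel_measurable torus3"
  using integrable_torus3_continuous[OF assms] by auto

lemma integral_torus3_eq:
  fixes f :: "real^3 \<Rightarrow> 'b::euclidean_space"
  assumes "continuous_on UNIV f"
  shows "integral\<^sup>L torus3 f = integral (cbox 0 One) f"
  using integrable_torus3_continuous[OF assms] unfolding torus3_def
  by (rule lebesgue_integral_eq_integral) auto

lemma One_nth: "(One::real^3) $ j = 1"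
  unfolding cart_eq_inner_axis by (simp add: inner_sum_left_Basis axis_in_Basis_iff del: inner_axis)

text \<open>The slab by which the translated cube differs from the unit cube is carried onto the missing slab by
  a unit translation, which does not change a periodic integrand.\<close>

lemma integral_unit_cube_translate:
  fixes g :: "real^3 \<Rightarrow> 'b::euclidean_space"
  assumes per: "periodic g" and cont: "continuous_on UNIV g" and h: "0 \<le> h" "h \<le> 1"
  shows "integral (cbox 0 One) (\<lambda>x. g (x + h *\<^sub>R axis i 1)) = integral (cbox 0 One) g"
proof -
  let ?e = "axis i (1::real) :: real^3"
  have e: "?e \<in> Basis" by (simp add: axis_in_Basis_iff)
  have inte: "x \<bullet> ?e = x $ i" for x :: "real^3"
    by (simp add: inner_axis)
  have comps: "(One + c *\<^sub>R ?e) $ j = (if j = i then 1 + c else 1)"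
      "(c *\<^sub>R ?e) $ j = (if j = i then c else 0)" "?e $ j = (if j = i then 1 else 0)"
      "(One::real^3) $ j = 1" for c j
    using One_nth by (simp_all add: axis_def del: sum_component)
  have eq1: "integral (cbox 0 One) (\<lambda>x. g (x + h *\<^sub>R ?e)) = integral (cbox (h *\<^sub>R ?e) (One + h *\<^sub>R ?e)) g"
    using integral_shift_cbox[of "h *\<^sub>R ?e" "h *\<^sub>R ?e" "One + h *\<^sub>R ?e" g] by simp
  let ?B = "cbox 0 (One + h *\<^sub>R ?e)"
  have int: "g integrable_on ?B"
    by (rule integrable_continuous) (use cont continuous_on_subset in blast)
  have a: "integral ?B g = integral (cbox 0 One) g + integral (cbox ?e (One + h *\<^sub>R ?e)) g"
  proof -
    have "?B \<inter> {x. x \<bullet> ?e \<le> 1} = cbox 0 One"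
      using h by (intro set_eqI, simp add: mem_box_cart inte comps del: sum_component vector_add_component vector_scaleR_component) (smt (verit))
    moreover have "?B \<inter> {x. x \<bullet> ?e \<ge> 1} = cbox ?e (One + h *\<^sub>R ?e)"
      using h by (intro set_eqI, simp add: mem_box_cart inte comps del: sum_component vector_add_component vector_scaleR_component) (smt (verit))
    ultimately show ?thesis using integral_split[OF int e, of 1] by simp
  qed
  have b: "integral ?B g = integral (cbox 0 (One + (h - 1) *\<^sub>R ?e)) g
        + integral (cbox (h *\<^sub>R ?e) (One + h *\<^sub>R ?e)) g"
  proof -
    have "?B \<inter> {x. x \<bullet> ?e \<le> h} = cbox 0 (One + (h - 1) *\<^sub>R ?e)"
      using h by (intro set_eqI, simp add: mem_box_cart inte comps del: sum_component vector_add_component vector_scaleR_component) (smt (verit))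
    moreover have "?B \<inter> {x. x \<bullet> ?e \<ge> h} = cbox (h *\<^sub>R ?e) (One + h *\<^sub>R ?e)"
      using h by (intro set_eqI, simp add: mem_box_cart inte comps del: sum_component vector_add_component vector_scaleR_component) (smt (verit))
    ultimately show ?thesis using integral_split[OF int e, of h] by simp
  qed
  have c: "integral (cbox ?e (One + h *\<^sub>R ?e)) g = integral (cbox 0 (One + (h - 1) *\<^sub>R ?e)) g"
    using integral_shift_cbox[of "?e" "?e" "One + h *\<^sub>R ?e" g] per
    by (simp add: periodic_def algebra_simps)
  show ?thesis using eq1 a b c by simp
qed

lemma has_vector_derivative_along_axis:
  fixes g :: "real^3 \<Rightarrow> 'b::real_normed_vector"
  assumes "g differentiable at (x + h *\<^sub>R axis i 1)"
  shows "((\<lambda>h. g (x + h *\<^sub>R axis i 1)) has_vector_derivative pd i g (x + h *\<^sub>R axis i 1)) (at h within U)"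
proof -
  have d: "(g has_derivative frechet_derivative g (at (x + h *\<^sub>R axis i 1))) (at (x + h *\<^sub>R axis i 1))"
    using assms by (simp add: frechet_derivative_works)
  have "((\<lambda>h. g (x + h *\<^sub>R axis i 1)) has_derivative
     (\<lambda>t. frechet_derivative g (at (x + h *\<^sub>R axis i 1)) (t *\<^sub>R axis i 1))) (at h within U)"
    by (rule has_derivative_compose[where f="\<lambda>h. x + h *\<^sub>R axis i 1" and g=g, OF _ d])
       (auto intro!: derivative_eq_intros)
  moreover have "frechet_derivative g (at (x + h *\<^sub>R axis i 1)) (t *\<^sub>R axis i 1)
      = t *\<^sub>R pd i g (x + h *\<^sub>R axis i 1)" for t
    using d unfolding pd_def by (simp add: has_derivative_def bounded_linear.linear linear_cmul)
  ultimately show ?thesis by (simp add: has_vector_derivative_def)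
qed

text \<open>The integral over the unit cube does not change when the integrand is translated in direction i;
  differentiating under the integral sign gives the claim. This replaces the divergence theorem: every
  integration by parts below comes from it.\<close>

lemma integral_pd_periodic:
  fixes g :: "real^3 \<Rightarrow> 'b::euclidean_space"
  assumes per: "periodic g" and diff: "\<And>x. g differentiable at x"
    and cont: "continuous_on UNIV (pd i g)"
  shows "(\<integral>x. pd i g x \<partial>torus3) = 0"
proof -
  let ?e = "axis i (1::real) :: real^3"
  have cg: "continuous_on UNIV g"
    by (meson continuous_at_imp_continuous_on diff differentiable_imp_continuous_within)
  have D: "((\<lambda>h. integral (cbox 0 One) (\<lambda>x. g (x + h *\<^sub>R ?e))) has_vector_derivative
      integral (cbox 0 One) (\<lambda>x. pd i g (x + 0 *\<^sub>R ?e))) (at 0 within {0..1})"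
  proof (rule leibniz_rule_vector_derivative)
    show "((\<lambda>h. g (t + h *\<^sub>R ?e)) has_vector_derivative pd i g (t + x *\<^sub>R ?e)) (at x within {0..1})"
      for x t by (rule has_vector_derivative_along_axis) (rule diff)
    show "(\<lambda>y. g (y + x *\<^sub>R ?e)) integrable_on cbox 0 One" for x
      by (intro integrable_continuous continuous_on_compose2[OF cg] continuous_intros) auto
    show "continuous_on ({0..1} \<times> cbox 0 One) (\<lambda>(x, t). pd i g (t + x *\<^sub>R ?e))"
      unfolding split_beta by (intro continuous_on_compose2[OF cont] continuous_intros) auto
  qed auto
  have "((\<lambda>h::real. integral (cbox 0 One) g) has_vector_derivative
      integral (cbox 0 One) (pd i g)) (at 0 within {0..1})"
    by (rule has_vector_derivative_transform[OF _ _ D[simplified]])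
       (use integral_unit_cube_translate[OF per cg] in auto)
  moreover have "((\<lambda>h::real. integral (cbox 0 One) g) has_vector_derivative 0) (at 0 within {0..1})"
    by simp
  ultimately have "integral (cbox 0 One) (pd i g) = 0"
    using vector_derivative_unique_within_closed_interval[of 0 1 0] by (metis atLeastAtMost_iff box_real(2) order_refl zero_le_one zero_less_one)
  thus ?thesis using integral_torus3_eq[OF cont] by simp
qed

section \<open>Plane waves\<close>

definition freq :: "int^3 \<Rightarrow> real^3" where
  "freq k = (\<chi> i. real_of_int (k $ i))"

definition wave :: "int^3 \<Rightarrow> real^3 \<Rightarrow> complex" where
  "wave k x = cis (2 * pi * (freq k \<bullet> x))"

text \<open>The factor by which the partial derivative in direction i acts on a wave.\<close>

definition symb :: "3 \<Rightarrow> int^3 \<Rightarrow> complex" where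
  "symb i k = 2 * pi * \<i> * of_int (k $ i)"

lemma freq_nth [simp]: "freq k $ i = of_int (k $ i)"
  by (simp add: freq_def)

lemma freq_add: "freq (k + l) = freq k + freq l"
  by (simp add: freq_def vec_eq_iff)

lemma freq_uminus [simp]: "freq (- k) = - freq k"
  by (simp add: freq_def vec_eq_iff)

lemma freq_zero [simp]: "freq 0 = 0"
  by (simp add: freq_def vec_eq_iff)

lemma freq_eq_0_iff [simp]: "freq k = 0 \<longleftrightarrow> k = 0"
  by (simp add: freq_def vec_eq_iff)

lemma norm_freq_ge_1:
  assumes "k \<noteq> 0" shows "norm (freq k) \<ge> 1"
proof -
  from assms obtain i where "k $ i \<noteq> 0" by (auto simp: vec_eq_iff)
  hence "\<bar>freq k $ i\<bar> \<ge> 1" by simp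
  thus ?thesis using component_le_norm_cart[of "freq k" i] by linarith
qed

lemma wave_add: "wave (k + l) x = wave k x * wave l x"
  by (simp add: wave_def freq_add inner_left_distrib distrib_left cis_mult)

lemma wave_uminus: "wave (- k) x = cnj (wave k x)"
  by (simp add: wave_def cis_cnj)

lemma wave_zero [simp]: "wave 0 x = 1"
  by (simp add: wave_def)

lemma norm_wave [simp]: "norm (wave k x) = 1"
  by (simp add: wave_def)

lemma symb_uminus: "symb i (- k) = cnj (symb i k)"
  by (simp add: symb_def)

lemma periodic_wave: "periodic (wave k)"
proof -
  have "wave k (x + axis i 1) = wave k x" for i x
  proof -
    have "wave k (x + axis i 1) = wave k x * cis (2 * pi * of_int (k $ i))"
      by (simp add: wave_def inner_right_distrib distrib_left cis_mult inner_axis del: cis_multiple_2pi)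
    also have "cis (2 * pi * of_int (k $ i)) = 1"
      by (rule cis_multiple_2pi) simp
    finally show ?thesis by simp
  qed
  thus ?thesis by (simp add: periodic_def)
qed

lemma has_derivative_wave:
  "(wave k has_derivative (\<lambda>h. (2 * pi * (freq k \<bullet> h)) *\<^sub>R (\<i> * wave k x))) (at x within S)"
proof -
  have "((\<lambda>x. 2 * pi * (freq k \<bullet> x)) has_derivative (\<lambda>h. 2 * pi * (freq k \<bullet> h))) (at x within S)"
    by (auto intro!: derivative_eq_intros)
  from has_derivative_cis[OF this] show ?thesis
    unfolding wave_def by (simp add: mult_ac)
qed

lemma continuous_on_wave [continuous_intros]:
  "continuous_on S f \<Longrightarrow> continuous_on S (\<lambda>x. wave k (f x))"
  unfolding wave_def cis_conv_exp by (intro continuous_intros) 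

lemma pd_eqI:
  assumes "(f has_derivative f') (at x)"
  shows "pd i f x = f' (axis i 1)"
  using frechet_derivative_at[OF assms] by (simp add: pd_def)

lemma pd_wave: "pd i (wave k) x = symb i k * wave k x"
  by (subst pd_eqI[OF has_derivative_wave]) (simp add: symb_def inner_axis scaleR_conv_of_real)

lemma integral_wave: "(\<integral>x. wave k x \<partial>torus3) = (if k = 0 then 1 else 0)"
proof (cases "k = 0")
  case True
  have "(\<integral>x. wave k x \<partial>torus3) = (\<integral>x. 1 \<partial>torus3)" by (simp add: True)
  thus ?thesis using True by (simp add: measure_torus3_space)
next
  case False
  then obtain i where i: "k $ i \<noteq> 0" by (auto simp: vec_eq_iff)
  \<comment> \<open>Differentiation multiplies the wave by a nonzero factor but annihilates its integral.\<close>
  have "(\<integral>x. pd i (wave k) x \<partial>torus3) = 0"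
  proof (rule integral_pd_periodic[OF periodic_wave])
    show "wave k differentiable at x" for x
      using has_derivative_wave differentiable_def by blast
    show "continuous_on UNIV (pd i (wave k))"
      unfolding pd_wave by (intro continuous_intros)
  qed
  hence "symb i k * (\<integral>x. wave k x \<partial>torus3) = 0"
    by (simp add: pd_wave)
  moreover have "symb i k \<noteq> 0" using i by (simp add: symb_def)
  ultimately show ?thesis using False by simp
qed

section \<open>The space of square integrable fields\<close>

lemma borel_measurable_component [measurable]:
  fixes f :: "_ \<Rightarrow> 'b::euclidean_space ^ 'n::finite"
  assumes "f \<in> borel_measurable M"
  shows "(\<lambda>x. f x $ i) \<in> borel_measurable M"
proof -
  have "(\<lambda>v::'b^'n. v $ i) \<in> borel_measurable borel"
    by (intro borel_measurable_continuous_onI continuous_intros)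
  from measurable_compose[OF assms this] show ?thesis .
qed

lemma L2_measurable: "f \<in> L2 \<Longrightarrow> f \<in> borel_measurable torus3"
  by (simp add: L2_def)

lemma inner_le_sum_squares: "\<bar>x \<bullet> y\<bar> \<le> (norm x)\<^sup>2 + (norm y)\<^sup>2" for x y :: "'a::real_inner"
proof -
  have "\<bar>x \<bullet> y\<bar> \<le> norm x * norm y" by (rule Cauchy_Schwarz_ineq2)
  also have "\<dots> \<le> (norm x)\<^sup>2 + (norm y)\<^sup>2"
    using sum_squares_bound[of "norm x" "norm y"] zero_le_power2[of "norm x"] zero_le_power2[of "norm y"]
     mult_nonneg_nonneg[OF norm_ge_zero[of x] norm_ge_zero[of y]]
    by linarith
  finally show ?thesis .
qed

lemma L2_integrable_inner:
  assumes f: "f \<in> L2" and g: "g \<in> L2"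
  shows "integrable torus3 (\<lambda>x. f x \<bullet> g x)"
proof (rule Bochner_Integration.integrable_bound)
  show "integrable torus3 (\<lambda>x. (norm (f x))\<^sup>2 + (norm (g x))\<^sup>2)"
    using assms by (auto simp: L2_def)
  show "(\<lambda>x. f x \<bullet> g x) \<in> borel_measurable torus3"
    using L2_measurable[OF f] L2_measurable[OF g] by measurable
  show "AE x in torus3. norm (f x \<bullet> g x) \<le> norm ((norm (f x))\<^sup>2 + (norm (g x))\<^sup>2)"
    using inner_le_sum_squares[of "f x" "g x" for x] by (simp add: abs_of_nonneg)
qed

lemma L2_continuous: "continuous_on UNIV f \<Longrightarrow> f \<in> L2"
  unfolding L2_def
  by (auto intro!: borel_measurable_torus3_continuous integrable_torus3_continuous continuous_intros)

lemma L2_scaleR [intro]: "f \<in> L2 \<Longrightarrow> (\<lambda>x. c *\<^sub>R f x) \<in> L2"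
  by (auto simp: L2_def power_mult_distrib)

lemma L2_add [intro]:
  assumes f: "f \<in> L2" and g: "g \<in> L2"
  shows "(\<lambda>x. f x + g x) \<in> L2"
proof -
  have "integrable torus3 (\<lambda>x. (norm (f x))\<^sup>2 + 2 * (f x \<bullet> g x) + (norm (g x))\<^sup>2)"
    using L2_integrable_inner[OF f g] assms by (auto simp: L2_def)
  moreover have "(\<lambda>x. (norm (f x))\<^sup>2 + 2 * (f x \<bullet> g x) + (norm (g x))\<^sup>2) = (\<lambda>x. (norm (f x + g x))\<^sup>2)"
    by (auto simp: power2_norm_eq_inner inner_add inner_commute)
  ultimately show ?thesis using assms by (auto simp: L2_def)
qed

lemma L2_uminus [intro]: "f \<in> L2 \<Longrightarrow> (\<lambda>x. - f x) \<in> L2"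
  by (auto simp: L2_def)

lemma L2_diff [intro]: "f \<in> L2 \<Longrightarrow> g \<in> L2 \<Longrightarrow> (\<lambda>x. f x - g x) \<in> L2"
  using L2_add[of f "\<lambda>x. - g x"] L2_uminus[of g] by simp

lemma l2_inner_add_left:
  "f \<in> L2 \<Longrightarrow> g \<in> L2 \<Longrightarrow> h \<in> L2 \<Longrightarrow> l2_inner (\<lambda>x. f x + g x) h = l2_inner f h + l2_inner g h"
  by (simp add: l2_inner_def inner_add_left L2_integrable_inner)

lemma l2_inner_diff_left:
  "f \<in> L2 \<Longrightarrow> g \<in> L2 \<Longrightarrow> h \<in> L2 \<Longrightarrow> l2_inner (\<lambda>x. f x - g x) h = l2_inner f h - l2_inner g h"
  by (simp add: l2_inner_def inner_diff_left L2_integrable_inner)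

lemma l2_inner_commute: "l2_inner f g = l2_inner g f"
  by (simp add: l2_inner_def inner_commute)

lemma l2_inner_add_right:
  "f \<in> L2 \<Longrightarrow> g \<in> L2 \<Longrightarrow> h \<in> L2 \<Longrightarrow> l2_inner h (\<lambda>x. f x + g x) = l2_inner h f + l2_inner h g"
  by (simp add: l2_inner_commute[of h] l2_inner_add_left)

lemma l2_inner_diff_right:
  "f \<in> L2 \<Longrightarrow> g \<in> L2 \<Longrightarrow> h \<in> L2 \<Longrightarrow> l2_inner h (\<lambda>x. f x - g x) = l2_inner h f - l2_inner h g"
  by (simp add: l2_inner_commute[of h] l2_inner_diff_left)

lemma l2_inner_scaleR_left: "l2_inner (\<lambda>x. c *\<^sub>R f x) g = c * l2_inner f g"
  by (simp add: l2_inner_def)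

lemma l2_inner_scaleR_right: "l2_inner f (\<lambda>x. c *\<^sub>R g x) = c * l2_inner f g"
  by (simp add: l2_inner_def)

lemma l2_inner_self_nonneg: "l2_inner f f \<ge> 0"
  by (simp add: l2_inner_def)

lemma l2_norm_nonneg [simp]: "l2_norm f \<ge> 0"
  by (simp add: l2_norm_def l2_inner_self_nonneg)

lemma l2_norm_power2: "(l2_norm f)\<^sup>2 = l2_inner f f"
  by (simp add: l2_norm_def l2_inner_self_nonneg)

lemma l2_norm_cong_AE:
  assumes "AE x in torus3. f x = g x" "f \<in> L2" "g \<in> L2"
  shows "l2_norm f = l2_norm g"
proof -
  have "l2_inner f f = l2_inner g g"
    unfolding l2_inner_def
    by (rule integral_cong_AE)
       (use assms in \<open>auto intro!: borel_measurable_integrable L2_integrable_inner\<close>)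
  thus ?thesis by (simp add: l2_norm_def)
qed

lemma l2_norm_scaleR: "l2_norm (\<lambda>x. c *\<^sub>R f x) = \<bar>c\<bar> * l2_norm f"
  by (simp add: l2_norm_def l2_inner_scaleR_left l2_inner_scaleR_right real_sqrt_mult
      real_sqrt_mult_self flip: mult.assoc)

lemma l2_norm_minus_commute: "l2_norm (\<lambda>x. f x - g x) = l2_norm (\<lambda>x. g x - f x)"
  using l2_norm_scaleR[of "-1" "\<lambda>x. f x - g x"] by simp

lemma l2_Cauchy_Schwarz:
  assumes f: "f \<in> L2" and g: "g \<in> L2"
  shows "\<bar>l2_inner f g\<bar> \<le> l2_norm f * l2_norm g"
proof -
  have "0 \<le> l2_inner f f + 2 * t * l2_inner f g + t\<^sup>2 * l2_inner g g" for t
  proof -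
    have "l2_inner (\<lambda>x. f x + t *\<^sub>R g x) (\<lambda>x. f x + t *\<^sub>R g x) \<ge> 0" by (rule l2_inner_self_nonneg)
    thus ?thesis using f g
      by (simp add: l2_inner_add_left l2_inner_add_right L2_scaleR L2_add l2_inner_scaleR_left
        l2_inner_scaleR_right l2_inner_commute[of g f] power2_eq_square algebra_simps)
  qed
  hence *: "0 \<le> l2_inner f f + 2 * t * l2_inner f g + t\<^sup>2 * l2_inner g g" for t by blast
  have "(l2_inner f g)\<^sup>2 \<le> l2_inner f f * l2_inner g g"
  proof (cases "l2_inner g g = 0")
    case True
    have "l2_inner f g = 0"
    proof (rule ccontr)
      assume n: "l2_inner f g \<noteq> 0"
      \<comment> \<open>The quadratic polynomial in t is affine here, and this t makes it equal to -1.\<close>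
      show False using *[of "- (l2_inner f f + 1) / (2 * l2_inner f g)"] n True by (simp add: field_simps)
    qed
    thus ?thesis using True by simp
  next
    case False
    hence p: "l2_inner g g > 0" using l2_inner_self_nonneg[of g] by simp
    show ?thesis using *[of "- l2_inner f g / l2_inner g g"] p
      by (simp add: field_simps power2_eq_square)
  qed
  hence "(l2_inner f g)\<^sup>2 \<le> (l2_norm f * l2_norm g)\<^sup>2"
    by (simp add: power_mult_distrib l2_norm_power2)
  thus ?thesis by (rule abs_le_square_iff[THEN iffD2, THEN order_trans]) simp
qed

lemma l2_norm_triangle:
  assumes f: "f \<in> L2" and g: "g \<in> L2"
  shows "l2_norm (\<lambda>x. f x + g x) \<le> l2_norm f + l2_norm g"
proof (rule power2_le_imp_le)
  have "(l2_norm (\<lambda>x. f x + g x))\<^sup>2 = (l2_norm f)\<^sup>2 + 2 * l2_inner f g + (l2_norm g)\<^sup>2"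
    using assms by (simp add: l2_norm_power2 l2_inner_add_left l2_inner_add_right L2_add l2_inner_commute[of g f])
  also have "\<dots> \<le> (l2_norm f)\<^sup>2 + 2 * (l2_norm f * l2_norm g) + (l2_norm g)\<^sup>2"
    using l2_Cauchy_Schwarz[OF assms] by simp
  finally show "(l2_norm (\<lambda>x. f x + g x))\<^sup>2 \<le> (l2_norm f + l2_norm g)\<^sup>2"
    by (simp add: power2_sum)
qed simp

lemma l2_inner_tendsto:
  assumes "\<And>n. f n \<in> L2" "f' \<in> L2" "h \<in> L2"
    and "(\<lambda>n. l2_norm (\<lambda>x. f n x - f' x)) \<longlonglongrightarrow> 0"
  shows "(\<lambda>n. l2_inner (f n) h) \<longlonglongrightarrow> l2_inner f' h"
proof -
  have "(\<lambda>n. l2_inner (f n) h - l2_inner f' h) \<longlonglongrightarrow> 0"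
  proof (rule Lim_null_comparison)
    show "eventually (\<lambda>n. norm (l2_inner (f n) h - l2_inner f' h) \<le> l2_norm (\<lambda>x. f n x - f' x) * l2_norm h) sequentially"
      using l2_Cauchy_Schwarz[of "\<lambda>x. f n x - f' x" h for n] assms
      by (intro always_eventually) (simp add: l2_inner_diff_left L2_diff)
    show "(\<lambda>n. l2_norm (\<lambda>x. f n x - f' x) * l2_norm h) \<longlonglongrightarrow> 0"
      using tendsto_mult[OF assms(4) tendsto_const[of "l2_norm h"]] by simp
  qed
  thus ?thesis by (simp add: LIM_zero_iff)
qed

lemma l2_norm_tendsto:
  assumes f: "\<And>n. f n \<in> L2" "f' \<in> L2"
    and lim: "(\<lambda>n. l2_norm (\<lambda>x. f n x - f' x)) \<longlonglongrightarrow> 0"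
  shows "(\<lambda>n. l2_norm (f n)) \<longlonglongrightarrow> l2_norm f'"
proof -
  have "(\<lambda>n. l2_norm (f n) - l2_norm f') \<longlonglongrightarrow> 0"
  proof (rule Lim_null_comparison[OF always_eventually lim], rule allI)
    fix n
    have "l2_norm (f n) \<le> l2_norm (\<lambda>x. f n x - f' x) + l2_norm f'"
      using l2_norm_triangle[of "\<lambda>x. f n x - f' x" f'] f by (simp add: L2_diff)
    moreover have "l2_norm f' \<le> l2_norm (\<lambda>x. f' x - f n x) + l2_norm (f n)"
      using l2_norm_triangle[of "\<lambda>x. f' x - f n x" "f n"] f by (simp add: L2_diff)
    ultimately show "norm (l2_norm (f n) - l2_norm f') \<le> l2_norm (\<lambda>x. f n x - f' x)"
      using l2_norm_minus_commute[of f' "f n"] by simp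
  qed
  thus ?thesis by (simp add: LIM_zero_iff)
qed

text \<open>Cauchy-Schwarz against a constant unit field, as the torus has measure one.\<close>

lemma integral_norm_le_l2_norm:
  assumes f: "f \<in> L2"
  shows "integrable torus3 (\<lambda>x. norm (f x))" "(\<integral>x. norm (f x) \<partial>torus3) \<le> l2_norm f"
proof -
  let ?e = "axis 1 (1::real) :: real^3"
  have ne: "norm ?e = 1" by (simp add: norm_axis_1)
  define F where "F = (\<lambda>x. norm (f x) *\<^sub>R ?e)"
  have F: "F \<in> L2" using f by (auto simp: F_def L2_def ne)
  have c: "(\<lambda>x. ?e) \<in> L2" by (rule L2_continuous) simp
  have eq: "(\<lambda>x. F x \<bullet> ?e) = (\<lambda>x. norm (f x))"
    by (simp add: F_def ne flip: power2_norm_eq_inner)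
  show "integrable torus3 (\<lambda>x. norm (f x))"
    using L2_integrable_inner[OF F c] eq by simp
  have "l2_norm (\<lambda>x. ?e) = 1" "l2_norm F = l2_norm f"
    by (simp_all add: l2_norm_def l2_inner_def F_def ne measure_torus3_space flip: power2_norm_eq_inner)
  thus "(\<integral>x. norm (f x) \<partial>torus3) \<le> l2_norm f"
    using l2_Cauchy_Schwarz[OF F c] eq by (simp add: l2_inner_def)
qed

lemma nn_integral_norm_square:
  "f \<in> L2 \<Longrightarrow> (\<integral>\<^sup>+x. ennreal ((norm (f x))\<^sup>2) \<partial>torus3) = ennreal ((l2_norm f)\<^sup>2)"
  unfolding l2_norm_power2 l2_inner_def power2_norm_eq_inner[symmetric]
  by (rule nn_integral_eq_integral) (auto simp: L2_def)

lemma L2_of_nn_integral: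
  assumes "f \<in> borel_measurable torus3" "(\<integral>\<^sup>+x. ennreal ((norm (f x))\<^sup>2) \<partial>torus3) \<le> ennreal (c\<^sup>2)" "c \<ge> 0"
  shows "f \<in> L2" "l2_norm f \<le> c"
proof -
  show f: "f \<in> L2"
    using assms unfolding L2_def by (auto intro!: integrableI_bounded simp: le_less_trans)
  have "(l2_norm f)\<^sup>2 \<le> c\<^sup>2"
    using assms(2) nn_integral_norm_square[OF f] by simp
  thus "l2_norm f \<le> c" using assms(3) by (rule power2_le_imp_le)
qed

text \<open>Along a rapidly convergent subsequence the increments are summable in the mean,
  hence almost everywhere; the pointwise limit is the limit in the norm by Fatou's lemma.\<close>

lemma L2_complete:
  assumes f: "\<And>n. f n \<in> L2"
    and Cauchy: "\<And>\<epsilon>. \<epsilon> > 0 \<Longrightarrow> \<exists>N. \<forall>m\<ge>N. \<forall>n\<ge>N. l2_norm (\<lambda>x. f m x - f n x) < \<epsilon>"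
  shows "\<exists>g\<in>L2. (\<lambda>n. l2_norm (\<lambda>x. f n x - g x)) \<longlonglongrightarrow> 0"
proof -
  note [measurable] = L2_measurable[OF f]
  have "\<exists>N. \<forall>m\<ge>N. \<forall>n\<ge>N. l2_norm (\<lambda>x. f m x - f n x) < (1/2)^j" for j :: nat
    by (rule Cauchy) simp
  then obtain N where N: "\<And>j m n. m \<ge> N j \<Longrightarrow> n \<ge> N j \<Longrightarrow> l2_norm (\<lambda>x. f m x - f n x) < (1/2)^j"
    by metis
  define r where "r j = (\<Sum>i\<le>j. N i)" for j
  have rN: "r j \<ge> N i" if "i \<le> j" for i j
    unfolding r_def by (rule member_le_sum) (use that in auto)
  define d where "d j x = norm (f (r (Suc j)) x - f (r j) x)" for j x
  have [measurable]: "d j \<in> borel_measurable torus3" for j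
    unfolding d_def by measurable
  have "(\<integral>\<^sup>+x. (\<Sum>j. ennreal (d j x)) \<partial>torus3) = (\<Sum>j. \<integral>\<^sup>+x. ennreal (d j x) \<partial>torus3)"
    by (rule nn_integral_suminf) simp
  also have "\<dots> \<le> (\<Sum>j. ennreal ((1/2)^j))"
  proof (rule suminf_le)
    fix j
    have i: "(\<lambda>x. f (r (Suc j)) x - f (r j) x) \<in> L2" using f by auto
    have "(\<integral>\<^sup>+x. ennreal (d j x) \<partial>torus3) = ennreal (\<integral>x. d j x \<partial>torus3)"
      unfolding d_def by (rule nn_integral_eq_integral) (use integral_norm_le_l2_norm[OF i] in auto)
    also have "\<dots> \<le> ennreal ((1/2)^j)"
      using integral_norm_le_l2_norm(2)[OF i] N[OF rN rN, of j "Suc j" j] unfolding d_def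
      by (intro ennreal_leI) linarith
    finally show "(\<integral>\<^sup>+x. ennreal (d j x) \<partial>torus3) \<le> ennreal ((1/2)^j)" .
  qed auto
  also have "\<dots> = ennreal (\<Sum>j. (1/2)^j)"
    by (rule suminf_ennreal2) (auto simp: summable_geometric)
  also have "\<dots> < \<infinity>" by simp
  finally have "(\<integral>\<^sup>+x. (\<Sum>j. ennreal (d j x)) \<partial>torus3) \<noteq> \<infinity>" by simp
  hence "AE x in torus3. (\<Sum>j. ennreal (d j x)) \<noteq> \<infinity>"
    by (intro nn_integral_PInf_AE) auto
  hence conv: "AE x in torus3. convergent (\<lambda>j. f (r j) x)"
  proof eventually_elim
    case (elim x)
    hence "summable (\<lambda>j. d j x)"
      by (intro summable_suminf_not_top) (auto simp: d_def)
    hence "summable (\<lambda>j. f (r (Suc j)) x - f (r j) x)"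
      unfolding d_def by (rule summable_norm_cancel)
    hence "convergent (\<lambda>n. \<Sum>j<n. f (r (Suc j)) x - f (r j) x)"
      by (simp add: summable_iff_convergent)
    hence "convergent (\<lambda>n. f (r n) x - f (r 0) x)"
      by (simp add: sum_lessThan_telescope[of "\<lambda>j. f (r j) x"])
    from convergent_add[OF this convergent_const[of "f (r 0) x"]] show ?case by simp
  qed
  define g where "g x = lim (\<lambda>j. f (r j) x)" for x
  have gm [measurable]: "g \<in> borel_measurable torus3"
    unfolding g_def by (rule borel_measurable_lim_metric) auto
  have bound: "(\<lambda>x. f m x - g x) \<in> L2 \<and> l2_norm (\<lambda>x. f m x - g x) \<le> (1/2)^j" if m: "m \<ge> N j" for m j
  proof -
    have "(\<integral>\<^sup>+x. ennreal ((norm (f m x - g x))\<^sup>2) \<partial>torus3)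
        = (\<integral>\<^sup>+x. liminf (\<lambda>n. ennreal ((norm (f m x - f (r n) x))\<^sup>2)) \<partial>torus3)"
    proof (rule nn_integral_cong_AE, use conv in eventually_elim)
      case (elim x)
      hence "(\<lambda>n. f (r n) x) \<longlonglongrightarrow> g x" unfolding g_def by (simp add: convergent_LIMSEQ_iff)
      hence "(\<lambda>n. ennreal ((norm (f m x - f (r n) x))\<^sup>2)) \<longlonglongrightarrow> ennreal ((norm (f m x - g x))\<^sup>2)"
        by (intro tendsto_intros tendsto_ennrealI)
      from lim_imp_Liminf[OF _ this] show ?case by simp
    qed
    also have "\<dots> \<le> liminf (\<lambda>n. \<integral>\<^sup>+x. ennreal ((norm (f m x - f (r n) x))\<^sup>2) \<partial>torus3)"
      by (rule nn_integral_liminf) simp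
    also have "\<dots> \<le> ennreal (((1/2)^j)\<^sup>2)"
    proof (rule Liminf_le, simp, rule eventually_sequentiallyI)
      fix n assume "n \<ge> j"
      hence "r n \<ge> N j" by (rule rN)
      hence "l2_norm (\<lambda>x. f m x - f (r n) x) \<le> (1/2)^j" using N[OF m] by (simp add: less_imp_le)
      hence "(l2_norm (\<lambda>x. f m x - f (r n) x))\<^sup>2 \<le> ((1/2)^j)\<^sup>2" by (rule power_mono) simp
      thus "(\<integral>\<^sup>+x. ennreal ((norm (f m x - f (r n) x))\<^sup>2) \<partial>torus3) \<le> ennreal (((1/2)^j)\<^sup>2)"
        using nn_integral_norm_square[of "\<lambda>x. f m x - f (r n) x"] f by (simp add: L2_diff ennreal_leI)
    qed
    finally show ?thesis
      using L2_of_nn_integral[of "\<lambda>x. f m x - g x" "(1/2)^j"] by simp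
  qed
  have "g \<in> L2"
    using L2_diff[OF f[of "N 0"], of "\<lambda>x. f (N 0) x - g x"] bound[of 0 "N 0"] by simp
  moreover have "(\<lambda>n. l2_norm (\<lambda>x. f n x - g x)) \<longlonglongrightarrow> 0"
  proof (rule LIMSEQ_I)
    fix \<epsilon> :: real assume "\<epsilon> > 0"
    then obtain j where "(1/2)^j < \<epsilon>" using real_arch_pow_inv[of \<epsilon> "1/2"] by auto
    thus "\<exists>no. \<forall>n\<ge>no. norm (l2_norm (\<lambda>x. f n x - g x) - 0) < \<epsilon>"
      using bound[where j=j] by (intro exI[of _ "N j"]) (auto intro: le_less_trans)
  qed
  ultimately show ?thesis by blast
qed

section \<open>Completeness of the trigonometric system\<close>

lemma AE_zero_of_integrals_over_Borel_sets:
  fixes g :: "'a \<Rightarrow> real"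
  assumes g: "integrable M g" and 0: "\<And>B. B \<in> sets M \<Longrightarrow> (LINT x:B|M. g x) = 0"
  shows "AE x in M. g x = 0"
proof -
  note [measurable] = borel_measurable_integrable[OF g]
  have AE: "AE x in M. \<not> s * g x > 0" if "s = 1 \<or> s = -1" for s
  proof -
    let ?B = "{x \<in> space M. s * g x > 0}"
    let ?f = "\<lambda>x. indicator ?B x * (s * g x)"
    have int: "integrable M ?f"
      using integrable_mult_indicator[of ?B M "\<lambda>x. s * g x"] g by simp
    have "(\<integral>x. ?f x \<partial>M) = s * (LINT x:?B|M. g x)"
      unfolding set_lebesgue_integral_def by (subst Bochner_Integration.integral_mult_right_zero[symmetric])
        (auto intro!: Bochner_Integration.integral_cong simp: mult_ac)
    hence "(\<integral>x. ?f x \<partial>M) = 0" using 0[of ?B] by simp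
    moreover have "AE x in M. ?f x \<ge> 0"
      by (intro always_eventually) (auto simp: indicator_def)
    ultimately have "AE x in M. ?f x = 0"
      using integral_nonneg_eq_0_iff_AE[OF int] by simp
    thus ?thesis using AE_space by eventually_elim (auto simp: indicator_def)
  qed
  have "AE x in M. \<not> 1 * g x > 0" "AE x in M. \<not> -1 * g x > 0" by (rule AE, simp)+
  thus ?thesis by eventually_elim simp
qed

text \<open>The lower orthants form an intersection-stable generator of the Borel sets, so that by Dynkin's
  theorem the integral vanishes over every Borel set. Passing to a Borel representative reduces the
  Lebesgue measurable case to this.\<close>

lemma AE_zero_of_integrals_atMost:
  fixes H :: "real^3 \<Rightarrow> real"
  assumes H: "integrable lebesgue H" and tot: "(\<integral>x. H x \<partial>lebesgue) = 0"
    and 0: "\<And>a. (\<integral>x. indicator {..a} x * H x \<partial>lebesgue) = 0"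
  shows "AE x in lebesgue. H x = 0"
proof -
  obtain g where g [measurable]: "g \<in> borel_measurable lborel" and AE: "AE x in lborel. H x = g x"
    using completion_ex_borel_measurable_real[of H lborel] H by auto
  have AE': "AE x in lebesgue. H x = g x" using AE by (rule AE_completion)
  have gm: "g \<in> borel_measurable lebesgue" using g by (rule measurable_completion)
  have "integrable lebesgue g"
    using integrable_cong_AE[of H lebesgue g] H gm AE' by auto
  hence gi: "integrable lborel g" using integrable_completion[OF g] by simp
  have eq: "(LINT x:B|lborel. g x) = (\<integral>x. indicator B x * H x \<partial>lebesgue)" if [measurable]: "B \<in> sets borel" for B
  proof -
    have "(LINT x:B|lborel. g x) = (\<integral>x. indicator B x * g x \<partial>lborel)"
      by (simp add: set_lebesgue_integral_def)
    also have "\<dots> = (\<integral>x. indicator B x * g x \<partial>lebesgue)"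
      by (rule integral_completion[symmetric]) measurable
    also have "\<dots> = (\<integral>x. indicator B x * H x \<partial>lebesgue)"
    proof (rule integral_cong_AE)
      show "AE x in lebesgue. indicator B x * g x = indicator B x * H x"
        using AE' by eventually_elim simp
      have "B \<in> sets lebesgue" by simp
      thus "(\<lambda>x. indicator B x * g x) \<in> borel_measurable lebesgue"
        "(\<lambda>x. indicator B x * H x) \<in> borel_measurable lebesgue"
        using gm borel_measurable_integrable[OF H]
        by (auto intro!: borel_measurable_times borel_measurable_indicator)
    qed
    finally show ?thesis .
  qed
  have si: "set_integrable lborel B g" if "B \<in> sets borel" for B
    unfolding set_integrable_def using integrable_mult_indicator[OF _ gi] that by simp
  have zero: "(LINT x:B|lborel. g x) = 0" if "B \<in> sets borel" for B
  proof -
    have B: "B \<in> sigma_sets UNIV (range atMost)" using that by (simp add: borel_eq_atMost)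
    have stable: "Int_stable (range (atMost :: real^3 \<Rightarrow> _))"
    proof -
      have "{..a} \<inter> {..b} = {..inf a b}" for a b :: "real^3" by auto
      thus ?thesis unfolding Int_stable_def by auto
    qed
    have sb: "sigma_sets UNIV (range (atMost :: real^3 \<Rightarrow> _)) = sets borel"
      by (simp add: borel_eq_atMost)
    have sub: "range (atMost :: real^3 \<Rightarrow> _) \<subseteq> Pow UNIV" by simp
    from stable sub B show ?thesis
    proof (induction rule: sigma_sets_induct_disjoint)
      case (basic A)
      thus ?case using eq 0 by auto
    next
      case (compl A)
      hence A: "A \<in> sets borel" using sb by simp
      have "(LINT x:UNIV|lborel. g x) = (LINT x:A|lborel. g x) + (LINT x:UNIV - A|lborel. g x)"
        using set_integral_Un[of A "UNIV - A" lborel g] si A by (auto simp: Un_absorb1)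
      moreover have "(LINT x:UNIV|lborel. g x) = 0" using eq[of UNIV] tot by simp
      ultimately show ?case using compl by simp
    next
      case (union A)
      have A: "A i \<in> sets borel" for i using union(2) sb by auto
      have "(LINT x:(\<Union>i. A i)|lborel. g x) = (\<Sum>i. LINT x:A i|lborel. g x)"
        using A union(1)
        by (intro lebesgue_integral_countable_add si sets.countable_UN) (auto simp: disjoint_family_on_def)
      thus ?case using union(3) by simp
    qed (simp add: set_lebesgue_integral_def)
  qed
  have "AE x in lborel. g x = 0"
    by (rule AE_zero_of_integrals_over_Borel_sets[OF gi]) (use zero in simp)
  hence "AE x in lebesgue. g x = 0" by (rule AE_completion)
  thus ?thesis using AE' by eventually_elim simp
qed

text \<open>Defined as a linear span; that the span of the waves is also closed under products is what makes
  polynomials in trigonometric functions available for approximation.\<close>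

inductive_set trig_span :: "(real^3 \<Rightarrow> complex) set" where
  wave: "wave k \<in> trig_span"
| scale: "f \<in> trig_span \<Longrightarrow> (\<lambda>x. c * f x) \<in> trig_span"
| add: "f \<in> trig_span \<Longrightarrow> g \<in> trig_span \<Longrightarrow> (\<lambda>x. f x + g x) \<in> trig_span"

lemma trig_span_const: "(\<lambda>x. c) \<in> trig_span"
  using trig_span.scale[OF trig_span.wave[of 0], of c] by simp

lemma trig_span_mult:
  assumes "f \<in> trig_span" "g \<in> trig_span"
  shows "(\<lambda>x. f x * g x) \<in> trig_span"
  using assms
proof (induction arbitrary: g)
  case (wave k)
  thus ?case
  proof (induction)
    case (wave l)
    have "(\<lambda>x. wave k x * wave l x) = wave (k + l)" by (simp add: wave_add fun_eq_iff)
    thus ?case by (simp add: trig_span.wave)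
  next
    case (scale f c)
    from trig_span.scale[OF scale.IH, of c] show ?case by (simp add: mult_ac)
  next
    case (add f g)
    from trig_span.add[OF add.IH] show ?case by (simp add: ring_distribs)
  qed
next
  case (scale f c)
  from trig_span.scale[OF scale.IH[OF scale.prems], of c] show ?case by (simp add: mult_ac)
next
  case (add f g h)
  from trig_span.add[OF add.IH(1)[OF add.prems] add.IH(2)[OF add.prems]] show ?case by (simp add: ring_distribs)
qed

lemma trig_span_prod:
  assumes "finite I" "\<And>i. i \<in> I \<Longrightarrow> (\<lambda>x. f i x) \<in> trig_span"
  shows "(\<lambda>x. \<Prod>i\<in>I. f i x) \<in> trig_span"
  using assms by (induction rule: finite_induct) (auto intro: trig_span_mult trig_span_const)

lemma trig_span_real_polynomial:
  assumes "real_polynomial_function p" "(\<lambda>x. complex_of_real (f x)) \<in> trig_span"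
  shows "(\<lambda>x. complex_of_real (p (f x))) \<in> trig_span"
  using assms
proof (induction)
  case (linear p)
  have "p y = p 1 * y" for y
    using linear_cmul[OF bounded_linear.linear[OF linear(1)], of y 1] by simp
  hence "(\<lambda>x. complex_of_real (p (f x))) = (\<lambda>x. complex_of_real (p 1) * of_real (f x))"
    by (metis of_real_mult)
  thus ?case using trig_span.scale[OF linear(2)] by simp
qed (auto intro: trig_span_const trig_span.add trig_span_mult)

lemma continuous_on_trig_span: "f \<in> trig_span \<Longrightarrow> continuous_on UNIV f"
  by (induction rule: trig_span.induct) (auto intro!: continuous_intros)

text \<open>For a in [0,1] and a coordinate of x strictly between 0 and 1, the sign of this function is the sign of
  the difference of a and that coordinate.\<close>

lemma trig_span_sin_sin:
  "(\<lambda>x. complex_of_real (2 * sin (pi * x $ i) * sin (pi * (a - x $ i)))) \<in> trig_span"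
proof -
  let ?e = "axis i 1 :: int^3"
  have "freq ?e \<bullet> x = x $ i" for x
  proof -
    have "freq ?e = axis i 1" by (simp add: vec_eq_iff axis_def)
    thus ?thesis by (simp add: inner_axis')
  qed
  hence w: "wave ?e x = cis (2 * pi * x $ i)" for x by (simp add: wave_def)
  have "(\<lambda>x. (cis (- (pi * a)) / 2) * wave ?e x + ((cis (pi * a) / 2) * wave (- ?e) x + (- complex_of_real (cos (pi * a))))) \<in> trig_span"
    by (intro trig_span.add trig_span.scale trig_span.wave trig_span_const)
  also have "(\<lambda>x. (cis (- (pi * a)) / 2) * wave ?e x + ((cis (pi * a) / 2) * wave (- ?e) x + (- complex_of_real (cos (pi * a)))))
      = (\<lambda>x. complex_of_real (2 * sin (pi * x $ i) * sin (pi * (a - x $ i))))"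
  proof
    fix x :: "real^3"
    define y where "y = pi * x $ i"
    define b where "b = pi * a"
    have "(cis (- b) / 2) * cis (2 * y) + (cis b / 2) * cnj (cis (2 * y)) = complex_of_real (cos (2 * y - b))"
      by (simp add: cis_mult cis_cnj complex_eq_iff) (simp add: cos_diff sin_diff cos_add sin_add field_simps)
    moreover have "cos (2 * y - b) - cos b = 2 * sin y * sin (b - y)"
    proof -
      have "(2 * y - b + b) / 2 = y" "(b - (2 * y - b)) / 2 = b - y" by (simp_all add: field_simps)
      thus ?thesis using cos_diff_cos[of "2 * y - b" b] by (simp only:)
    qed
    ultimately show "(cis (- (pi * a)) / 2) * wave ?e x + ((cis (pi * a) / 2) * wave (- ?e) x + (- complex_of_real (cos (pi * a))))
      = complex_of_real (2 * sin (pi * x $ i) * sin (pi * (a - x $ i)))"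
      unfolding wave_uminus w by (simp add: y_def b_def algebra_simps flip: of_real_diff)
  qed
  finally show ?thesis .
qed

text \<open>The step function is a pointwise limit of the continuous ramps min 1 (max 0 (n y)), to which the
  Weierstrass theorem applies. The interval [-2,2] contains the values of the trigonometric
  functions that are substituted for y.\<close>

lemma polynomial_approx_step:
  obtains p :: "nat \<Rightarrow> real \<Rightarrow> real" where "\<And>n. real_polynomial_function (p n)"
    "\<And>n y. \<bar>y\<bar> \<le> 2 \<Longrightarrow> \<bar>p n y\<bar> \<le> 2"
    "\<And>y. \<bar>y\<bar> \<le> 2 \<Longrightarrow> y \<noteq> 0 \<Longrightarrow> (\<lambda>n. p n y) \<longlonglongrightarrow> (if y > 0 then 1 else 0)"
proof -
  define r where "r n y = min 1 (max 0 (real n * y))" for n y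
  have "\<exists>p. real_polynomial_function p \<and> (\<forall>y\<in>cbox (-2) 2. \<bar>r n y - p y\<bar> < 1 / Suc n)" for n
    by (rule Stone_Weierstrass_real_polynomial_function[of "cbox (-2) 2" "r n" "1 / Suc n"])
      (auto simp: r_def intro!: continuous_intros)
  then obtain p where p: "\<And>n. real_polynomial_function (p n)"
    "\<And>n y. \<bar>y\<bar> \<le> 2 \<Longrightarrow> \<bar>r n y - p n y\<bar> < 1 / Suc n"
    by (metis (no_types, lifting) abs_le_iff box_real(2) atLeastAtMost_iff minus_le_iff)
  show ?thesis
  proof
    show "real_polynomial_function (p n)" for n by (rule p)
    show "\<bar>p n y\<bar> \<le> 2" if "\<bar>y\<bar> \<le> 2" for n y
    proof -
      have "1 / real (Suc n) \<le> 1" by simp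
      moreover have "0 \<le> r n y" "r n y \<le> 1" by (auto simp: r_def)
      ultimately show ?thesis using p(2)[OF that, of n] by linarith
    qed
    show "(\<lambda>n. p n y) \<longlonglongrightarrow> (if y > 0 then 1 else 0)" if y: "\<bar>y\<bar> \<le> 2" "y \<noteq> 0" for y
    proof -
      have "(\<lambda>n. r n y) \<longlonglongrightarrow> (if y > 0 then 1 else 0)"
      proof (rule tendsto_eventually)
        obtain N :: nat where N: "real N > 1 / \<bar>y\<bar>" using reals_Archimedean2 by blast
        show "eventually (\<lambda>n. r n y = (if y > 0 then 1 else 0)) sequentially"
        proof (rule eventually_sequentiallyI)
          fix n assume "n \<ge> N"
          hence "real n > 1 / \<bar>y\<bar>" using N by linarith
          hence "y > 0 \<Longrightarrow> real n * y \<ge> 1" using y by (simp add: field_simps)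
          moreover have "\<not> y > 0 \<Longrightarrow> real n * y \<le> 0" using y by (simp add: mult_nonneg_nonpos)
          ultimately show "r n y = (if y > 0 then 1 else 0)" by (auto simp: r_def)
        qed
      qed
      moreover have "(\<lambda>n. r n y - p n y) \<longlonglongrightarrow> 0"
      proof (rule Lim_null_comparison[OF always_eventually])
        show "\<forall>n. norm (r n y - p n y) \<le> 1 / Suc n" using p(2)[OF y(1)] by (auto intro: less_imp_le)
        show "(\<lambda>n. 1 / real (Suc n)) \<longlonglongrightarrow> 0" using lim_inverse_n' LIMSEQ_Suc by fastforce
      qed
      ultimately have "(\<lambda>n. r n y - (r n y - p n y)) \<longlonglongrightarrow> (if y > 0 then 1 else 0) - 0"
        by (intro tendsto_diff)
      thus ?thesis by simp
    qed
  qed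
qed

lemma AE_torus3_off_hyperplane: "AE x in torus3. x $ i \<noteq> c"
proof -
  have "{x::real^3. x $ i = c} \<in> null_sets lebesgue"
    using negligible_standard_hyperplane[of "axis i 1 :: real^3" c]
    by (simp add: axis_in_Basis_iff inner_axis negligible_iff_null_sets)
  hence "AE x in lebesgue. x \<notin> {x::real^3. x $ i = c}" by (rule AE_not_in)
  thus ?thesis unfolding torus3_def by (subst AE_restrict_space_iff) auto
qed

lemma mem_unit_cube: "x \<in> cbox 0 (One::real^3) \<longleftrightarrow> (\<forall>i. 0 \<le> x $ i \<and> x $ i \<le> 1)"
  by (simp add: mem_box_cart One_nth del: sum_component)

text \<open>Products of polynomials in one-dimensional trigonometric polynomials converge boundedly to the
  indicators of the sub-boxes at the origin, and these generate the Borel sets.\<close>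

lemma AE_zero_of_orthogonal_waves:
  fixes h :: "real^3 \<Rightarrow> real"
  assumes h: "integrable torus3 h"
    and 0: "\<And>k. (\<integral>x. wave k x * of_real (h x) \<partial>torus3) = 0"
  shows "AE x in torus3. h x = 0"
proof -
  note [measurable] = borel_measurable_integrable[OF h]
  have bdd: "\<exists>B. \<forall>x\<in>cbox 0 One. norm (f x) \<le> B" if "f \<in> trig_span" for f
    using compact_imp_bounded[OF compact_continuous_image[OF continuous_on_subset[OF continuous_on_trig_span[OF that] subset_UNIV] compact_cbox]]
    unfolding bounded_iff by auto
  have int: "integrable torus3 (\<lambda>x. f x * of_real (h x))" if f: "f \<in> trig_span" for f
  proof -
    obtain B where B: "\<And>x. x \<in> cbox 0 One \<Longrightarrow> norm (f x) \<le> B" using bdd[OF f] by auto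
    have [measurable]: "f \<in> borel_measurable torus3"
      by (rule borel_measurable_torus3_continuous[OF continuous_on_trig_span[OF f]])
    show ?thesis
    proof (rule Bochner_Integration.integrable_bound)
      show "integrable torus3 (\<lambda>x. B * h x)" using h by simp
      show "AE x in torus3. norm (f x * of_real (h x)) \<le> norm (B * h x)"
        by (rule AE_I2) (simp add: norm_mult abs_mult, intro mult_right_mono order_trans[OF B] abs_ge_self, auto)
    qed measurable
  qed
  have span0: "(\<integral>x. f x * of_real (h x) \<partial>torus3) = 0" if "f \<in> trig_span" for f
    using that
  proof (induction)
    case (wave k) thus ?case by (rule 0)
  next
    case (scale f c) thus ?case by (simp add: mult.assoc)
  next
    case (add f g) thus ?case using int by (simp add: distrib_right)
  qed
  have real0: "(\<integral>x. f x * h x \<partial>torus3) = 0" if "(\<lambda>x. complex_of_real (f x)) \<in> trig_span" for f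
  proof -
    have "complex_of_real (\<integral>x. f x * h x \<partial>torus3) = (\<integral>x. complex_of_real (f x * h x) \<partial>torus3)"
      by (rule integral_complex_of_real[symmetric])
    also have "\<dots> = 0" using span0[OF that] by simp
    finally show ?thesis by simp
  qed
  obtain p :: "nat \<Rightarrow> real \<Rightarrow> real" where p: "\<And>n. real_polynomial_function (p n)"
    "\<And>n y. \<bar>y\<bar> \<le> 2 \<Longrightarrow> \<bar>p n y\<bar> \<le> 2"
    "\<And>y. \<bar>y\<bar> \<le> 2 \<Longrightarrow> y \<noteq> 0 \<Longrightarrow> (\<lambda>n. p n y) \<longlonglongrightarrow> (if y > 0 then 1 else 0)"
    using polynomial_approx_step by blast
  have box0: "(\<integral>x. indicator {..a} x * h x \<partial>torus3) = 0" if a: "\<And>i. 0 \<le> a $ i" "\<And>i. a $ i \<le> 1" for a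
  proof -
    define s where "s i x = 2 * sin (pi * x $ i) * sin (pi * (a $ i - x $ i))" for i and x :: "real^3"
    define \<phi> where "\<phi> n x = (\<Prod>i\<in>UNIV. p n (s i x))" for n x
    have s2: "\<bar>s i x\<bar> \<le> 2" for i x
    proof -
      have "\<bar>s i x\<bar> = 2 * (\<bar>sin (pi * x $ i)\<bar> * \<bar>sin (pi * (a $ i - x $ i))\<bar>)"
        by (simp add: s_def abs_mult)
      also have "\<dots> \<le> 2 * (1 * 1)"
        by (intro mult_left_mono mult_mono) auto
      finally show ?thesis by simp
    qed
    have \<phi>: "(\<lambda>x. complex_of_real (\<phi> n x)) \<in> trig_span" for n
      unfolding \<phi>_def of_real_prod s_def
      by (rule trig_span_prod[OF finite], rule trig_span_real_polynomial[OF p(1) trig_span_sin_sin])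
    have [measurable]: "\<phi> n \<in> borel_measurable torus3" for n
    proof -
      have "continuous_on UNIV (\<lambda>x. Re (complex_of_real (\<phi> n x)))"
        by (intro continuous_intros continuous_on_trig_span \<phi>)
      thus ?thesis by (intro borel_measurable_torus3_continuous) simp
    qed
    have "{..a} \<in> sets lebesgue" by simp
    hence [measurable]: "(\<lambda>x. indicator {..a} x :: real) \<in> borel_measurable torus3"
      unfolding torus3_def by (rule measurable_restrict_space1[OF borel_measurable_indicator])
    have "(\<lambda>n. \<integral>x. \<phi> n x * h x \<partial>torus3) \<longlonglongrightarrow> (\<integral>x. indicator {..a} x * h x \<partial>torus3)"
    proof (rule integral_dominated_convergence[where w="\<lambda>x. 2 ^ CARD(3) * \<bar>h x\<bar>"])
      show "AE x in torus3. (\<lambda>n. \<phi> n x * h x) \<longlonglongrightarrow> indicator {..a} x * h x"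
      proof -
        have "AE x in torus3. \<forall>i\<in>UNIV. x $ i \<noteq> 0 \<and> x $ i \<noteq> 1 \<and> x $ i \<noteq> a $ i"
          by (intro AE_finite_allI AE_conjI AE_torus3_off_hyperplane) auto
        moreover have "AE x in torus3. x \<in> cbox 0 One" by (rule AE_I2) simp
        ultimately show ?thesis
        proof eventually_elim
          case (elim x)
          have x: "0 < x $ i" "x $ i < 1" "x $ i \<noteq> a $ i" for i
            using elim by (auto simp: mem_unit_cube less_le)
          have sp: "sin (pi * x $ i) > 0" for i
            using x[of i] by (intro sin_gt_zero) auto
          have pos: "s i x > 0" if "x $ i < a $ i" for i
          proof -
            have "sin (pi * (a $ i - x $ i)) > 0"
              using x(1,2)[of i] a[of i] that by (intro sin_gt_zero) (auto intro: mult_less_cancel_left2[THEN iffD2])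
            thus ?thesis using sp[of i] by (simp add: s_def)
          qed
          have neg: "s i x < 0" if "x $ i > a $ i" for i
          proof -
            have "sin (pi * (x $ i - a $ i)) > 0"
              using x(1,2)[of i] a[of i] that by (intro sin_gt_zero) (auto intro: mult_less_cancel_left2[THEN iffD2])
            moreover have "pi * (a $ i - x $ i) = - (pi * (x $ i - a $ i))" by (simp add: algebra_simps)
            hence "sin (pi * (a $ i - x $ i)) = - sin (pi * (x $ i - a $ i))" by (simp only: sin_minus)
            ultimately show ?thesis using sp[of i] by (simp add: s_def mult_pos_neg)
          qed
          have "s i x \<noteq> 0 \<and> (s i x > 0 \<longleftrightarrow> x $ i \<le> a $ i)" for i
          proof (cases "x $ i < a $ i")
            case True thus ?thesis using pos[of i] by simp
          next
            case False
            hence "x $ i > a $ i" using x(3)[of i] by simp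
            thus ?thesis using neg[of i] by simp
          qed
          hence ne: "s i x \<noteq> 0" and sgn: "s i x > 0 \<longleftrightarrow> x $ i \<le> a $ i" for i by blast+
          have "(\<lambda>n. \<phi> n x) \<longlonglongrightarrow> (\<Prod>i\<in>UNIV. if s i x > 0 then 1 else 0)"
            unfolding \<phi>_def by (intro tendsto_prod p(3) s2 ne)
          also have "(\<Prod>i\<in>UNIV. if s i x > 0 then 1 else 0) = (indicator {..a} x :: real)"
          proof (cases "\<forall>i. x $ i \<le> a $ i")
            case True thus ?thesis by (simp add: sgn indicator_def less_eq_vec_def)
          next
            case False
            then obtain i where "\<not> x $ i \<le> a $ i" by auto
            hence "\<exists>i\<in>UNIV. (if s i x > 0 then 1 else (0::real)) = 0" using sgn by auto
            hence "(\<Prod>i\<in>UNIV. if s i x > 0 then 1 else (0::real)) = 0" by (intro prod_zero) auto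
            thus ?thesis using False by (auto simp: indicator_def less_eq_vec_def)
          qed
          finally show ?case by (intro tendsto_intros)
        qed
      qed
      show "AE x in torus3. norm (\<phi> n x * h x) \<le> 2 ^ CARD(3) * \<bar>h x\<bar>" for n
      proof (rule AE_I2)
        fix x
        have "\<bar>\<phi> n x\<bar> = (\<Prod>i\<in>UNIV. \<bar>p n (s i x)\<bar>)" by (simp add: \<phi>_def abs_prod)
        also have "\<dots> \<le> (\<Prod>i\<in>(UNIV::3 set). 2)" by (rule prod_mono) (use p(2) s2 in auto)
        finally have "\<bar>\<phi> n x\<bar> \<le> 2 ^ CARD(3)" by simp
        thus "norm (\<phi> n x * h x) \<le> 2 ^ CARD(3) * \<bar>h x\<bar>" by (simp add: abs_mult mult_right_mono)
      qed
    qed (use h in auto)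
    moreover have "(\<integral>x. \<phi> n x * h x \<partial>torus3) = 0" for n by (rule real0[OF \<phi>])
    ultimately show ?thesis by (simp add: LIMSEQ_const_iff)
  qed
  define H where "H x = indicator (cbox 0 One) x * h x" for x
  have S: "cbox 0 One \<inter> space lebesgue \<in> sets lebesgue" by simp
  have Hi: "integrable lebesgue H"
    using h unfolding H_def torus3_def integrable_restrict_space[OF S] by simp
  have HQ: "(\<integral>x. f x * H x \<partial>lebesgue) = (\<integral>x. f x * h x \<partial>torus3)" for f
    unfolding torus3_def H_def by (subst integral_restrict_space[OF S]) (simp add: mult_ac)
  have "AE x in lebesgue. H x = 0"
  proof (rule AE_zero_of_integrals_atMost[OF Hi])
    have "(\<lambda>x. complex_of_real 1) \<in> trig_span" by (rule trig_span_const)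
    from real0[OF this] show "(\<integral>x. H x \<partial>lebesgue) = 0" using HQ[of "\<lambda>x. 1"] by simp
    show "(\<integral>x. indicator {..a} x * H x \<partial>lebesgue) = 0" for a
    proof (cases "\<forall>i. a $ i \<ge> 0")
      case True
      define b :: "real^3" where "b = (\<chi> i. min 1 (a $ i))"
      have "(\<integral>x. indicator {..a} x * H x \<partial>lebesgue) = (\<integral>x. indicator {..b} x * H x \<partial>lebesgue)"
        by (rule Bochner_Integration.integral_cong)
          (auto simp: H_def b_def indicator_def less_eq_vec_def mem_unit_cube)
      also have "\<dots> = 0" unfolding HQ by (rule box0) (use True in \<open>auto simp: b_def\<close>)
      finally show ?thesis .
    next
      case False
      then obtain i where i: "a $ i < 0" by (auto simp: not_le)
      have "indicator {..a} x * H x = 0" for x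
        using i by (auto simp: H_def indicator_def less_eq_vec_def mem_unit_cube) (meson dual_order.trans not_le)
      thus ?thesis by (simp only: Bochner_Integration.integral_zero)
    qed
  qed
  hence "AE x in lebesgue. x \<in> cbox 0 One \<longrightarrow> h x = 0" by eventually_elim (auto simp: H_def)
  thus ?thesis unfolding torus3_def by (subst AE_restrict_space_iff) simp_all
qed

section \<open>Fourier coefficients of vector fields\<close>

definition fourier_coeff :: "vfield \<Rightarrow> int^3 \<Rightarrow> complex^3" where
  "fourier_coeff f k = (\<chi> i. \<integral>x. wave (- k) x * of_real (f x $ i) \<partial>torus3)"

definition trig_sum :: "(int^3) set \<Rightarrow> (int^3 \<Rightarrow> complex^3) \<Rightarrow> vfield" where
  "trig_sum F c x = (\<chi> i. Re (\<Sum>k\<in>F. c k $ i * wave k x))"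

text \<open>The reality condition: over a symmetric set of frequencies, sums of waves with such coefficients are
  real, and taking real parts in trig_sum changes nothing.\<close>

definition hermitian :: "(int^3 \<Rightarrow> complex^3) \<Rightarrow> bool" where
  "hermitian c \<longleftrightarrow> (\<forall>k i. c (- k) $ i = cnj (c k $ i))"

definition symmetric_set :: "(int^3) set \<Rightarrow> bool" where
  "symmetric_set F \<longleftrightarrow> (\<forall>k\<in>F. - k \<in> F)"

lemma fourier_coeff_nth: "fourier_coeff f k $ i = (\<integral>x. wave (- k) x * of_real (f x $ i) \<partial>torus3)"
  by (simp add: fourier_coeff_def)

lemma cnj_integral:
  fixes f :: "_ \<Rightarrow> complex"
  shows "cnj (\<integral>x. f x \<partial>M) = (\<integral>x. cnj (f x) \<partial>M)"
  by (rule Bochner_Integration.integral_cnj[symmetric])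

lemma hermitian_fourier_coeff: "hermitian (fourier_coeff f)"
proof -
  have "fourier_coeff f (- k) $ i = cnj (fourier_coeff f k $ i)" for k i
    unfolding fourier_coeff_nth cnj_integral by (simp add: wave_uminus)
  thus ?thesis by (simp add: hermitian_def)
qed

lemma symmetric_set_uminus: "symmetric_set F \<Longrightarrow> uminus ` F = F"
  unfolding symmetric_set_def by (force simp: image_iff)

lemma continuous_on_trig_sum [continuous_intros]:
  "continuous_on S (trig_sum F c)"
  unfolding trig_sum_def by (intro continuous_intros)

lemma L2_trig_sum [simp, intro]: "trig_sum F c \<in> L2"
  by (intro L2_continuous continuous_intros)

lemma integrable_wave_times:
  assumes f: "f \<in> L2"
  shows "integrable torus3 (\<lambda>x. wave k x * of_real (f x $ i))"
proof (rule Bochner_Integration.integrable_bound[OF integral_norm_le_l2_norm(1)[OF f]])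
  note [measurable] = L2_measurable[OF f]
  have [measurable]: "wave k \<in> borel_measurable torus3"
    by (intro borel_measurable_torus3_continuous continuous_intros)
  show "(\<lambda>x. wave k x * of_real (f x $ i)) \<in> borel_measurable torus3" by measurable
  show "AE x in torus3. norm (wave k x * of_real (f x $ i)) \<le> norm (norm (f x))"
    by (intro AE_I2) (simp add: norm_mult component_le_norm_cart)
qed

lemma fourier_coeff_diff:
  "f \<in> L2 \<Longrightarrow> g \<in> L2 \<Longrightarrow> fourier_coeff (\<lambda>x. f x - g x) k = fourier_coeff f k - fourier_coeff g k"
  by (simp add: vec_eq_iff fourier_coeff_nth right_diff_distrib integrable_wave_times)

lemma fourier_coeff_scaleR: "fourier_coeff (\<lambda>x. c *\<^sub>R f x) k = c *\<^sub>R fourier_coeff f k"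
proof -
  have "wave (- k) x * complex_of_real (c * f x $ i) = of_real c * (wave (- k) x * of_real (f x $ i))" for x i
    by simp
  hence "fourier_coeff (\<lambda>x. c *\<^sub>R f x) k $ i = c *\<^sub>R fourier_coeff f k $ i" for i
    by (simp only: fourier_coeff_nth vector_scaleR_component real_scaleR_def
        Bochner_Integration.integral_mult_right_zero) (simp add: scaleR_conv_of_real)
  thus ?thesis by (simp add: vec_eq_iff)
qed

lemma inner_complex_eq: "x \<bullet> y = Re (x * cnj y)" for x y :: complex
  by (simp add: inner_complex_def)

lemma integral_Re_mult_wave:
  assumes f: "f \<in> L2"
  shows "(\<integral>x. Re (c * wave k x) * f x $ i \<partial>torus3) = c \<bullet> fourier_coeff f k $ i"
    and "integrable torus3 (\<lambda>x. Re (c * wave k x) * f x $ i)"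
proof -
  have eq: "(\<lambda>x. Re (c * wave k x) * f x $ i) = (\<lambda>x. Re (c * (wave k x * of_real (f x $ i))))"
    by (simp add: fun_eq_iff algebra_simps)
  show "integrable torus3 (\<lambda>x. Re (c * wave k x) * f x $ i)"
    unfolding eq by (intro integrable_Re integrable_mult_right integrable_wave_times f)
  have "(\<integral>x. Re (c * wave k x) * f x $ i \<partial>torus3) = Re (c * (\<integral>x. wave k x * of_real (f x $ i) \<partial>torus3))"
    unfolding eq by (subst integral_Re) (simp_all add: integrable_wave_times f)
  also have "(\<integral>x. wave k x * of_real (f x $ i) \<partial>torus3) = cnj (fourier_coeff f k $ i)"
    unfolding fourier_coeff_nth cnj_integral by (simp add: wave_uminus)
  finally show "(\<integral>x. Re (c * wave k x) * f x $ i \<partial>torus3) = c \<bullet> fourier_coeff f k $ i"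
    by (simp only: inner_complex_eq)
qed

lemma l2_inner_trig_sum:
  assumes f: "f \<in> L2"
  shows "l2_inner (trig_sum F c) f = (\<Sum>k\<in>F. c k \<bullet> fourier_coeff f k)"
proof -
  have eq: "trig_sum F c x \<bullet> f x = (\<Sum>k\<in>F. \<Sum>i\<in>UNIV. Re (c k $ i * wave k x) * f x $ i)" for x
    unfolding trig_sum_def inner_vec_def
    by (simp add: sum_distrib_right) (rule sum.swap)
  show ?thesis
    unfolding l2_inner_def eq
    by (simp del: times_complex.sel add: integral_Re_mult_wave[OF f] inner_vec_def)
qed

lemma trig_sum_complex:
  assumes F: "symmetric_set F" and c: "hermitian c"
  shows "complex_of_real (trig_sum F c x $ i) = (\<Sum>k\<in>F. c k $ i * wave k x)"
proof -
  let ?z = "\<Sum>k\<in>F. c k $ i * wave k x"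
  have "cnj ?z = (\<Sum>k\<in>F. c (- k) $ i * wave (- k) x)"
    using c by (simp add: hermitian_def wave_uminus)
  also have "\<dots> = (\<Sum>k\<in>uminus ` F. c k $ i * wave k x)"
    by (subst sum.reindex) auto
  also have "\<dots> = ?z" using symmetric_set_uminus[OF F] by simp
  finally have "?z \<in> \<real>" by (simp add: Reals_cnj_iff)
  thus ?thesis by (simp only: trig_sum_def vec_lambda_beta of_real_Re)
qed

lemma fourier_coeff_of_waves:
  assumes F: "finite F" and f: "\<And>x i. complex_of_real (f x $ i) = (\<Sum>k\<in>F. c k $ i * wave k x)"
  shows "fourier_coeff f k = (if k \<in> F then c k else 0)"
proof -
  have int: "integrable torus3 (wave l)" for l
    by (intro integrable_torus3_continuous continuous_intros)
  have "fourier_coeff f k $ i = (if k \<in> F then c k $ i else 0)" for i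
  proof -
    have "fourier_coeff f k $ i = (\<integral>x. (\<Sum>l\<in>F. c l $ i * wave (l - k) x) \<partial>torus3)"
    proof -
      have "wave (- k) x * of_real (f x $ i) = (\<Sum>l\<in>F. c l $ i * wave (l - k) x)" for x
        unfolding f sum_distrib_left diff_conv_add_uminus[of _ k] wave_add by (simp add: mult_ac)
      thus ?thesis by (simp add: fourier_coeff_nth)
    qed
    also have "\<dots> = (\<Sum>l\<in>F. c l $ i * (if l = k then 1 else 0))"
      using int by (simp add: integral_wave)
    also have "\<dots> = (if k \<in> F then c k $ i else 0)"
      using F by (simp add: if_distrib sum.delta cong: if_cong)
    finally show ?thesis .
  qed
  thus ?thesis by (simp add: vec_eq_iff)
qed

lemma fourier_coeff_trig_sum:
  assumes "finite F" "symmetric_set F" "hermitian c"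
  shows "fourier_coeff (trig_sum F c) k = (if k \<in> F then c k else 0)"
  by (rule fourier_coeff_of_waves) (simp_all add: assms trig_sum_complex)

lemma l2_norm_trig_sum:
  assumes "finite F" "symmetric_set F" "hermitian c"
  shows "(l2_norm (trig_sum F c))\<^sup>2 = (\<Sum>k\<in>F. (norm (c k))\<^sup>2)"
  unfolding l2_norm_power2 using assms
  by (simp add: l2_inner_trig_sum fourier_coeff_trig_sum power2_norm_eq_inner)

lemma l2_norm_diff_trig_sum:
  assumes f: "f \<in> L2" and F: "finite F" "symmetric_set F"
  shows "(l2_norm (\<lambda>x. f x - trig_sum F (fourier_coeff f) x))\<^sup>2
    = (l2_norm f)\<^sup>2 - (\<Sum>k\<in>F. (norm (fourier_coeff f k))\<^sup>2)"
proof -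
  let ?t = "trig_sum F (fourier_coeff f)"
  have "l2_inner ?t f = (\<Sum>k\<in>F. (norm (fourier_coeff f k))\<^sup>2)"
    using f by (simp add: l2_inner_trig_sum power2_norm_eq_inner)
  moreover have "l2_inner ?t ?t = (\<Sum>k\<in>F. (norm (fourier_coeff f k))\<^sup>2)"
    using l2_norm_trig_sum[OF F hermitian_fourier_coeff] by (simp add: l2_norm_power2)
  ultimately show ?thesis unfolding l2_norm_power2
    using f by (simp add: l2_inner_diff_left l2_inner_diff_right L2_diff l2_inner_commute[of f ?t])
qed

text \<open>An exhaustion of the frequency lattice by finite symmetric sets, so that the partial sums of the
  Fourier series of a real field are real.\<close>

definition int_box :: "nat \<Rightarrow> (int^3) set" where
  "int_box n = {k. \<forall>i. \<bar>k $ i\<bar> \<le> int n}"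

lemma finite_int_box [simp]: "finite (int_box n)"
proof -
  have "int_box n \<subseteq> (\<lambda>f. \<chi> i. f i) ` (UNIV \<rightarrow>\<^sub>E {- int n..int n})"
  proof
    fix k assume k: "k \<in> int_box n"
    have "k = (\<chi> i. (\<lambda>i. k $ i) i)" by (simp add: vec_eq_iff)
    moreover have "(\<lambda>i. k $ i) \<in> UNIV \<rightarrow>\<^sub>E {- int n..int n}"
      using k by (auto simp: int_box_def abs_le_iff) (metis minus_le_iff)
    ultimately show "k \<in> (\<lambda>f. \<chi> i. f i) ` (UNIV \<rightarrow>\<^sub>E {- int n..int n})" by blast
  qed
  thus ?thesis by (rule finite_subset) (auto intro!: finite_PiE)
qed

lemma symmetric_int_box [simp]: "symmetric_set (int_box n)"
  by (simp add: symmetric_set_def int_box_def)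

lemma int_box_mono: "m \<le> n \<Longrightarrow> int_box m \<subseteq> int_box n"
  unfolding int_box_def by (auto intro: order_trans[of _ "int m"])

lemma finite_subset_int_box:
  assumes "finite F" obtains n where "F \<subseteq> int_box n"
proof -
  define n where "n = nat (\<Sum>k\<in>F. \<Sum>i\<in>UNIV. \<bar>k $ i\<bar>)"
  have "F \<subseteq> int_box n"
  proof
    fix k assume k: "k \<in> F"
    have "\<bar>k $ i\<bar> \<le> int n" for i
    proof -
      have "\<bar>k $ i\<bar> \<le> (\<Sum>i\<in>UNIV. \<bar>k $ i\<bar>)" by (rule member_le_sum) auto
      also have "\<dots> \<le> (\<Sum>k\<in>F. \<Sum>i\<in>UNIV. \<bar>k $ i\<bar>)"
        by (rule member_le_sum[where f="\<lambda>k. \<Sum>i\<in>UNIV. \<bar>k $ i\<bar>"]) (use k assms in \<open>auto intro: sum_nonneg\<close>)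
      also have "\<dots> = int n" by (simp add: n_def sum_nonneg)
      finally show ?thesis .
    qed
    thus "k \<in> int_box n" by (simp add: int_box_def)
  qed
  thus ?thesis by (rule that)
qed

lemma Bessel:
  assumes f: "f \<in> L2" and F: "finite F"
  shows "(\<Sum>k\<in>F. (norm (fourier_coeff f k))\<^sup>2) \<le> (l2_norm f)\<^sup>2"
proof -
  obtain n where n: "F \<subseteq> int_box n" using finite_subset_int_box[OF F] .
  have "(\<Sum>k\<in>F. (norm (fourier_coeff f k))\<^sup>2) \<le> (\<Sum>k\<in>int_box n. (norm (fourier_coeff f k))\<^sup>2)"
    by (rule sum_mono2) (use n in auto)
  also have "\<dots> \<le> (l2_norm f)\<^sup>2"
    using l2_norm_diff_trig_sum[OF f finite_int_box symmetric_int_box, of n]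
      zero_le_power2[of "l2_norm (\<lambda>x. f x - trig_sum (int_box n) (fourier_coeff f) x)"] by linarith
  finally show ?thesis .
qed

lemma norm_fourier_coeff_le: "f \<in> L2 \<Longrightarrow> norm (fourier_coeff f k) \<le> l2_norm f"
  using Bessel[of f "{k}"] by (auto intro: power2_le_imp_le)

lemma AE_zero_of_fourier_coeff_zero:
  assumes f: "f \<in> L2" and 0: "\<And>k. fourier_coeff f k = 0"
  shows "AE x in torus3. f x = 0"
proof -
  have "AE x in torus3. f x $ i = 0" for i
  proof (rule AE_zero_of_orthogonal_waves)
    note [measurable] = L2_measurable[OF f]
    show "integrable torus3 (\<lambda>x. f x $ i)"
      by (rule Bochner_Integration.integrable_bound[OF integral_norm_le_l2_norm(1)[OF f]])
        (auto intro!: AE_I2 component_le_norm_cart)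
    fix k
    have "fourier_coeff f (- k) $ i = 0" using 0 by simp
    thus "(\<integral>x. wave k x * of_real (f x $ i) \<partial>torus3) = 0" by (simp add: fourier_coeff_nth)
  qed
  hence "AE x in torus3. \<forall>i\<in>UNIV. f x $ i = 0" by (intro AE_finite_allI) auto
  thus ?thesis by eventually_elim (simp add: vec_eq_iff)
qed

lemma AE_eq_of_fourier_coeff_eq:
  assumes "f \<in> L2" "g \<in> L2" "\<And>k. fourier_coeff f k = fourier_coeff g k"
  shows "AE x in torus3. f x = g x"
proof -
  have "AE x in torus3. f x - g x = 0"
    by (rule AE_zero_of_fourier_coeff_zero) (use assms in \<open>auto simp: fourier_coeff_diff\<close>)
  thus ?thesis by eventually_elim simp
qed

lemma trig_sum_diff_subset:
  assumes "finite F" "G \<subseteq> F"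
  shows "trig_sum F c x - trig_sum G c x = trig_sum (F - G) c x"
  using assms by (simp add: trig_sum_def vec_eq_iff sum_diff)

lemma fourier_coeff_tendsto:
  assumes "\<And>n. f n \<in> L2" "g \<in> L2" "(\<lambda>n. l2_norm (\<lambda>x. f n x - g x)) \<longlonglongrightarrow> 0"
  shows "(\<lambda>n. fourier_coeff (f n) k) \<longlonglongrightarrow> fourier_coeff g k"
proof -
  have "(\<lambda>n. fourier_coeff (f n) k - fourier_coeff g k) \<longlonglongrightarrow> 0"
    by (rule Lim_null_comparison[OF always_eventually assms(3)])
      (use norm_fourier_coeff_le[of "\<lambda>x. f n x - g x" k for n] assms in \<open>auto simp: fourier_coeff_diff\<close>)
  thus ?thesis by (simp add: LIM_zero_iff)
qed

text \<open>The partial sums over frequency boxes form a Cauchy sequence, because the squared norm of their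
  differences is a difference of partial sums of a bounded increasing series.\<close>

lemma Riesz_Fischer:
  assumes c: "hermitian c" and B: "\<And>F. finite F \<Longrightarrow> (\<Sum>k\<in>F. (norm (c k))\<^sup>2) \<le> B\<^sup>2" "B \<ge> 0"
  obtains g where "g \<in> L2" "\<And>k. fourier_coeff g k = c k" "l2_norm g \<le> B"
    "(\<lambda>n. l2_norm (\<lambda>x. trig_sum (int_box n) c x - g x)) \<longlonglongrightarrow> 0"
proof -
  let ?t = "\<lambda>n. trig_sum (int_box n) c"
  define S where "S n = (\<Sum>k\<in>int_box n. (norm (c k))\<^sup>2)" for n
  have mono: "incseq S"
    unfolding S_def by (intro monoI sum_mono2 int_box_mono) auto
  have "Bseq S"
    by (rule BseqI'[of _ "B\<^sup>2"]) (use B(1) in \<open>simp add: S_def sum_nonneg\<close>)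
  hence "convergent S" by (rule Bseq_mono_convergent) (use mono in \<open>simp add: incseq_def\<close>)
  hence Cau: "Cauchy S" by (rule convergent_Cauchy)
  have diff: "(l2_norm (\<lambda>x. ?t n x - ?t m x))\<^sup>2 = S n - S m" if "m \<le> n" for m n
  proof -
    have sub: "int_box m \<subseteq> int_box n" using that by (rule int_box_mono)
    have "symmetric_set (int_box n - int_box m)"
      using symmetric_int_box[of n] symmetric_int_box[of m] unfolding symmetric_set_def
      by (metis DiffD1 DiffD2 DiffI minus_minus)
    hence "(l2_norm (trig_sum (int_box n - int_box m) c))\<^sup>2 = (\<Sum>k\<in>int_box n - int_box m. (norm (c k))\<^sup>2)"
      by (intro l2_norm_trig_sum c) auto
    also have "\<dots> = S n - S m" using sub by (simp add: S_def sum_diff)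
    finally show ?thesis using trig_sum_diff_subset[OF finite_int_box sub] by simp
  qed
  have "\<exists>g\<in>L2. (\<lambda>n. l2_norm (\<lambda>x. ?t n x - g x)) \<longlonglongrightarrow> 0"
  proof (rule L2_complete)
    fix \<epsilon> :: real assume \<epsilon>: "\<epsilon> > 0"
    obtain N where N: "\<And>m n. m \<ge> N \<Longrightarrow> n \<ge> N \<Longrightarrow> norm (S m - S n) < \<epsilon>\<^sup>2"
      using CauchyD[OF Cau, of "\<epsilon>\<^sup>2"] \<epsilon> by auto
    have *: "l2_norm (\<lambda>x. ?t n x - ?t m x) < \<epsilon>" if "m \<ge> N" "n \<ge> N" "m \<le> n" for m n
    proof (rule power2_less_imp_less)
      show "(l2_norm (\<lambda>x. ?t n x - ?t m x))\<^sup>2 < \<epsilon>\<^sup>2" using diff[OF that(3)] N[of n m] that by simp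
    qed (use \<epsilon> in simp)
    show "\<exists>N. \<forall>m\<ge>N. \<forall>n\<ge>N. l2_norm (\<lambda>x. ?t m x - ?t n x) < \<epsilon>"
    proof (intro exI[of _ N] allI impI)
      fix m n assume "m \<ge> N" "n \<ge> N"
      thus "l2_norm (\<lambda>x. ?t m x - ?t n x) < \<epsilon>"
        using *[of m n] *[of n m] l2_norm_minus_commute[of "?t m" "?t n"] by (cases "m \<le> n") auto
    qed
  qed auto
  then obtain g where g: "g \<in> L2" "(\<lambda>n. l2_norm (\<lambda>x. ?t n x - g x)) \<longlonglongrightarrow> 0" by blast
  show ?thesis
  proof
    show "g \<in> L2" "(\<lambda>n. l2_norm (\<lambda>x. ?t n x - g x)) \<longlonglongrightarrow> 0" by fact+
    show "fourier_coeff g k = c k" for k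
    proof -
      obtain n0 where n0: "{k} \<subseteq> int_box n0" using finite_subset_int_box[of "{k}"] by auto
      have "eventually (\<lambda>n. fourier_coeff (?t n) k = c k) sequentially"
      proof (rule eventually_sequentiallyI)
        fix n assume "n \<ge> n0"
        hence "k \<in> int_box n" using n0 int_box_mono by blast
        thus "fourier_coeff (?t n) k = c k" by (simp add: fourier_coeff_trig_sum c)
      qed
      hence "(\<lambda>n. fourier_coeff (?t n) k) \<longlonglongrightarrow> c k" by (rule tendsto_eventually)
      moreover have "(\<lambda>n. fourier_coeff (?t n) k) \<longlonglongrightarrow> fourier_coeff g k"
        by (rule fourier_coeff_tendsto) (use g in auto)
      ultimately show ?thesis using LIMSEQ_unique by blast
    qed
    show "l2_norm g \<le> B"
    proof (rule LIMSEQ_le_const2)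
      show "(\<lambda>n. l2_norm (?t n)) \<longlonglongrightarrow> l2_norm g"
        by (rule l2_norm_tendsto) (use g in auto)
      have "l2_norm (?t n) \<le> B" for n
        by (rule power2_le_imp_le) (use B c in \<open>simp_all add: l2_norm_trig_sum\<close>)
      thus "\<exists>N. \<forall>n\<ge>N. l2_norm (?t n) \<le> B" by blast
    qed
  qed
qed

text \<open>The field that the Riesz-Fischer theorem builds from the coefficients of f has the same coefficients
  as f, and hence agrees with f almost everywhere.\<close>

lemma Fourier_series_converges:
  assumes f: "f \<in> L2"
  shows "(\<lambda>n. l2_norm (\<lambda>x. trig_sum (int_box n) (fourier_coeff f) x - f x)) \<longlonglongrightarrow> 0"
proof -
  obtain g where g: "g \<in> L2" "\<And>k. fourier_coeff g k = fourier_coeff f k" "l2_norm g \<le> l2_norm f"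
    "(\<lambda>n. l2_norm (\<lambda>x. trig_sum (int_box n) (fourier_coeff f) x - g x)) \<longlonglongrightarrow> 0"
    by (rule Riesz_Fischer[OF hermitian_fourier_coeff[of f] Bessel[OF f] l2_norm_nonneg]) blast+
  have AE: "AE x in torus3. g x = f x"
    by (rule AE_eq_of_fourier_coeff_eq) (use f g in auto)
  have "l2_norm (\<lambda>x. trig_sum (int_box n) (fourier_coeff f) x - g x)
      = l2_norm (\<lambda>x. trig_sum (int_box n) (fourier_coeff f) x - f x)" for n
    by (rule l2_norm_cong_AE) (use AE f g in auto)
  thus ?thesis using g(4) by simp
qed

section \<open>Weak derivatives as Fourier multipliers\<close>

definition symbs :: "3 list \<Rightarrow> int^3 \<Rightarrow> complex" where
  "symbs js k = prod_list (map (\<lambda>i. symb i k) js)"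

lemma symbs_Nil [simp]: "symbs [] k = 1"
  and symbs_Cons [simp]: "symbs (i # js) k = symb i k * symbs js k"
  by (simp_all add: symbs_def)

lemma symbs_uminus: "symbs js (- k) = cnj (symbs js k)"
  by (induction js) (simp_all add: symb_uminus)

lemma cnj_symb: "cnj (symb i k) = - symb i k"
  by (simp add: symb_def)

lemma cnj_symbs: "cnj (symbs js k) = (-1) ^ length js * symbs js k"
  by (induction js) (simp_all add: cnj_symb)

lemma norm_symb_le: "norm (symb i k) \<le> 2 * pi * norm (freq k)"
  using component_le_norm_cart[of "freq k" i]
  by (simp add: symb_def norm_mult abs_mult)

lemma norm_symbs_le: "norm (symbs js k) \<le> (2 * pi * norm (freq k)) ^ length js"
  by (induction js) (auto simp: norm_mult intro!: mult_mono norm_symb_le)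

lemma sum_norm_symb: "(\<Sum>i\<in>UNIV. (norm (symb i k))\<^sup>2) = (2 * pi * norm (freq k))\<^sup>2"
proof -
  have "(norm (freq k))\<^sup>2 = (\<Sum>i\<in>UNIV. (of_int (k $ i))\<^sup>2)"
    by (simp add: norm_vec_def L2_set_def sum_nonneg)
  thus ?thesis
    by (simp add: symb_def norm_mult power_mult_distrib sum_distrib_left)
qed

lemma norm_vector_scalar_mult: "norm (c *s v) = norm c * norm v" for v :: "complex^'n"
  by (simp add: norm_vec_def norm_mult L2_set_left_distrib L2_set_right_distrib)

lemma scaleR_eq_smult: "c *\<^sub>R v = complex_of_real c *s v" for v :: "complex^'n"
  by (simp add: vec_eq_iff complex_eq_iff)

lemma inner_vector_scalar_mult: "(c *s v) \<bullet> w = v \<bullet> (cnj c *s w)" for v :: "complex^'n"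
  by (simp add: inner_vec_def inner_complex_def algebra_simps)

lemma hermitian_symbs: "hermitian c \<Longrightarrow> hermitian (\<lambda>k. symbs js k *s c k)"
  by (simp add: hermitian_def symbs_uminus)

lemma Parseval_tendsto:
  assumes f: "f \<in> L2" and h: "h \<in> L2"
  shows "(\<lambda>n. \<Sum>k\<in>int_box n. fourier_coeff f k \<bullet> fourier_coeff h k) \<longlonglongrightarrow> l2_inner f h"
  using l2_inner_tendsto[OF _ f h Fourier_series_converges[OF f]] h by (simp add: l2_inner_trig_sum)

lemma periodic_pd:
  fixes f :: "real^3 \<Rightarrow> 'b::real_normed_vector"
  assumes per: "periodic f" and d: "\<And>x. f differentiable at x"
  shows "periodic (pd i f)"
  unfolding periodic_def
proof (intro allI)
  fix j :: 3 and x :: "real^3"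
  let ?e = "axis j 1 :: real^3"
  have "(f has_derivative frechet_derivative f (at (x + ?e))) (at (x + ?e))"
    using d by (simp add: frechet_derivative_works)
  hence "((\<lambda>y. f (y + ?e)) has_derivative (\<lambda>h. frechet_derivative f (at (x + ?e)) h)) (at x)"
    by (intro has_derivative_compose[where f="\<lambda>y. y + ?e" and g=f]) (auto intro!: derivative_eq_intros)
  hence "(f has_derivative frechet_derivative f (at (x + ?e))) (at x)"
    using per by (simp add: periodic_def)
  thus "pd i f (x + ?e) = pd i f x"
    using frechet_derivative_at by (fastforce simp: pd_def)
qed

lemma pds_Nil [simp]: "pds [] f = f"
  and pds_Cons: "pds (i # js) f = pd i (pds js f)"
  by (simp_all add: pds_def fun_eq_iff)

lemma test_function_differentiable: "\<phi> \<in> test_functions \<Longrightarrow> pds js \<phi> differentiable (at x)"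
  by (simp add: test_functions_def)

lemma test_function_continuous: "\<phi> \<in> test_functions \<Longrightarrow> continuous_on UNIV (pds js \<phi>)"
  by (meson continuous_at_imp_continuous_on test_function_differentiable differentiable_imp_continuous_within)

lemma periodic_pds_test_function: "\<phi> \<in> test_functions \<Longrightarrow> periodic (pds js \<phi>)"
  by (induction js) (auto simp: pds_Cons intro!: periodic_pd test_function_differentiable,
      simp add: test_functions_def)

lemma pd_mult_wave:
  assumes "\<eta> differentiable at x"
  shows "((\<lambda>x. complex_of_real (\<eta> x) * wave k x) has_derivative
     (\<lambda>h. of_real (\<eta> x) * ((2 * pi * (freq k \<bullet> h)) *\<^sub>R (\<i> * wave k x))
        + of_real (frechet_derivative \<eta> (at x) h) * wave k x)) (at x)"
    and "pd i (\<lambda>x. complex_of_real (\<eta> x) * wave k x) x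
      = of_real (\<eta> x) * (symb i k * wave k x) + of_real (pd i \<eta> x) * wave k x"
proof -
  have "(\<eta> has_derivative frechet_derivative \<eta> (at x)) (at x)"
    using assms by (simp add: frechet_derivative_works)
  hence "((\<lambda>x. complex_of_real (\<eta> x)) has_derivative (\<lambda>h. of_real (frechet_derivative \<eta> (at x) h))) (at x)"
    by (rule has_derivative_of_real)
  from has_derivative_mult[OF this has_derivative_wave]
  show *: "((\<lambda>x. complex_of_real (\<eta> x) * wave k x) has_derivative
     (\<lambda>h. of_real (\<eta> x) * ((2 * pi * (freq k \<bullet> h)) *\<^sub>R (\<i> * wave k x))
        + of_real (frechet_derivative \<eta> (at x) h) * wave k x)) (at x)" .
  show "pd i (\<lambda>x. complex_of_real (\<eta> x) * wave k x) x
      = of_real (\<eta> x) * (symb i k * wave k x) + of_real (pd i \<eta> x) * wave k x"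
    by (subst pd_eqI[OF *]) (simp add: symb_def inner_axis scaleR_conv_of_real pd_def)
qed

text \<open>Integration by parts, one derivative at a time.\<close>

lemma integral_pds_times_wave:
  assumes \<phi>: "\<phi> \<in> test_functions"
  shows "(\<integral>x. of_real (pds js \<phi> x) * wave k x \<partial>torus3)
     = (-1) ^ length js * symbs js k * (\<integral>x. of_real (\<phi> x) * wave k x \<partial>torus3)"
proof (induction js)
  case (Cons i js)
  let ?\<eta> = "pds js \<phi>" and ?g = "\<lambda>x. complex_of_real (pds js \<phi> x) * wave k x"
  note d = test_function_differentiable[OF \<phi>] and c = test_function_continuous[OF \<phi>]
  have c': "continuous_on UNIV (pd i ?\<eta>)" using c[of "i # js"] by (simp add: pds_Cons)
  have pd: "pd i ?g x = of_real (?\<eta> x) * (symb i k * wave k x) + of_real (pd i ?\<eta> x) * wave k x" for x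
    by (rule pd_mult_wave(2)[OF d])
  have "(\<integral>x. pd i ?g x \<partial>torus3) = 0"
  proof (rule integral_pd_periodic)
    show "periodic ?g" using periodic_pds_test_function[OF \<phi>] periodic_wave by (simp add: periodic_def)
    show "?g differentiable at x" for x
      using pd_mult_wave(1)[OF d] differentiable_def by blast
    show "continuous_on UNIV (pd i ?g)"
      unfolding pd by (intro continuous_intros c c')
  qed
  moreover have "(\<integral>x. pd i ?g x \<partial>torus3)
      = (\<integral>x. symb i k * ?g x \<partial>torus3) + (\<integral>x. of_real (pd i ?\<eta> x) * wave k x \<partial>torus3)"
    unfolding pd
    by (subst Bochner_Integration.integral_add[symmetric])
      (auto intro!: integrable_torus3_continuous continuous_intros c c' Bochner_Integration.integral_cong)
  ultimately show ?case
    using Cons by (simp add: pds_Cons add_eq_0_iff mult_ac)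
qed simp

lemma has_derivative_Re_wave:
  "((\<lambda>x. Re (c * wave k x)) has_derivative (\<lambda>h. Re (c * ((2 * pi * (freq k \<bullet> h)) *\<^sub>R (\<i> * wave k x))))) (at x)"
  by (intro derivative_intros has_derivative_wave)

lemma pd_Re_wave: "pd i (\<lambda>x. Re (c * wave k x)) = (\<lambda>x. Re ((symb i k * c) * wave k x))"
proof
  fix x
  have "c * ((2 * pi * (freq k \<bullet> axis i 1)) *\<^sub>R (\<i> * wave k x)) = (symb i k * c) * wave k x"
    by (simp add: symb_def inner_axis scaleR_conv_of_real)
  thus "pd i (\<lambda>x. Re (c * wave k x)) x = Re ((symb i k * c) * wave k x)"
    by (subst pd_eqI[OF has_derivative_Re_wave]) (simp only:)
qed

lemma pds_Re_wave: "pds js (\<lambda>x. Re (c * wave k x)) = (\<lambda>x. Re ((symbs js k * c) * wave k x))"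
proof (induction js)
  case (Cons i js)
  show ?case unfolding pds_Cons Cons pd_Re_wave by (simp only: symbs_Cons mult.assoc)
qed simp

lemma Re_wave_test_function: "(\<lambda>x. Re (c * wave k x)) \<in> test_functions"
proof -
  have "periodic (\<lambda>x. Re (c * wave k x))" using periodic_wave[of k] by (simp add: periodic_def)
  moreover have "pds js (\<lambda>x. Re (c * wave k x)) differentiable (at x)" for js x
    unfolding pds_Re_wave using has_derivative_Re_wave differentiable_def by blast
  ultimately show ?thesis by (simp add: test_functions_def)
qed

lemma integrable_continuous_scaleR_L2:
  assumes f: "f \<in> L2" and c: "continuous_on UNIV \<psi>"
  shows "integrable torus3 (\<lambda>x. \<psi> x *\<^sub>R f x)"
proof -
  have "bounded (\<psi> ` cbox 0 One)"
    by (intro compact_imp_bounded compact_continuous_image continuous_on_subset[OF c]) auto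
  then obtain B where B: "\<And>x. x \<in> cbox 0 One \<Longrightarrow> \<bar>\<psi> x\<bar> \<le> B" unfolding bounded_iff by auto
  note [measurable] = L2_measurable[OF f] borel_measurable_torus3_continuous[OF c]
  show ?thesis
  proof (rule Bochner_Integration.integrable_bound)
    show "integrable torus3 (\<lambda>x. B * norm (f x))"
      using integral_norm_le_l2_norm(1)[OF f] by simp
    show "AE x in torus3. norm (\<psi> x *\<^sub>R f x) \<le> norm (B * norm (f x))"
      by (rule AE_I2) (simp add: abs_mult, intro mult_right_mono order_trans[OF B] abs_ge_self, auto)
  qed measurable
qed

lemma integral_scaleR_nth:
  assumes f: "f \<in> L2" and c: "continuous_on UNIV \<psi>"
  shows "(\<integral>x. \<psi> x *\<^sub>R f x \<partial>torus3) $ i = (\<integral>x. \<psi> x * f x $ i \<partial>torus3)"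
    and "(\<integral>x. \<psi> x *\<^sub>R f x \<partial>torus3) $ i = l2_inner (\<lambda>x. \<psi> x *\<^sub>R axis i 1) f"
proof -
  have "(\<integral>x. \<psi> x *\<^sub>R f x \<partial>torus3) \<bullet> axis i 1 = (\<integral>x. (\<psi> x *\<^sub>R f x) \<bullet> axis i 1 \<partial>torus3)"
    by (rule integral_inner_left[symmetric]) (use integrable_continuous_scaleR_L2[OF f c] in simp)
  thus *: "(\<integral>x. \<psi> x *\<^sub>R f x \<partial>torus3) $ i = (\<integral>x. \<psi> x * f x $ i \<partial>torus3)"
    by (simp add: inner_axis)
  show "(\<integral>x. \<psi> x *\<^sub>R f x \<partial>torus3) $ i = l2_inner (\<lambda>x. \<psi> x *\<^sub>R axis i 1) f"
    unfolding * l2_inner_def by (simp add: inner_axis')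
qed

text \<open>Testing against a single wave gives one direction; the other follows from Parseval's identity, as
  the coefficients of a differentiated test function are known by partial integration.\<close>

lemma is_weak_deriv_iff:
  assumes f: "f \<in> L2" and g: "g \<in> L2"
  shows "is_weak_deriv js f g \<longleftrightarrow> (\<forall>k. fourier_coeff g k = symbs js k *s fourier_coeff f k)"
proof
  assume W: "is_weak_deriv js f g"
  have "fourier_coeff g k $ i = symbs js k * fourier_coeff f k $ i" for k i
  proof -
    let ?s = "(-1::real) ^ length js"
    have "(symbs js k * c) \<bullet> fourier_coeff f k $ i = ?s * (c \<bullet> fourier_coeff g k $ i)" for c
    proof -
      let ?\<phi> = "\<lambda>x. Re (c * wave k x)"
      have c: "continuous_on UNIV (\<lambda>x. Re (d * wave k x))" for d by (intro continuous_intros)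
      have "(\<integral>x. pds js ?\<phi> x *\<^sub>R f x \<partial>torus3) = ?s *\<^sub>R (\<integral>x. ?\<phi> x *\<^sub>R g x \<partial>torus3)"
        using W Re_wave_test_function unfolding is_weak_deriv_def by blast
      from arg_cong[OF this, of "\<lambda>v. v $ i"]
      show ?thesis
        unfolding pds_Re_wave vector_scaleR_component integral_scaleR_nth(1)[OF f c] integral_scaleR_nth(1)[OF g c]
          integral_Re_mult_wave[OF f] integral_Re_mult_wave[OF g] by simp
    qed
    hence "c \<bullet> (cnj (symbs js k) * fourier_coeff f k $ i - of_real ?s * fourier_coeff g k $ i) = 0" for c
      by (simp add: inner_complex_def algebra_simps)
    hence "cnj (symbs js k) * fourier_coeff f k $ i = of_real ?s * fourier_coeff g k $ i"
      by (metis inner_eq_zero_iff eq_iff_diff_eq_0)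
    thus ?thesis by (simp add: cnj_symbs)
  qed
  thus "\<forall>k. fourier_coeff g k = symbs js k *s fourier_coeff f k" by (simp add: vec_eq_iff)
next
  assume *: "\<forall>k. fourier_coeff g k = symbs js k *s fourier_coeff f k"
  show "is_weak_deriv js f g"
    unfolding is_weak_deriv_def
  proof (intro ballI)
    fix \<phi> assume \<phi>: "\<phi> \<in> test_functions"
    let ?s = "(-1::real) ^ length js"
    note c = test_function_continuous[OF \<phi>, of js] test_function_continuous[OF \<phi>, of "[]", simplified]
    have "(\<integral>x. pds js \<phi> x *\<^sub>R f x \<partial>torus3) $ i = ?s * (\<integral>x. \<phi> x *\<^sub>R g x \<partial>torus3) $ i" for i
    proof -
      let ?P = "\<lambda>x. pds js \<phi> x *\<^sub>R (axis i 1 :: real^3)" and ?Q = "\<lambda>x. \<phi> x *\<^sub>R (axis i 1 :: real^3)"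
      have L: "?P \<in> L2" "?Q \<in> L2" by (intro L2_continuous continuous_intros c)+
      have fcP: "fourier_coeff ?P k = (of_real ?s * symbs js (- k)) *s fourier_coeff ?Q k" for k
      proof -
        have "fourier_coeff ?P k $ j = of_real ?s * symbs js (- k) * fourier_coeff ?Q k $ j" for j
        proof (cases "j = i")
          case True
          thus ?thesis using integral_pds_times_wave[OF \<phi>, of js "- k"]
            by (simp add: fourier_coeff_nth mult.commute[of _ "wave (- k) _"])
        qed (simp add: fourier_coeff_nth axis_def)
        thus ?thesis by (simp add: vec_eq_iff)
      qed
      have "fourier_coeff f k \<bullet> fourier_coeff ?P k = ?s * (fourier_coeff g k \<bullet> fourier_coeff ?Q k)" for k
      proof -
        have "?s * (fourier_coeff g k \<bullet> fourier_coeff ?Q k)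
            = ?s * ((symbs js k *s fourier_coeff f k) \<bullet> fourier_coeff ?Q k)"
          using * by simp
        also have "\<dots> = ?s * (fourier_coeff f k \<bullet> (symbs js (- k) *s fourier_coeff ?Q k))"
          by (simp only: inner_vector_scalar_mult symbs_uminus)
        also have "\<dots> = fourier_coeff f k \<bullet> (?s *\<^sub>R (symbs js (- k) *s fourier_coeff ?Q k))"
          by simp
        also have "?s *\<^sub>R (symbs js (- k) *s fourier_coeff ?Q k) = fourier_coeff ?P k"
          unfolding fcP scaleR_eq_smult by (simp add: vector_smult_assoc)
        finally show ?thesis by simp
      qed
      hence "(\<lambda>n. \<Sum>k\<in>int_box n. fourier_coeff f k \<bullet> fourier_coeff ?P k)
           = (\<lambda>n. ?s * (\<Sum>k\<in>int_box n. fourier_coeff g k \<bullet> fourier_coeff ?Q k))"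
        by (simp add: sum_distrib_left)
      hence "(\<lambda>n. \<Sum>k\<in>int_box n. fourier_coeff f k \<bullet> fourier_coeff ?P k) \<longlonglongrightarrow> ?s * l2_inner g ?Q"
        using tendsto_mult_left[OF Parseval_tendsto[OF g L(2)], of ?s] by simp
      hence "l2_inner f ?P = ?s * l2_inner g ?Q"
        using Parseval_tendsto[OF f L(1)] LIMSEQ_unique by blast
      thus ?thesis
        unfolding integral_scaleR_nth(2)[OF f c(1)] integral_scaleR_nth(2)[OF g c(2)]
        by (simp add: l2_inner_commute)
    qed
    thus "(\<integral>x. pds js \<phi> x *\<^sub>R f x \<partial>torus3) = ?s *\<^sub>R (\<integral>x. \<phi> x *\<^sub>R g x \<partial>torus3)"
      by (simp add: vec_eq_iff)
  qed
qed

section \<open>Sobolev spaces in terms of Fourier coefficients\<close>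

lemma Hm_L2: "f \<in> Hm m \<Longrightarrow> f \<in> L2"
  by (simp add: Hm_def)

lemma Hm_weak_deriv:
  assumes f: "f \<in> Hm m" and js: "length js \<le> m"
  shows "weak_deriv js f \<in> L2" "fourier_coeff (weak_deriv js f) k = symbs js k *s fourier_coeff f k"
proof -
  have "\<exists>g. g \<in> L2 \<and> is_weak_deriv js f g" using f js by (auto simp: Hm_def)
  hence "weak_deriv js f \<in> L2 \<and> is_weak_deriv js f (weak_deriv js f)"
    unfolding weak_deriv_def by (rule someI_ex)
  thus "weak_deriv js f \<in> L2" "fourier_coeff (weak_deriv js f) k = symbs js k *s fourier_coeff f k"
    using is_weak_deriv_iff Hm_L2[OF f] by blast+
qed

lemma l2_norm_eq_of_fourier_coeff_eq:
  assumes "f \<in> L2" "g \<in> L2" "\<And>k. fourier_coeff f k = fourier_coeff g k"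
  shows "l2_norm f = l2_norm g"
  by (intro l2_norm_cong_AE AE_eq_of_fourier_coeff_eq assms)

lemma HmI:
  assumes "f \<in> L2"
    "\<And>js. length js \<le> m \<Longrightarrow> \<exists>g\<in>L2. \<forall>k. fourier_coeff g k = symbs js k *s fourier_coeff f k"
  shows "f \<in> Hm m"
  using assms is_weak_deriv_iff by (auto simp: Hm_def)

lemma l2_norm_weak_deriv_eq:
  assumes "f \<in> Hm m" "length js \<le> m" "g \<in> L2" "\<And>k. fourier_coeff g k = symbs js k *s fourier_coeff f k"
  shows "l2_norm (weak_deriv js f) = l2_norm g"
  by (rule l2_norm_eq_of_fourier_coeff_eq) (use assms Hm_weak_deriv in auto)

lemma finite_lists_le [simp]: "finite {js :: 3 list. length js \<le> m}"
  using finite_lists_length_le[of "UNIV :: 3 set" m] by simp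

lemma Hm_norm_nonneg [simp]: "Hm_norm m f \<ge> 0"
  by (simp add: Hm_norm_def sum_nonneg)

lemma l2_norm_weak_deriv_le_Hm_norm:
  assumes "length js \<le> m"
  shows "l2_norm (weak_deriv js f) \<le> Hm_norm m f"
proof -
  have "(l2_norm (weak_deriv js f))\<^sup>2 \<le> (\<Sum>js\<in>{js. length js \<le> m}. (l2_norm (weak_deriv js f))\<^sup>2)"
    by (rule member_le_sum) (use assms in auto)
  thus ?thesis unfolding Hm_norm_def by (rule real_le_rsqrt)
qed

lemma l2_norm_le_Hm_norm:
  assumes "f \<in> Hm m"
  shows "l2_norm f \<le> Hm_norm m f"
  using l2_norm_weak_deriv_eq[OF assms, of "[]" f] l2_norm_weak_deriv_le_Hm_norm[of "[]" m f] Hm_L2[OF assms] by simp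

lemma Hm_scaleR:
  assumes f: "f \<in> Hm m"
  shows "(\<lambda>x. c *\<^sub>R f x) \<in> Hm m" "Hm_norm m (\<lambda>x. c *\<^sub>R f x) = \<bar>c\<bar> * Hm_norm m f"
proof -
  have fc: "fourier_coeff (\<lambda>x. c *\<^sub>R weak_deriv js f x) k = symbs js k *s fourier_coeff (\<lambda>x. c *\<^sub>R f x) k"
    if "length js \<le> m" for js k
    by (simp add: fourier_coeff_scaleR Hm_weak_deriv[OF f that] vec_eq_iff)
  show 1: "(\<lambda>x. c *\<^sub>R f x) \<in> Hm m"
    using fc Hm_weak_deriv(1)[OF f] Hm_L2[OF f] by (intro HmI) blast+
  have "l2_norm (weak_deriv js (\<lambda>x. c *\<^sub>R f x)) = \<bar>c\<bar> * l2_norm (weak_deriv js f)" if "length js \<le> m" for js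
    using l2_norm_weak_deriv_eq[OF 1 that _ fc[OF that]] Hm_weak_deriv(1)[OF f that] by (simp add: L2_scaleR l2_norm_scaleR)
  hence "(\<Sum>js\<in>{js. length js \<le> m}. (l2_norm (weak_deriv js (\<lambda>x. c *\<^sub>R f x)))\<^sup>2)
      = c\<^sup>2 * (\<Sum>js\<in>{js. length js \<le> m}. (l2_norm (weak_deriv js f))\<^sup>2)"
    by (simp add: power_mult_distrib sum_distrib_left)
  thus "Hm_norm m (\<lambda>x. c *\<^sub>R f x) = \<bar>c\<bar> * Hm_norm m f"
    by (simp add: Hm_norm_def real_sqrt_mult)
qed

lemma Hm_diff:
  assumes f: "f \<in> Hm m" and g: "g \<in> Hm m"
  shows "(\<lambda>x. f x - g x) \<in> Hm m"
proof (rule HmI)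
  show "(\<lambda>x. f x - g x) \<in> L2" using f g by (auto intro: Hm_L2)
  fix js :: "3 list" assume js: "length js \<le> m"
  show "\<exists>h\<in>L2. \<forall>k. fourier_coeff h k = symbs js k *s fourier_coeff (\<lambda>x. f x - g x) k"
    by (rule bexI[of _ "\<lambda>x. weak_deriv js f x - weak_deriv js g x"])
      (use f g js Hm_weak_deriv in \<open>auto simp: fourier_coeff_diff Hm_L2 vec_eq_iff algebra_simps\<close>)
qed

lemma finite_ex_max:
  fixes f :: "'a::finite \<Rightarrow> real"
  shows "\<exists>j. \<forall>i. f i \<le> f j"
proof -
  have "Max (range f) \<in> range f" by (rule Max_in) auto
  then obtain j where "f j = Max (range f)" by (metis imageE)
  hence "f i \<le> f j" for i by simp
  thus ?thesis by blast
qed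

text \<open>The largest component of a frequency controls its length up to the factor 3, so the pure
  derivatives of order m suffice.\<close>

lemma Hm_coeff_bound:
  assumes f: "f \<in> Hm m"
  obtains B where "B \<ge> 0" "\<And>F. finite F \<Longrightarrow> (\<Sum>k\<in>F. (norm (freq k) ^ m * norm (fourier_coeff f k))\<^sup>2) \<le> B\<^sup>2"
proof -
  define D where "D = (\<Sum>i\<in>UNIV. (l2_norm (weak_deriv (replicate m i) f))\<^sup>2)"
  have symbs_rep: "norm (symbs (replicate m i) k) = (2 * pi * \<bar>of_int (k $ i)\<bar>) ^ m" for i k
    by (induction m) (simp_all add: symb_def norm_mult)
  have nine: "((3::real) ^ m)\<^sup>2 = 9 ^ m"
    by (simp add: power2_eq_square flip: power_mult_distrib)
  have key: "(norm (freq k) ^ m)\<^sup>2 \<le> 9 ^ m * (\<Sum>i\<in>UNIV. (norm (symbs (replicate m i) k))\<^sup>2)" for k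
  proof -
    obtain j where j: "\<And>i. \<bar>freq k $ i\<bar> \<le> \<bar>freq k $ j\<bar>"
      using finite_ex_max[of "\<lambda>i. \<bar>freq k $ i\<bar>"] by blast
    have "norm (freq k) \<le> (\<Sum>i\<in>UNIV. \<bar>freq k $ i\<bar>)" by (rule norm_le_l1_cart)
    also have "\<dots> \<le> (\<Sum>i\<in>(UNIV::3 set). \<bar>freq k $ j\<bar>)" by (rule sum_mono) (rule j)
    also have "\<dots> = 3 * \<bar>of_int (k $ j)\<bar>" by simp
    also have "\<dots> \<le> 3 * (2 * pi * \<bar>of_int (k $ j)\<bar>)"
      using pi_gt3 by (intro mult_left_mono) (auto simp: mult_le_cancel_right1)
    finally have "(norm (freq k) ^ m)\<^sup>2 \<le> ((3 * (2 * pi * \<bar>of_int (k $ j)\<bar>)) ^ m)\<^sup>2"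
      by (intro power_mono) auto
    also have "\<dots> = 9 ^ m * (norm (symbs (replicate m j) k))\<^sup>2"
      by (simp only: symbs_rep power_mult_distrib nine)
    also have "\<dots> \<le> 9 ^ m * (\<Sum>i\<in>UNIV. (norm (symbs (replicate m i) k))\<^sup>2)"
      by (intro mult_left_mono member_le_sum) auto
    finally show ?thesis .
  qed
  have bound: "(\<Sum>k\<in>F. (norm (freq k) ^ m * norm (fourier_coeff f k))\<^sup>2) \<le> 9 ^ m * D" if F: "finite F" for F
  proof -
    have "(\<Sum>k\<in>F. (norm (freq k) ^ m * norm (fourier_coeff f k))\<^sup>2)
       \<le> (\<Sum>k\<in>F. 9 ^ m * (\<Sum>i\<in>UNIV. (norm (symbs (replicate m i) k))\<^sup>2) * (norm (fourier_coeff f k))\<^sup>2)"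
      unfolding power_mult_distrib by (intro sum_mono mult_right_mono key) auto
    also have "\<dots> = 9 ^ m * (\<Sum>i\<in>UNIV. \<Sum>k\<in>F. (norm (fourier_coeff (weak_deriv (replicate m i) f) k))\<^sup>2)"
      by (subst sum.swap) (simp add: Hm_weak_deriv[OF f] norm_vector_scalar_mult power_mult_distrib
          sum_distrib_left sum_distrib_right mult_ac)
    also have "\<dots> \<le> 9 ^ m * D"
      unfolding D_def by (intro mult_left_mono sum_mono Bessel F Hm_weak_deriv[OF f]) auto
    finally show ?thesis .
  qed
  have "D \<ge> 0" by (simp add: D_def sum_nonneg)
  thus ?thesis using bound by (intro that[of "sqrt (9 ^ m * D)"]) auto
qed

lemma H1_coeff_bound:
  assumes f: "f \<in> Hm 1" and F: "finite F"
  shows "(\<Sum>k\<in>F. (norm (freq k) * norm (fourier_coeff f k))\<^sup>2) \<le> (Hm_norm 1 f)\<^sup>2"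
proof -
  have "(\<Sum>k\<in>F. (norm (freq k) * norm (fourier_coeff f k))\<^sup>2)
      \<le> (\<Sum>k\<in>F. (\<Sum>i\<in>UNIV. (norm (symb i k))\<^sup>2) * (norm (fourier_coeff f k))\<^sup>2)"
    unfolding power_mult_distrib sum_norm_symb
  proof (intro sum_mono mult_right_mono)
    fix k
    have "1 * (norm (freq k))\<^sup>2 \<le> (2 * pi)\<^sup>2 * (norm (freq k))\<^sup>2"
      using pi_gt3 by (intro mult_right_mono one_le_power) auto
    thus "(norm (freq k))\<^sup>2 \<le> 2\<^sup>2 * pi\<^sup>2 * (norm (freq k))\<^sup>2" by (simp add: power_mult_distrib)
  qed auto
  also have "\<dots> = (\<Sum>i\<in>UNIV. \<Sum>k\<in>F. (norm (fourier_coeff (weak_deriv [i] f) k))\<^sup>2)"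
    by (subst sum.swap) (simp add: Hm_weak_deriv[OF f] norm_vector_scalar_mult power_mult_distrib
        sum_distrib_left sum_distrib_right mult_ac)
  also have "\<dots> \<le> (\<Sum>i\<in>UNIV. (l2_norm (weak_deriv [i] f))\<^sup>2)"
    by (intro sum_mono Bessel F Hm_weak_deriv[OF f]) auto
  also have "\<dots> = (\<Sum>js\<in>(\<lambda>i. [i]) ` UNIV. (l2_norm (weak_deriv js f))\<^sup>2)"
    by (subst sum.reindex) (auto simp: inj_on_def)
  also have "\<dots> \<le> (\<Sum>js\<in>{js. length js \<le> 1}. (l2_norm (weak_deriv js f))\<^sup>2)"
    by (rule sum_mono2) auto
  also have "\<dots> = (Hm_norm 1 f)\<^sup>2"
    by (simp add: Hm_norm_def sum_nonneg)
  finally show ?thesis .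
qed

text \<open>The nonzero frequencies have length at least 1, so that in the absence of a mean value the symbol of
  order m dominates all symbols of lower order.\<close>

lemma Hm_of_coeff_bound:
  assumes f: "f \<in> L2" and 0: "fourier_coeff f 0 = 0" and B: "B \<ge> 0"
    and bound: "\<And>F. finite F \<Longrightarrow> (\<Sum>k\<in>F. (norm (freq k) ^ m * norm (fourier_coeff f k))\<^sup>2) \<le> B\<^sup>2"
  shows "f \<in> Hm m"
    and "Hm_norm m f \<le> sqrt (card {js :: 3 list. length js \<le> m}) * ((2 * pi) ^ m * B)"
proof -
  have deriv: "\<exists>g\<in>L2. (\<forall>k. fourier_coeff g k = symbs js k *s fourier_coeff f k) \<and> l2_norm g \<le> (2 * pi) ^ m * B"
    if js: "length js \<le> m" for js
  proof -
    have sy: "norm (symbs js k *s fourier_coeff f k) \<le> (2 * pi) ^ m * (norm (freq k) ^ m * norm (fourier_coeff f k))" for k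
    proof (cases "k = 0")
      case False
      have "1 * 1 \<le> 2 * pi * norm (freq k)"
        using pi_gt3 norm_freq_ge_1[OF False] by (intro mult_mono) auto
      hence "(2 * pi * norm (freq k)) ^ length js \<le> (2 * pi * norm (freq k)) ^ m"
        using js by (intro power_increasing) auto
      hence "norm (symbs js k) \<le> (2 * pi * norm (freq k)) ^ m"
        using norm_symbs_le[of js k] by linarith
      thus ?thesis by (simp add: norm_vector_scalar_mult power_mult_distrib mult_right_mono flip: mult.assoc)
    qed (simp add: 0)
    have "(\<Sum>k\<in>F. (norm (symbs js k *s fourier_coeff f k))\<^sup>2) \<le> ((2 * pi) ^ m * B)\<^sup>2" if F: "finite F" for F
    proof -
      have "(\<Sum>k\<in>F. (norm (symbs js k *s fourier_coeff f k))\<^sup>2)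
          \<le> (\<Sum>k\<in>F. ((2 * pi) ^ m * (norm (freq k) ^ m * norm (fourier_coeff f k)))\<^sup>2)"
        by (intro sum_mono power_mono sy) auto
      also have "\<dots> = ((2 * pi) ^ m)\<^sup>2 * (\<Sum>k\<in>F. (norm (freq k) ^ m * norm (fourier_coeff f k))\<^sup>2)"
        by (simp add: power_mult_distrib sum_distrib_left)
      also have "\<dots> \<le> ((2 * pi) ^ m)\<^sup>2 * B\<^sup>2" by (intro mult_left_mono bound F) auto
      finally show ?thesis by (simp add: power_mult_distrib)
    qed
    from Riesz_Fischer[OF hermitian_symbs[OF hermitian_fourier_coeff[of f], of js] this]
    show ?thesis using B by (metis mult_nonneg_nonneg pi_ge_zero zero_le_numeral zero_le_power)
  qed
  show Hm: "f \<in> Hm m" using deriv by (intro HmI f) blast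
  have "l2_norm (weak_deriv js f) \<le> (2 * pi) ^ m * B" if "length js \<le> m" for js
    using deriv[OF that] l2_norm_weak_deriv_eq[OF Hm that] by metis
  hence "(\<Sum>js\<in>{js. length js \<le> m}. (l2_norm (weak_deriv js f))\<^sup>2) \<le> (\<Sum>js\<in>{js::3 list. length js \<le> m}. ((2 * pi) ^ m * B)\<^sup>2)"
    by (intro sum_mono power_mono) auto
  hence "Hm_norm m f \<le> sqrt (real (card {js :: 3 list. length js \<le> m}) * ((2 * pi) ^ m * B)\<^sup>2)"
    by (simp add: Hm_norm_def)
  thus "Hm_norm m f \<le> sqrt (card {js :: 3 list. length js \<le> m}) * ((2 * pi) ^ m * B)"
    using B by (simp add: real_sqrt_mult)
qed

section \<open>The trilinear estimate\<close>

lemma sum_int_even_le: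
  fixes g :: "int \<Rightarrow> real"
  assumes even: "\<And>n. g (- n) = g n" and nonneg: "\<And>n. g n \<ge> 0"
  shows "(\<Sum>n\<in>{- int N..int N}. g n) \<le> 2 * (\<Sum>n\<le>N. g (int n))"
proof (induction N)
  case (Suc N)
  have "{- int (Suc N)..int (Suc N)} = insert (int (Suc N)) (insert (- int (Suc N)) {- int N..int N})"
    by auto
  thus ?case using Suc even[of "int (Suc N)"] by simp
qed (use nonneg in simp)

text \<open>In three dimensions the fourth power of the frequency dominates a product of one factor per
  coordinate, each growing like the power 4/3, which is summable over the integers.\<close>

lemma lattice_sum_bounded:
  obtains S :: real where "S \<ge> 0" "\<And>G :: (int^3) set. finite G \<Longrightarrow> 0 \<notin> G \<Longrightarrow> (\<Sum>k\<in>G. 1 / norm (freq k) ^ 4) \<le> S\<^sup>2"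
proof -
  define g :: "int \<Rightarrow> real" where "g n = (1 + (of_int n)\<^sup>2) powr (- 2 / 3)" for n
  have g0: "g n \<ge> 0" for n by (simp add: g_def)
  have "summable (\<lambda>n. g (int n))"
  proof (rule summable_comparison_test'[of "\<lambda>n. real n powr (- 4 / 3)" 1])
    show "summable (\<lambda>n. real n powr (- 4 / 3))" by (subst summable_real_powr_iff) simp
    fix n :: nat assume n: "n \<ge> 1"
    have "g (int n) \<le> ((real n)\<^sup>2) powr (- 2 / 3)"
      unfolding g_def using n by (intro powr_mono2') auto
    also have "\<dots> = real n powr (- 4 / 3)"
      using n by (simp add: powr_powr flip: powr_numeral)
    finally show "norm (g (int n)) \<le> real n powr (- 4 / 3)" using g0 by simp
  qed
  define M where "M = 2 * (\<Sum>n. g (int n))"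
  have M0: "M \<ge> 0" unfolding M_def using g0 by (simp add: suminf_nonneg \<open>summable (\<lambda>n. g (int n))\<close>)
  have gM: "(\<Sum>n\<in>{- int N..int N}. g n) \<le> M" for N
  proof -
    have "(\<Sum>n\<in>{- int N..int N}. g n) \<le> 2 * (\<Sum>n\<le>N. g (int n))"
      by (rule sum_int_even_le) (simp_all add: g_def)
    also have "\<dots> \<le> M"
      unfolding M_def using \<open>summable (\<lambda>n. g (int n))\<close> g0 by (simp add: sum_le_suminf)
    finally show ?thesis .
  qed
  have term_le: "1 / norm (freq k) ^ 4 \<le> 4 * (\<Prod>i\<in>UNIV. g (k $ i))" if "k \<noteq> 0" for k
  proof -
    let ?r = "(norm (freq k))\<^sup>2"
    have r1: "?r \<ge> 1" using norm_freq_ge_1[OF that] by simp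
    have "(of_int (k $ i))\<^sup>2 \<le> ?r" for i
      using component_le_norm_cart[of "freq k" i] power_mono[of "\<bar>freq k $ i\<bar>" "norm (freq k)" 2] by simp
    hence "(\<Prod>i\<in>UNIV. 1 + (of_int (k $ i))\<^sup>2) \<le> (\<Prod>i\<in>(UNIV::3 set). 1 + ?r)"
      by (intro prod_mono) auto
    hence le: "(\<Prod>i\<in>UNIV. 1 + (of_int (k $ i))\<^sup>2) \<le> (1 + ?r) ^ 3" by simp
    have pos: "(\<Prod>i\<in>UNIV. 1 + (of_int (k $ i))\<^sup>2) > (0::real)"
      by (intro prod_pos) (auto intro: add_pos_nonneg)
    have "1 / norm (freq k) ^ 4 = 1 / ?r ^ 2" by (simp flip: power_mult)
    also have "\<dots> \<le> 1 / (((1 + ?r) / 2) ^ 2)"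
      using r1 by (intro divide_left_mono power_mono mult_pos_pos zero_less_power) auto
    also have "\<dots> = 4 * (1 + ?r) powr (- 2)"
      using r1 by (simp add: powr_minus power_divide field_simps)
    also have "(1 + ?r) powr (- 2) = ((1 + ?r) ^ 3) powr (- 2 / 3)"
      using r1 by (simp add: powr_powr flip: powr_numeral)
    also have "\<dots> \<le> (\<Prod>i\<in>UNIV. 1 + (of_int (k $ i))\<^sup>2) powr (- 2 / 3)"
      using pos le by (intro powr_mono2') auto
    also have "\<dots> = (\<Prod>i\<in>UNIV. g (k $ i))"
      unfolding g_def by (rule prod_powr_distrib)
    finally show ?thesis by simp
  qed
  have bound: "(\<Sum>k\<in>G. 1 / norm (freq k) ^ 4) \<le> 4 * M ^ 3" if G: "finite G" "0 \<notin> G" for G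
  proof -
    obtain N where N: "G \<subseteq> int_box N" using finite_subset_int_box[OF G(1)] .
    have "(\<Sum>k\<in>G. 1 / norm (freq k) ^ 4) \<le> (\<Sum>k\<in>G. 4 * (\<Prod>i\<in>UNIV. g (k $ i)))"
      by (intro sum_mono term_le) (use G in auto)
    also have "\<dots> = (\<Sum>h\<in>(\<lambda>k i. k $ i) ` G. 4 * (\<Prod>i\<in>UNIV. g (h i)))"
      by (subst sum.reindex) (auto simp: inj_on_def vec_eq_iff fun_eq_iff)
    also have "\<dots> \<le> (\<Sum>h\<in>(UNIV :: 3 set) \<rightarrow>\<^sub>E {- int N..int N}. 4 * (\<Prod>i\<in>UNIV. g (h i)))"
    proof (rule sum_mono2)
      show "(\<lambda>k i. k $ i) ` G \<subseteq> UNIV \<rightarrow>\<^sub>E {- int N..int N}"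
        using N by (auto simp: int_box_def abs_le_iff subset_iff) (metis minus_le_iff)
    qed (auto intro!: finite_PiE mult_nonneg_nonneg prod_nonneg g0)
    also have "\<dots> = 4 * (\<Prod>i\<in>(UNIV :: 3 set). \<Sum>n\<in>{- int N..int N}. g n)"
      by (subst prod_sum_PiE) (simp_all add: sum_distrib_left)
    also have "\<dots> \<le> 4 * (\<Prod>i\<in>(UNIV :: 3 set). M)"
      by (intro mult_left_mono prod_mono conjI sum_nonneg g0 gM) auto
    finally show ?thesis by simp
  qed
  show ?thesis
    by (rule that[of "sqrt (4 * M ^ 3)"]) (use M0 bound in auto)
qed

text \<open>This is the embedding of a product of two functions from the first-order Sobolev space into the square
  integrable functions, in terms of Fourier coefficients. Cauchy-Schwarz over all pairs of frequencies leaves a factor that is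
  at most the square root of the lattice sum, by the inequality between the arithmetic and the
  geometric mean.\<close>

lemma trilinear_bound:
  fixes x y z :: "int^3 \<Rightarrow> real"
  assumes S: "S \<ge> 0" "\<And>G :: (int^3) set. finite G \<Longrightarrow> 0 \<notin> G \<Longrightarrow> (\<Sum>k\<in>G. 1 / norm (freq k) ^ 4) \<le> S\<^sup>2"
    and F: "finite F" and 0: "x 0 = 0" "y 0 = 0"
    and A: "A \<ge> 0" "(\<Sum>k\<in>F. (norm (freq k) * x k)\<^sup>2) \<le> A\<^sup>2"
    and B: "B \<ge> 0" "(\<Sum>k\<in>F. (norm (freq k) * y k)\<^sup>2) \<le> B\<^sup>2"
    and C: "C \<ge> 0" "\<And>G. finite G \<Longrightarrow> (\<Sum>k\<in>G. (z k)\<^sup>2) \<le> C\<^sup>2"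
  shows "(\<Sum>l\<in>F. \<Sum>p\<in>F. x l * y p * z (l + p)) \<le> S * A * B * C"
proof -
  define E where "E = F - {0}"
  have E: "finite E" "0 \<notin> E" "E \<subseteq> F" using F by (auto simp: E_def)
  define a where "a k = norm (freq k) * x k" for k
  define b where "b k = norm (freq k) * y k" for k
  define q where "q k = 1 / norm (freq k)" for k
  have nz: "norm (freq k) \<noteq> 0" if "k \<in> E" for k using that E by (metis norm_eq_zero freq_eq_0_iff)
  have "(\<Sum>l\<in>F. \<Sum>p\<in>F. x l * y p * z (l + p)) = (\<Sum>l\<in>E. \<Sum>p\<in>E. x l * y p * z (l + p))"
    unfolding E_def using F 0
    by (intro sum.mono_neutral_cong_right sum.mono_neutral_right) auto
  also have "\<dots> = (\<Sum>(l,p)\<in>E\<times>E. (a l * b p) * (q l * q p * z (l + p)))"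
    unfolding sum.cartesian_product
    by (intro sum.cong) (use nz in \<open>auto simp: a_def b_def q_def\<close>)
  also have "\<dots> \<le> (\<Sum>s\<in>E\<times>E. \<bar>a (fst s) * b (snd s)\<bar> * \<bar>q (fst s) * q (snd s) * z (fst s + snd s)\<bar>)"
    by (intro sum_mono) (auto simp: abs_mult[symmetric])
  also have "\<dots> \<le> L2_set (\<lambda>s. a (fst s) * b (snd s)) (E\<times>E) * L2_set (\<lambda>s. q (fst s) * q (snd s) * z (fst s + snd s)) (E\<times>E)"
    by (rule L2_set_mult_ineq)
  also have "\<dots> \<le> (A * B) * (S * C)"
  proof (intro mult_mono)
    have "(\<Sum>s\<in>E\<times>E. (a (fst s) * b (snd s))\<^sup>2) = (\<Sum>l\<in>E. (a l)\<^sup>2) * (\<Sum>p\<in>E. (b p)\<^sup>2)"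
      by (simp add: sum_product sum.cartesian_product power_mult_distrib split_beta)
    also have "\<dots> \<le> A\<^sup>2 * B\<^sup>2"
    proof (intro mult_mono)
      have "(\<Sum>l\<in>E. (a l)\<^sup>2) \<le> (\<Sum>l\<in>F. (a l)\<^sup>2)" "(\<Sum>l\<in>E. (b l)\<^sup>2) \<le> (\<Sum>l\<in>F. (b l)\<^sup>2)"
        by (intro sum_mono2 F E; simp)+
      thus "(\<Sum>l\<in>E. (a l)\<^sup>2) \<le> A\<^sup>2" "(\<Sum>l\<in>E. (b l)\<^sup>2) \<le> B\<^sup>2"
        using A(2) B(2) unfolding a_def b_def by linarith+
    qed (auto intro: sum_nonneg)
    finally show "L2_set (\<lambda>s. a (fst s) * b (snd s)) (E\<times>E) \<le> A * B"
      unfolding L2_set_def using A(1) B(1) by (intro real_le_lsqrt) (auto simp: power_mult_distrib)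
    have S': "(\<Sum>l\<in>E. q l ^ 4) \<le> S\<^sup>2" using S(2)[OF E(1,2)] by (simp add: q_def power_divide)
    have shift: "(\<Sum>p\<in>E. (z (l + p))\<^sup>2) \<le> C\<^sup>2" "(\<Sum>p\<in>E. (z (p + l))\<^sup>2) \<le> C\<^sup>2" for l
    proof -
      have "(\<Sum>p\<in>E. (z (l + p))\<^sup>2) = (\<Sum>k\<in>(+) l ` E. (z k)\<^sup>2)" by (subst sum.reindex) auto
      thus "(\<Sum>p\<in>E. (z (l + p))\<^sup>2) \<le> C\<^sup>2" using C(2)[of "(+) l ` E"] E by simp
      thus "(\<Sum>p\<in>E. (z (p + l))\<^sup>2) \<le> C\<^sup>2" by (simp add: add.commute)
    qed
    have "(\<Sum>s\<in>E\<times>E. (q (fst s) * q (snd s) * z (fst s + snd s))\<^sup>2)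
        \<le> (\<Sum>s\<in>E\<times>E. (q (fst s) ^ 4 / 2 + q (snd s) ^ 4 / 2) * (z (fst s + snd s))\<^sup>2)"
    proof (rule sum_mono)
      fix s :: "(int^3) \<times> (int^3)"
      have "2 * (q (fst s))\<^sup>2 * (q (snd s))\<^sup>2 \<le> ((q (fst s))\<^sup>2)\<^sup>2 + ((q (snd s))\<^sup>2)\<^sup>2"
        by (rule sum_squares_bound)
      hence "(q (fst s))\<^sup>2 * (q (snd s))\<^sup>2 \<le> q (fst s) ^ 4 / 2 + q (snd s) ^ 4 / 2"
        by (simp flip: power_mult)
      thus "(q (fst s) * q (snd s) * z (fst s + snd s))\<^sup>2
          \<le> (q (fst s) ^ 4 / 2 + q (snd s) ^ 4 / 2) * (z (fst s + snd s))\<^sup>2"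
        by (simp add: power_mult_distrib mult_right_mono)
    qed
    also have "\<dots> = (\<Sum>l\<in>E. \<Sum>p\<in>E. q l ^ 4 / 2 * (z (l + p))\<^sup>2) + (\<Sum>l\<in>E. \<Sum>p\<in>E. q p ^ 4 / 2 * (z (l + p))\<^sup>2)"
      by (simp add: sum.cartesian_product split_beta distrib_right sum.distrib)
    also have "(\<Sum>l\<in>E. \<Sum>p\<in>E. q p ^ 4 / 2 * (z (l + p))\<^sup>2) = (\<Sum>l\<in>E. \<Sum>p\<in>E. q l ^ 4 / 2 * (z (p + l))\<^sup>2)"
      by (rule sum.swap)
    also have "(\<Sum>l\<in>E. \<Sum>p\<in>E. q l ^ 4 / 2 * (z (l + p))\<^sup>2) + (\<Sum>l\<in>E. \<Sum>p\<in>E. q l ^ 4 / 2 * (z (p + l))\<^sup>2)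
       \<le> (\<Sum>l\<in>E. q l ^ 4 / 2 * C\<^sup>2) + (\<Sum>l\<in>E. q l ^ 4 / 2 * C\<^sup>2)"
      unfolding sum_distrib_left[symmetric]
      by (intro add_mono sum_mono mult_left_mono shift) auto
    also have "\<dots> = (\<Sum>l\<in>E. q l ^ 4) * C\<^sup>2"
      by (simp add: sum_distrib_left mult.commute flip: sum.distrib)
    also have "\<dots> \<le> S\<^sup>2 * C\<^sup>2" by (intro mult_right_mono S') auto
    finally show "L2_set (\<lambda>s. q (fst s) * q (snd s) * z (fst s + snd s)) (E\<times>E) \<le> S * C"
      unfolding L2_set_def using S(1) C(1) by (intro real_le_lsqrt) (auto simp: power_mult_distrib)
  qed (use A(1) B(1) in \<open>auto intro: L2_set_nonneg\<close>)
  finally show ?thesis by (simp add: mult_ac)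
qed

lemma norm_sum_mult_le:
  fixes v w :: "complex^'n"
  shows "norm (\<Sum>i\<in>UNIV. v $ i * w $ i) \<le> norm v * norm w"
proof -
  have "norm (\<Sum>i\<in>UNIV. v $ i * w $ i) \<le> (\<Sum>i\<in>UNIV. \<bar>norm (v $ i)\<bar> * \<bar>norm (w $ i)\<bar>)"
    by (rule order_trans[OF norm_sum]) (simp add: norm_mult)
  also have "\<dots> \<le> norm v * norm w"
    unfolding norm_vec_def by (rule L2_set_mult_ineq)
  finally show ?thesis .
qed

section \<open>Trigonometric fields\<close>

text \<open>Componentwise membership in the algebra of trigonometric polynomials, so that the advection term
  of two such fields is again one.\<close>

definition trig_field :: "vfield \<Rightarrow> bool" where
  "trig_field f \<longleftrightarrow> (\<forall>i. (\<lambda>x. complex_of_real (f x $ i)) \<in> trig_span)"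

lemma trig_span_sum:
  "finite I \<Longrightarrow> (\<And>i. i \<in> I \<Longrightarrow> f i \<in> trig_span) \<Longrightarrow> (\<lambda>x. \<Sum>i\<in>I. f i x) \<in> trig_span"
  by (induction rule: finite_induct) (auto intro: trig_span.add trig_span_const)

lemma trig_span_finite_sum:
  assumes "f \<in> trig_span"
  shows "\<exists>K d. finite K \<and> (\<forall>x. f x = (\<Sum>k\<in>K. d k * wave k x))"
  using assms
proof (induction)
  case (wave k)
  show ?case by (rule exI[of _ "{k}"], rule exI[of _ "\<lambda>_. 1"]) simp
next
  case (scale f c)
  then obtain K d where "finite K" "\<And>x. f x = (\<Sum>k\<in>K. d k * wave k x)" by blast
  thus ?case by (intro exI[of _ K] exI[of _ "\<lambda>k. c * d k"]) (simp add: sum_distrib_left mult.assoc)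
next
  case (add f g)
  then obtain K d L e where *: "finite K" "\<And>x. f x = (\<Sum>k\<in>K. d k * wave k x)"
    "finite L" "\<And>x. g x = (\<Sum>k\<in>L. e k * wave k x)" by blast
  have "f x = (\<Sum>k\<in>K \<union> L. (if k \<in> K then d k else 0) * wave k x)"
    "g x = (\<Sum>k\<in>K \<union> L. (if k \<in> L then e k else 0) * wave k x)" for x
    using * by (auto intro!: sum.mono_neutral_cong_left)
  hence "f x + g x = (\<Sum>k\<in>K \<union> L. ((if k \<in> K then d k else 0) + (if k \<in> L then e k else 0)) * wave k x)" for x
    by (simp only: distrib_right sum.distrib)
  thus ?case using * by (intro exI[of _ "K \<union> L"]
      exI[of _ "\<lambda>k. (if k \<in> K then d k else 0) + (if k \<in> L then e k else 0)"]) blast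
qed

text \<open>The coefficients of any representation by waves are the Fourier coefficients, so that a common box
  of frequencies serves all components.\<close>

lemma trig_field_eq_trig_sum:
  assumes "trig_field f"
  obtains n where "\<And>N. N \<ge> n \<Longrightarrow> f = trig_sum (int_box N) (fourier_coeff f)"
    "\<And>N x i. N \<ge> n \<Longrightarrow> complex_of_real (f x $ i) = (\<Sum>k\<in>int_box N. fourier_coeff f k $ i * wave k x)"
proof -
  have "\<forall>i. \<exists>K d. finite K \<and> (\<forall>x. complex_of_real (f x $ i) = (\<Sum>k\<in>K. d k * wave k x))"
    using assms trig_span_finite_sum unfolding trig_field_def by blast
  then obtain K d where K: "\<And>i. finite (K i)" and
    d: "\<And>i x. complex_of_real (f x $ i) = (\<Sum>k\<in>K i. d i k * wave k x)"
    by metis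
  obtain n where n: "(\<Union>i. K i) \<subseteq> int_box n" using finite_subset_int_box[of "\<Union>i. K i"] K by auto
  have *: "complex_of_real (f x $ i) = (\<Sum>k\<in>int_box N. fourier_coeff f k $ i * wave k x)" if "N \<ge> n" for N x i
  proof -
    define c :: "int^3 \<Rightarrow> complex^3" where "c k = (\<chi> i. if k \<in> K i then d i k else 0)" for k
    have sub: "K i \<subseteq> int_box N" for i using n int_box_mono[OF that] by blast
    have eq: "complex_of_real (f x $ i) = (\<Sum>k\<in>int_box N. c k $ i * wave k x)" for x i
      unfolding d c_def using sub[of i] by (auto intro!: sum.mono_neutral_cong_left)
    have "fourier_coeff f k = c k" if "k \<in> int_box N" for k
      using fourier_coeff_of_waves[OF finite_int_box eq, of k] that by simp
    thus ?thesis using eq by simp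
  qed
  show ?thesis
  proof
    show "f = trig_sum (int_box N) (fourier_coeff f)" if "N \<ge> n" for N
    proof
      fix x
      have "f x $ i = Re (\<Sum>k\<in>int_box N. fourier_coeff f k $ i * wave k x)" for i
        using *[OF that, of x i] by (metis Re_complex_of_real)
      thus "f x = trig_sum (int_box N) (fourier_coeff f) x" by (simp only: vec_eq_iff trig_sum_def vec_lambda_beta) simp
    qed
  qed (rule *)
qed

lemma trig_polynomial_trig_field:
  assumes "trig_polynomial \<phi>"
  shows "trig_field \<phi>"
proof -
  obtain K :: "(int^3) set" and a b where K: "finite K" and
    \<phi>: "\<phi> = (\<lambda>x. \<Sum>k\<in>K. cos (2 * pi * (freq k \<bullet> x)) *\<^sub>R a k + sin (2 * pi * (freq k \<bullet> x)) *\<^sub>R b k)"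
    using assms unfolding trig_polynomial_def freq_def by blast
  have cos: "complex_of_real (cos (2 * pi * (freq k \<bullet> x))) = (1/2) * wave k x + (1/2) * wave (- k) x"
    and sin: "complex_of_real (sin (2 * pi * (freq k \<bullet> x))) = (- \<i>/2) * wave k x + (\<i>/2) * wave (- k) x" for k x
    unfolding wave_uminus by (simp_all add: wave_def complex_eq_iff)
  have "(\<lambda>x. complex_of_real (\<phi> x $ i)) = (\<lambda>x. \<Sum>k\<in>K. of_real (a k $ i) * ((1/2) * wave k x + (1/2) * wave (- k) x)
      + of_real (b k $ i) * ((- \<i>/2) * wave k x + (\<i>/2) * wave (- k) x))" for i
    unfolding \<phi> cos[symmetric] sin[symmetric] by (simp add: mult.commute)
  moreover have "\<dots> i \<in> trig_span" for i
    by (intro trig_span_sum K trig_span.intros)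
  ultimately show ?thesis unfolding trig_field_def by presburger
qed

lemma trig_polynomial_trig_sum:
  assumes "finite F"
  shows "trig_polynomial (trig_sum F c)"
  unfolding trig_polynomial_def
proof (intro exI conjI)
  show "trig_sum F c = (\<lambda>x. \<Sum>k\<in>F. cos (2 * pi * ((\<chi> i. real_of_int (k $ i)) \<bullet> x)) *\<^sub>R (\<chi> i. Re (c k $ i))
      + sin (2 * pi * ((\<chi> i. real_of_int (k $ i)) \<bullet> x)) *\<^sub>R (\<chi> i. - Im (c k $ i)))"
    unfolding freq_def[symmetric] by (simp add: fun_eq_iff vec_eq_iff trig_sum_def wave_def mult.commute)
qed fact

lemma has_derivative_trig_sum:
  "(trig_sum F c has_derivative (\<lambda>h. \<Sum>i\<in>UNIV. Re (\<Sum>k\<in>F. c k $ i * ((2 * pi * (freq k \<bullet> h)) *\<^sub>R (\<i> * wave k x))) *\<^sub>R axis i 1)) (at x)"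
proof -
  have "trig_sum F c = (\<lambda>x. \<Sum>i\<in>UNIV. Re (\<Sum>k\<in>F. c k $ i * wave k x) *\<^sub>R axis i 1)"
    by (simp add: fun_eq_iff vec_eq_iff trig_sum_def axis_def if_distrib sum.delta cong: if_cong)
  thus ?thesis
    by (simp only:) (intro derivative_intros has_derivative_wave)
qed

lemma pd_trig_sum: "pd i (trig_sum F c) = trig_sum F (\<lambda>k. symb i k *s c k)"
proof
  fix x
  have eq: "c k $ j * ((2 * pi * (freq k \<bullet> axis i 1)) *\<^sub>R (\<i> * wave k x)) = (symb i k *s c k) $ j * wave k x" for k j
    by (simp add: symb_def inner_axis scaleR_conv_of_real)
  show "pd i (trig_sum F c) x = trig_sum F (\<lambda>k. symb i k *s c k) x"
    unfolding pd_eqI[OF has_derivative_trig_sum] eq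
    by (simp only: trig_sum_def) (simp add: vec_eq_iff axis_def if_distrib sum.delta cong: if_cong)
qed

lemma pd_trig_sum_complex:
  assumes f: "f = trig_sum (int_box N) (fourier_coeff f)"
  shows "complex_of_real (pd i f x $ j) = (\<Sum>k\<in>int_box N. symb i k * fourier_coeff f k $ j * wave k x)"
proof -
  have "pd i f = trig_sum (int_box N) (\<lambda>k. symb i k *s fourier_coeff f k)"
    using pd_trig_sum[of i "int_box N" "fourier_coeff f"] f by simp
  moreover have "hermitian (\<lambda>k. symb i k *s fourier_coeff f k)"
    using hermitian_symbs[OF hermitian_fourier_coeff[of f], of "[i]"] by simp
  ultimately show ?thesis
    using trig_sum_complex[OF symmetric_int_box, of "\<lambda>k. symb i k *s fourier_coeff f k" N x j] by simp
qed

lemma trig_field_pd: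
  assumes "trig_field f"
  shows "trig_field (pd i f)"
proof -
  obtain n where "\<And>N. N \<ge> n \<Longrightarrow> f = trig_sum (int_box N) (fourier_coeff f)"
    using trig_field_eq_trig_sum[OF assms] by metis
  hence "f = trig_sum (int_box n) (fourier_coeff f)" by simp
  from pd_trig_sum_complex[OF this] show ?thesis
    unfolding trig_field_def by (simp only:) (intro allI trig_span_sum trig_span.intros finite_int_box)
qed

lemma trig_field_L2:
  assumes "trig_field f" shows "f \<in> L2"
proof -
  obtain n where "\<And>N. N \<ge> n \<Longrightarrow> f = trig_sum (int_box N) (fourier_coeff f)"
    using trig_field_eq_trig_sum[OF assms] by metis
  hence "f = trig_sum (int_box n) (fourier_coeff f)" by simp
  thus ?thesis using L2_trig_sum[of "int_box n" "fourier_coeff f"] by simp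
qed

lemma trig_field_differentiable:
  assumes "trig_field f" shows "f differentiable at x"
proof -
  obtain n where "\<And>N. N \<ge> n \<Longrightarrow> f = trig_sum (int_box N) (fourier_coeff f)"
    using trig_field_eq_trig_sum[OF assms] by metis
  hence "f = trig_sum (int_box n) (fourier_coeff f)" by simp
  moreover have "trig_sum (int_box n) (fourier_coeff f) differentiable at x"
    using has_derivative_trig_sum differentiable_def by blast
  ultimately show ?thesis by simp
qed

lemma trig_field_advection:
  assumes "trig_field f" "trig_field g"
  shows "trig_field (advection f g)"
proof -
  have "(\<lambda>x. complex_of_real (advection f g x $ j)) = (\<lambda>x. \<Sum>i\<in>UNIV. complex_of_real (f x $ i) * complex_of_real (pd i g x $ j))" for j
    by (simp add: advection_def)
  thus ?thesis
    using assms(1) trig_field_pd[OF assms(2)]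
    unfolding trig_field_def by (auto intro!: trig_span_sum trig_span_mult)
qed

text \<open>Keeps the simplifier from rewriting the order of the Sobolev space Hm 1.\<close>

declare One_nat_def [simp del]

section \<open>The spaces H and V\<close>

definition wave_dot :: "int^3 \<Rightarrow> complex^3 \<Rightarrow> complex" where
  "wave_dot k v = (\<Sum>i\<in>UNIV. of_int (k $ i) * v $ i)"

text \<open>Mean zero and zero divergence, read off from the Fourier coefficients.\<close>

definition solenoidal :: "(int^3 \<Rightarrow> complex^3) \<Rightarrow> bool" where
  "solenoidal c \<longleftrightarrow> c 0 = 0 \<and> (\<forall>k. wave_dot k (c k) = 0)"

lemma norm_wave_dot_le: "norm (wave_dot k v) \<le> norm (freq k) * norm v"
proof -
  have "norm (\<chi> i. complex_of_int (k $ i)) = norm (freq k)"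
    by (simp add: norm_vec_def)
  thus ?thesis using norm_sum_mult_le[of "\<chi> i. complex_of_int (k $ i)" v] by (simp add: wave_dot_def)
qed

lemma wave_dot_diff: "wave_dot k (v - w) = wave_dot k v - wave_dot k w"
  by (simp add: wave_dot_def right_diff_distrib sum_subtractf)

lemma wave_dot_smult: "wave_dot k (c *s v) = c * wave_dot k v"
  by (simp add: wave_dot_def sum_distrib_left mult_ac)

lemma wave_dot_scaleR: "wave_dot k (c *\<^sub>R v) = of_real c * wave_dot k v"
  by (simp add: scaleR_eq_smult wave_dot_smult)

lemma sum_symb_nth: "(\<Sum>i\<in>UNIV. symb i k * v $ i) = 2 * pi * \<i> * wave_dot k v"
  by (simp add: symb_def wave_dot_def sum_distrib_left mult_ac)

lemma solenoidal_diff: "solenoidal c \<Longrightarrow> solenoidal d \<Longrightarrow> solenoidal (\<lambda>k. c k - d k)"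
  by (simp add: solenoidal_def wave_dot_diff)

lemma solenoidal_scaleR: "solenoidal c \<Longrightarrow> solenoidal (\<lambda>k. r k *\<^sub>R c k)"
  by (simp add: solenoidal_def wave_dot_scaleR)

lemma hermitian_diff: "hermitian c \<Longrightarrow> hermitian d \<Longrightarrow> hermitian (\<lambda>k. c k - d k)"
  by (simp add: hermitian_def)

lemma hermitian_scaleR: "hermitian c \<Longrightarrow> (\<And>k. r (- k) = r k) \<Longrightarrow> hermitian (\<lambda>k. r k *\<^sub>R c k)"
  by (simp add: hermitian_def)

lemma integral_nth_eq_fourier_coeff_0:
  assumes f: "f \<in> L2"
  shows "complex_of_real ((\<integral>x. f x \<partial>torus3) $ i) = fourier_coeff f 0 $ i"
  using integral_scaleR_nth(1)[OF f, of "\<lambda>_. 1" i] by (simp add: fourier_coeff_nth)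

text \<open>Divergence acts on the coefficient at frequency k as a multiple of the complex dot product with k,
  and a sum of waves vanishes identically only if all coefficients vanish.\<close>

lemma calV_iff: "\<phi> \<in> calV \<longleftrightarrow> trig_field \<phi> \<and> solenoidal (fourier_coeff \<phi>)"
proof
  assume "\<phi> \<in> calV"
  hence \<phi>: "trig_polynomial \<phi>" "\<And>x. divergence \<phi> x = 0" "(\<integral>x. \<phi> x \<partial>torus3) = 0"
    by (auto simp: calV_def)
  have tf: "trig_field \<phi>" by (rule trig_polynomial_trig_field) fact
  have "fourier_coeff \<phi> 0 = 0"
    using integral_nth_eq_fourier_coeff_0[OF trig_field_L2[OF tf]] \<phi>(3) by (simp add: vec_eq_iff)
  moreover have "wave_dot k (fourier_coeff \<phi> k) = 0" for k
  proof -
    obtain n where n: "\<And>N. N \<ge> n \<Longrightarrow> \<phi> = trig_sum (int_box N) (fourier_coeff \<phi>)"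
      using trig_field_eq_trig_sum[OF tf] by metis
    obtain m where "{k} \<subseteq> int_box m" using finite_subset_int_box[of "{k}"] by auto
    define N where "N = max n m"
    have k: "k \<in> int_box N" using \<open>{k} \<subseteq> int_box m\<close> int_box_mono[of m N] by (auto simp: N_def)
    have rep: "\<phi> = trig_sum (int_box N) (fourier_coeff \<phi>)" using n by (simp add: N_def)
    define d :: "int^3 \<Rightarrow> complex^3" where "d l = (\<chi> i. 2 * pi * \<i> * wave_dot l (fourier_coeff \<phi> l))" for l
    have "complex_of_real ((\<lambda>_. 0 :: real^3) x $ i) = (\<Sum>l\<in>int_box N. d l $ i * wave l x)" for x i
    proof -
      have "0 = complex_of_real (divergence \<phi> x)" using \<phi>(2) by simp
      also have "\<dots> = (\<Sum>i\<in>UNIV. \<Sum>l\<in>int_box N. symb i l * fourier_coeff \<phi> l $ i * wave l x)"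
        unfolding divergence_def of_real_sum pd_trig_sum_complex[OF rep] ..
      also have "\<dots> = (\<Sum>l\<in>int_box N. d l $ i * wave l x)"
        by (subst sum.swap) (simp add: d_def sum_symb_nth flip: sum_distrib_right)
      finally show ?thesis by simp
    qed
    from fourier_coeff_of_waves[OF finite_int_box this, of k] k
    have "fourier_coeff (\<lambda>_. 0) k = d k" by simp
    moreover have "fourier_coeff (\<lambda>_. 0) k = 0" by (simp add: vec_eq_iff fourier_coeff_nth)
    ultimately have "d k $ 1 = 0" by simp
    thus ?thesis by (simp add: d_def)
  qed
  ultimately show "trig_field \<phi> \<and> solenoidal (fourier_coeff \<phi>)" using tf by (simp add: solenoidal_def)
next
  assume *: "trig_field \<phi> \<and> solenoidal (fourier_coeff \<phi>)"
  then obtain n where n: "\<And>N. N \<ge> n \<Longrightarrow> \<phi> = trig_sum (int_box N) (fourier_coeff \<phi>)"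
    using trig_field_eq_trig_sum by metis
  hence rep: "\<phi> = trig_sum (int_box n) (fourier_coeff \<phi>)" by simp
  have "trig_polynomial \<phi>"
    using trig_polynomial_trig_sum[OF finite_int_box[of n], of "fourier_coeff \<phi>"] rep by simp
  moreover have "divergence \<phi> x = 0" for x
  proof -
    have "complex_of_real (divergence \<phi> x) = (\<Sum>i\<in>UNIV. \<Sum>l\<in>int_box n. symb i l * fourier_coeff \<phi> l $ i * wave l x)"
      unfolding divergence_def of_real_sum pd_trig_sum_complex[OF rep] ..
    also have "\<dots> = (\<Sum>l\<in>int_box n. (\<Sum>i\<in>UNIV. symb i l * fourier_coeff \<phi> l $ i) * wave l x)"
      by (subst sum.swap) (simp add: sum_distrib_right)
    also have "\<dots> = 0" using * unfolding sum_symb_nth by (simp add: solenoidal_def)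
    finally show ?thesis by simp
  qed
  moreover have "(\<integral>x. \<phi> x \<partial>torus3) = 0"
    using integral_nth_eq_fourier_coeff_0[OF trig_field_L2, of \<phi>] * by (simp add: vec_eq_iff solenoidal_def)
  ultimately show "\<phi> \<in> calV" by (simp add: calV_def)
qed

lemma calV_L2: "\<phi> \<in> calV \<Longrightarrow> \<phi> \<in> L2"
  by (simp add: calV_iff trig_field_L2)

lemma trig_field_trig_sum:
  assumes "finite F" "symmetric_set F" "hermitian c"
  shows "trig_field (trig_sum F c)"
  unfolding trig_field_def trig_sum_complex[OF assms(2,3)]
  by (intro allI trig_span_sum trig_span.intros assms)

lemma calV_trig_sum:
  assumes "finite F" "symmetric_set F" "hermitian c" "solenoidal c"
  shows "trig_sum F c \<in> calV"
  using assms unfolding calV_iff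
  by (auto simp: trig_field_trig_sum solenoidal_def fourier_coeff_trig_sum wave_dot_def)

lemma trig_field_diff: "trig_field f \<Longrightarrow> trig_field g \<Longrightarrow> trig_field (\<lambda>x. f x - g x)"
proof -
  assume "trig_field f" "trig_field g"
  hence "(\<lambda>x. complex_of_real (f x $ i) + (-1) * complex_of_real (g x $ i)) \<in> trig_span" for i
    unfolding trig_field_def by (intro trig_span.add trig_span.scale) blast+
  thus ?thesis by (simp add: trig_field_def)
qed

lemma trig_field_scaleR: "trig_field f \<Longrightarrow> trig_field (\<lambda>x. c *\<^sub>R f x)"
proof -
  assume "trig_field f"
  hence "(\<lambda>x. complex_of_real c * complex_of_real (f x $ i)) \<in> trig_span" for i
    unfolding trig_field_def by (intro trig_span.scale) blast+
  thus ?thesis by (simp add: trig_field_def)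
qed

lemma calV_diff: "\<phi> \<in> calV \<Longrightarrow> \<psi> \<in> calV \<Longrightarrow> (\<lambda>x. \<phi> x - \<psi> x) \<in> calV"
  by (simp add: calV_iff trig_field_diff solenoidal_def wave_dot_diff fourier_coeff_diff trig_field_L2)

lemma calV_scaleR: "\<phi> \<in> calV \<Longrightarrow> (\<lambda>x. c *\<^sub>R \<phi> x) \<in> calV"
  by (simp add: calV_iff trig_field_scaleR fourier_coeff_scaleR solenoidal_def wave_dot_scaleR)

lemma trig_sum_Hm:
  assumes "finite F" "symmetric_set F" "hermitian c"
  shows "trig_sum F c \<in> Hm m"
proof (rule HmI)
  fix js :: "3 list"
  show "\<exists>g\<in>L2. \<forall>k. fourier_coeff g k = symbs js k *s fourier_coeff (trig_sum F c) k"
    by (rule bexI[of _ "trig_sum F (\<lambda>k. symbs js k *s c k)"])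
      (use assms in \<open>auto simp: fourier_coeff_trig_sum hermitian_symbs vec_eq_iff\<close>)
qed auto

lemma trig_field_Hm:
  assumes "trig_field f" shows "f \<in> Hm m"
proof -
  obtain n where "\<And>N. N \<ge> n \<Longrightarrow> f = trig_sum (int_box N) (fourier_coeff f)"
    using trig_field_eq_trig_sum[OF assms] by metis
  hence "f = trig_sum (int_box n) (fourier_coeff f)" by simp
  thus ?thesis using trig_sum_Hm[OF finite_int_box[of n] symmetric_int_box hermitian_fourier_coeff[of f]] by simp
qed

lemma calV_Hm: "\<phi> \<in> calV \<Longrightarrow> \<phi> \<in> Hm m"
  by (simp add: calV_iff trig_field_Hm)

lemma Hm_norm_zero: "Hm_norm m (\<lambda>x. 0) = 0"
proof -
  have "(\<lambda>x. 0) \<in> Hm m" by (rule trig_field_Hm) (simp add: trig_field_def trig_span_const[of 0])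
  from Hm_scaleR(2)[OF this, of 0] show ?thesis by simp
qed

lemma calV_spaceV:
  assumes "\<phi> \<in> calV" shows "\<phi> \<in> spaceV"
  unfolding spaceV_def using assms
  by (auto intro!: bexI[of _ \<phi>] simp: calV_Hm Hm_norm_zero)

lemma spaceV_Hm1: "f \<in> spaceV \<Longrightarrow> f \<in> Hm 1"
  by (simp add: spaceV_def)

lemma spaceV_L2: "f \<in> spaceV \<Longrightarrow> f \<in> L2"
  using spaceV_Hm1 Hm_L2 by blast

lemma calV_spaceH:
  assumes "\<phi> \<in> calV" shows "\<phi> \<in> spaceH"
  unfolding spaceH_def using assms
  by (auto intro!: bexI[of _ \<phi>] simp: calV_L2 l2_norm_def l2_inner_def)

lemma spaceV_subset_spaceH: "spaceV \<subseteq> spaceH"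
proof
  fix f assume f: "f \<in> spaceV"
  have "\<exists>\<phi>\<in>calV. l2_norm (\<lambda>x. \<phi> x - f x) < \<epsilon>" if "\<epsilon> > 0" for \<epsilon>
  proof -
    have "\<exists>\<phi>\<in>calV. Hm_norm 1 (\<lambda>x. \<phi> x - f x) < \<epsilon>"
      using f that by (simp add: spaceV_def)
    then obtain \<phi> where \<phi>: "\<phi> \<in> calV" "Hm_norm 1 (\<lambda>x. \<phi> x - f x) < \<epsilon>" by (rule bexE)
    have "(\<lambda>x. \<phi> x - f x) \<in> Hm 1" by (intro Hm_diff calV_Hm \<phi> spaceV_Hm1 f)
    from l2_norm_le_Hm_norm[OF this] \<phi> show ?thesis by force
  qed
  thus "f \<in> spaceH" using spaceV_L2[OF f] by (simp add: spaceH_def)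
qed

lemma spaceH_L2: "f \<in> spaceH \<Longrightarrow> f \<in> L2"
  by (simp add: spaceH_def)

text \<open>Both conditions are closed, since each coefficient depends continuously on the field.\<close>

lemma spaceH_solenoidal:
  assumes f: "f \<in> spaceH"
  shows "solenoidal (fourier_coeff f)"
proof -
  have approx: "\<exists>v. norm (fourier_coeff f k - v) < \<epsilon> \<and> wave_dot k v = 0 \<and> (k = 0 \<longrightarrow> v = 0)" if "\<epsilon> > 0" for \<epsilon> k
  proof -
    have "\<exists>\<phi>\<in>calV. l2_norm (\<lambda>x. \<phi> x - f x) < \<epsilon>"
      using f that by (simp add: spaceH_def)
    then obtain \<phi> where \<phi>: "\<phi> \<in> calV" "l2_norm (\<lambda>x. \<phi> x - f x) < \<epsilon>" by (rule bexE)
    have "norm (fourier_coeff (\<lambda>x. f x - \<phi> x) k) \<le> l2_norm (\<lambda>x. f x - \<phi> x)"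
      by (intro norm_fourier_coeff_le L2_diff spaceH_L2 calV_L2 f \<phi>)
    hence "norm (fourier_coeff f k - fourier_coeff \<phi> k) < \<epsilon>"
      using \<phi> f by (simp add: fourier_coeff_diff spaceH_L2 calV_L2 l2_norm_minus_commute[of f \<phi>])
    thus ?thesis using \<phi>(1) by (intro exI[of _ "fourier_coeff \<phi> k"]) (auto simp: calV_iff solenoidal_def)
  qed
  have "norm (fourier_coeff f 0) \<le> 0"
  proof (rule field_le_epsilon)
    fix \<epsilon> :: real assume "\<epsilon> > 0"
    from approx[OF this, of 0] show "norm (fourier_coeff f 0) \<le> 0 + \<epsilon>" by auto
  qed
  moreover have "norm (wave_dot k (fourier_coeff f k)) \<le> 0" for k
  proof (rule field_le_epsilon)
    fix \<epsilon> :: real assume \<epsilon>: "\<epsilon> > 0"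
    have p: "norm (freq k) + 1 > 0" using norm_ge_zero[of "freq k"] by linarith
    obtain v where v: "norm (fourier_coeff f k - v) < \<epsilon> / (norm (freq k) + 1)" "wave_dot k v = 0"
      using approx[of "\<epsilon> / (norm (freq k) + 1)" k] \<epsilon> p by auto
    have "norm (wave_dot k (fourier_coeff f k)) = norm (wave_dot k (fourier_coeff f k - v))"
      by (simp add: wave_dot_diff v)
    also have "\<dots> \<le> norm (freq k) * norm (fourier_coeff f k - v)" by (rule norm_wave_dot_le)
    also have "\<dots> \<le> (norm (freq k) + 1) * (\<epsilon> / (norm (freq k) + 1))"
      using v p by (intro mult_mono) auto
    finally show "norm (wave_dot k (fourier_coeff f k)) \<le> 0 + \<epsilon>" using p by simp
  qed
  ultimately show ?thesis by (simp add: solenoidal_def)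
qed

lemma spaceV_solenoidal: "f \<in> spaceV \<Longrightarrow> solenoidal (fourier_coeff f)"
  using spaceV_subset_spaceH spaceH_solenoidal by blast

lemma spaceV_truncation_calV: "f \<in> spaceV \<Longrightarrow> trig_sum (int_box n) (fourier_coeff f) \<in> calV"
  by (intro calV_trig_sum hermitian_fourier_coeff spaceV_solenoidal) auto

text \<open>Truncation commutes with weak derivatives, and the Fourier series of each derivative converges.\<close>

lemma Hm_norm_truncation:
  assumes f: "f \<in> Hm m"
  shows "(\<lambda>n. Hm_norm m (\<lambda>x. trig_sum (int_box n) (fourier_coeff f) x - f x)) \<longlonglongrightarrow> 0"
proof -
  let ?t = "\<lambda>n. trig_sum (int_box n) (fourier_coeff f)"
  have "(\<lambda>n. l2_norm (weak_deriv js (\<lambda>x. ?t n x - f x))) \<longlonglongrightarrow> 0" if js: "length js \<le> m" for js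
  proof -
    let ?g = "weak_deriv js f"
    let ?s = "\<lambda>n. trig_sum (int_box n) (fourier_coeff ?g)"
    have g: "?g \<in> L2" "fourier_coeff ?g k = symbs js k *s fourier_coeff f k" for k
      using Hm_weak_deriv[OF f js] by auto
    have "l2_norm (weak_deriv js (\<lambda>x. ?t n x - f x)) = l2_norm (\<lambda>x. ?s n x - ?g x)" for n
    proof (rule l2_norm_weak_deriv_eq[OF _ js])
      show "(\<lambda>x. ?t n x - f x) \<in> Hm m"
        by (intro Hm_diff trig_sum_Hm f hermitian_fourier_coeff) auto
      show "(\<lambda>x. ?s n x - ?g x) \<in> L2" using g by auto
      show "fourier_coeff (\<lambda>x. ?s n x - ?g x) k = symbs js k *s fourier_coeff (\<lambda>x. ?t n x - f x) k" for k
        using g Hm_L2[OF f]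
        by (simp add: fourier_coeff_diff fourier_coeff_trig_sum hermitian_fourier_coeff vec_eq_iff algebra_simps)
    qed
    thus ?thesis using Fourier_series_converges[OF g(1)] by simp
  qed
  hence "(\<lambda>n. sqrt (\<Sum>js\<in>{js :: 3 list. length js \<le> m}. (l2_norm (weak_deriv js (\<lambda>x. ?t n x - f x)))\<^sup>2)) \<longlonglongrightarrow>
     sqrt (\<Sum>js\<in>{js :: 3 list. length js \<le> m}. 0\<^sup>2)"
    by (intro tendsto_intros) auto
  thus ?thesis by (simp add: Hm_norm_def)
qed

lemma approximates_truncation:
  "f \<in> spaceV \<Longrightarrow> approximates (\<lambda>n. trig_sum (int_box n) (fourier_coeff f)) f"
  unfolding approximates_def using spaceV_truncation_calV Hm_norm_truncation[OF spaceV_Hm1] by blast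

lemma Hm_norm_triangle_diff:
  assumes f: "f \<in> Hm m" and g: "g \<in> Hm m"
  shows "Hm_norm m (\<lambda>x. f x - g x) \<le> Hm_norm m f + Hm_norm m g"
proof -
  let ?J = "{js :: 3 list. length js \<le> m}"
  have le: "l2_norm (weak_deriv js (\<lambda>x. f x - g x)) \<le> l2_norm (weak_deriv js f) + l2_norm (weak_deriv js g)"
    if "js \<in> ?J" for js
  proof -
    have js: "length js \<le> m" using that by simp
    have "l2_norm (weak_deriv js (\<lambda>x. f x - g x)) = l2_norm (\<lambda>x. weak_deriv js f x - weak_deriv js g x)"
      by (rule l2_norm_weak_deriv_eq[OF Hm_diff[OF f g] js])
        (use Hm_weak_deriv[OF f js] Hm_weak_deriv[OF g js] Hm_L2[OF f] Hm_L2[OF g]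
          in \<open>auto simp: fourier_coeff_diff vec_eq_iff algebra_simps\<close>)
    also have "\<dots> \<le> l2_norm (weak_deriv js f) + l2_norm (\<lambda>x. - weak_deriv js g x)"
      using l2_norm_triangle[of "weak_deriv js f" "\<lambda>x. - weak_deriv js g x"]
        Hm_weak_deriv[OF f js] Hm_weak_deriv[OF g js] by (simp add: L2_uminus)
    also have "l2_norm (\<lambda>x. - weak_deriv js g x) = l2_norm (weak_deriv js g)"
      using l2_norm_scaleR[of "-1" "weak_deriv js g"] by simp
    finally show ?thesis .
  qed
  have "Hm_norm m (\<lambda>x. f x - g x) = L2_set (\<lambda>js. l2_norm (weak_deriv js (\<lambda>x. f x - g x))) ?J"
    by (simp add: Hm_norm_def L2_set_def)
  also have "\<dots> \<le> L2_set (\<lambda>js. l2_norm (weak_deriv js f) + l2_norm (weak_deriv js g)) ?J"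
    by (intro L2_set_mono le) auto
  also have "\<dots> \<le> L2_set (\<lambda>js. l2_norm (weak_deriv js f)) ?J + L2_set (\<lambda>js. l2_norm (weak_deriv js g)) ?J"
    by (rule L2_set_triangle_ineq)
  finally show ?thesis by (simp add: Hm_norm_def L2_set_def)
qed

section \<open>The Leray projection\<close>

text \<open>At each nonzero frequency, the orthogonal projection onto the plane orthogonal to it.\<close>

definition leray_coeff :: "(int^3 \<Rightarrow> complex^3) \<Rightarrow> int^3 \<Rightarrow> complex^3" where
  "leray_coeff c k = (if k = 0 then 0
     else c k - (wave_dot k (c k) / of_real ((norm (freq k))\<^sup>2)) *s (\<chi> i. of_int (k $ i)))"

lemma wave_dot_self: "wave_dot k (\<chi> i. of_int (k $ i)) = of_real ((norm (freq k))\<^sup>2)"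
proof -
  have "(norm (freq k))\<^sup>2 = (\<Sum>i\<in>UNIV. (of_int (k $ i))\<^sup>2)"
    by (simp add: norm_vec_def L2_set_def sum_nonneg)
  thus ?thesis by (simp add: wave_dot_def power2_eq_square)
qed

lemma solenoidal_leray_coeff: "solenoidal (leray_coeff c)"
proof -
  have "wave_dot k (leray_coeff c k) = 0" for k
  proof (cases "k = 0")
    case False
    hence "complex_of_real ((norm (freq k))\<^sup>2) \<noteq> 0" by simp
    thus ?thesis using False by (simp add: leray_coeff_def wave_dot_diff wave_dot_smult wave_dot_self del: of_real_power)
  qed (simp add: wave_dot_def)
  thus ?thesis by (simp add: solenoidal_def leray_coeff_def)
qed

lemma hermitian_leray_coeff:
  assumes "hermitian c" shows "hermitian (leray_coeff c)"
proof -
  have "wave_dot (- k) (c (- k)) = - cnj (wave_dot k (c k))" for k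
    using assms by (simp add: wave_dot_def hermitian_def sum_negf)
  thus ?thesis using assms by (simp add: hermitian_def leray_coeff_def)
qed

lemma leray_coeff_orthogonal:
  assumes v: "wave_dot k v = 0" and 0: "k = 0 \<Longrightarrow> v = 0"
  shows "(c k - leray_coeff c k) \<bullet> v = 0"
proof (cases "k = 0")
  case False
  have "(a *s (\<chi> i. of_int (k $ i))) \<bullet> v = Re (a * cnj (wave_dot k v))" for a
    by (simp add: inner_vec_def inner_complex_eq wave_dot_def sum_distrib_left mult_ac del: times_complex.sel)
  thus ?thesis using False v by (simp add: leray_coeff_def)
qed (simp add: 0)

text \<open>The projection of a trigonometric field exists because the multiplier of leray_coeff provides it
  explicitly; the identity then holds for whichever representative the choice operator selects.\<close>

lemma leray_trig_field:
  assumes f: "trig_field f"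
  shows "leray f \<in> L2" and "v \<in> spaceH \<Longrightarrow> l2_inner (leray f) v = l2_inner f v"
proof -
  let ?c = "fourier_coeff f"
  obtain n where "\<And>N. N \<ge> n \<Longrightarrow> f = trig_sum (int_box N) ?c"
    using trig_field_eq_trig_sum[OF f] by metis
  hence rep: "f = trig_sum (int_box n) ?c" by simp
  define g where "g = trig_sum (int_box n) (leray_coeff ?c)"
  have "g \<in> calV"
    unfolding g_def by (intro calV_trig_sum hermitian_leray_coeff solenoidal_leray_coeff hermitian_fourier_coeff) auto
  hence g: "g \<in> spaceH" by (rule calV_spaceH)
  have "l2_inner (\<lambda>x. f x - g x) h = 0" if h: "h \<in> spaceH" for h
  proof -
    have "l2_inner (\<lambda>x. f x - g x) h = l2_inner f h - l2_inner g h"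
      using h g f by (intro l2_inner_diff_left) (auto simp: spaceH_L2 trig_field_L2)
    also have "l2_inner f h = (\<Sum>k\<in>int_box n. ?c k \<bullet> fourier_coeff h k)"
      using l2_inner_trig_sum[OF spaceH_L2[OF h], of "int_box n" ?c] rep by simp
    also have "l2_inner g h = (\<Sum>k\<in>int_box n. leray_coeff ?c k \<bullet> fourier_coeff h k)"
      unfolding g_def by (rule l2_inner_trig_sum[OF spaceH_L2[OF h]])
    also have "(\<Sum>k\<in>int_box n. ?c k \<bullet> fourier_coeff h k) - (\<Sum>k\<in>int_box n. leray_coeff ?c k \<bullet> fourier_coeff h k)
       = (\<Sum>k\<in>int_box n. (?c k - leray_coeff ?c k) \<bullet> fourier_coeff h k)"
      by (simp add: inner_diff_left sum_subtractf)
    also have "\<dots> = 0"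
      using spaceH_solenoidal[OF h] by (intro sum.neutral ballI leray_coeff_orthogonal) (auto simp: solenoidal_def)
    finally show ?thesis .
  qed
  hence "\<exists>g. g \<in> spaceH \<and> (\<forall>h\<in>spaceH. l2_inner (\<lambda>x. f x - g x) h = 0)" using g by blast
  hence *: "leray f \<in> spaceH \<and> (\<forall>h\<in>spaceH. l2_inner (\<lambda>x. f x - leray f x) h = 0)"
    unfolding leray_def by (rule someI_ex)
  thus "leray f \<in> L2" by (simp add: spaceH_L2)
  thus "l2_inner (leray f) v = l2_inner f v" if "v \<in> spaceH"
    using * that l2_inner_diff_left[of f "leray f" v] f by (auto simp: spaceH_L2 trig_field_L2)
qed

section \<open>The dual of V\<close>

lemma dual_norm_leI:
  assumes "\<And>v. v \<in> spaceV \<Longrightarrow> \<bar>F v\<bar> \<le> C * Hm_norm 1 v" "C \<ge> 0"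
  shows "dual_norm F \<le> ennreal C"
  unfolding dual_norm_def
proof (rule SUP_least)
  fix v assume v: "v \<in> {v \<in> spaceV. Hm_norm 1 v \<le> 1}"
  have "\<bar>F v\<bar> \<le> C * Hm_norm 1 v" using assms(1) v by simp
  also have "\<dots> \<le> C * 1" using v assms(2) by (intro mult_left_mono) auto
  finally show "ennreal \<bar>F v\<bar> \<le> ennreal C" by (simp add: ennreal_leI)
qed

text \<open>Scaling by 1 plus the norm, rather than by the norm, also covers fields of norm zero.\<close>

lemma abs_le_dual_norm:
  assumes v: "v \<in> calV" and hom: "\<And>c. D (\<lambda>x. c *\<^sub>R v x) = c * D v"
  shows "ennreal \<bar>D v\<bar> \<le> ennreal (1 + Hm_norm 1 v) * dual_norm D"
proof -
  define r where "r = 1 + Hm_norm 1 v"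
  have r: "r \<ge> 1" by (simp add: r_def)
  have "(\<lambda>x. (1/r) *\<^sub>R v x) \<in> spaceV" by (intro calV_spaceV calV_scaleR v)
  moreover have "Hm_norm 1 (\<lambda>x. (1/r) *\<^sub>R v x) \<le> 1"
  proof -
    have "Hm_norm 1 (\<lambda>x. (1/r) *\<^sub>R v x) = \<bar>1/r\<bar> * Hm_norm 1 v" by (rule Hm_scaleR(2)[OF calV_Hm[OF v]])
    also have "\<dots> = Hm_norm 1 v / r" using r by simp
    also have "\<dots> \<le> 1" using r by (subst divide_le_eq_1_pos) (linarith, simp add: r_def)
    finally show ?thesis .
  qed
  ultimately have "ennreal \<bar>D (\<lambda>x. (1/r) *\<^sub>R v x)\<bar> \<le> dual_norm D"
    unfolding dual_norm_def by (intro SUP_upper) auto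
  hence "ennreal r * ennreal \<bar>D (\<lambda>x. (1/r) *\<^sub>R v x)\<bar> \<le> ennreal r * dual_norm D"
    by (intro mult_left_mono) auto
  moreover have "ennreal r * ennreal \<bar>D (\<lambda>x. (1/r) *\<^sub>R v x)\<bar> = ennreal \<bar>D v\<bar>"
    using r unfolding hom by (simp add: abs_mult flip: ennreal_mult)
  ultimately show ?thesis by (simp add: r_def)
qed

lemma dual_norm_tendsto_0_pointwise:
  assumes v: "v \<in> calV" and hom: "\<And>s c. D s (\<lambda>x. c *\<^sub>R v x) = c * D s v"
    and lim: "((\<lambda>s. dual_norm (D s)) \<longlongrightarrow> 0) net"
  shows "((\<lambda>s. D s v) \<longlongrightarrow> 0) net"
proof -
  have "((\<lambda>s. ennreal (1 + Hm_norm 1 v) * dual_norm (D s)) \<longlongrightarrow> ennreal (1 + Hm_norm 1 v) * 0) net"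
    by (intro ennreal_tendsto_cmult lim) simp
  hence *: "((\<lambda>s. ennreal (1 + Hm_norm 1 v) * dual_norm (D s)) \<longlongrightarrow> 0) net" by simp
  have "((\<lambda>s. ennreal \<bar>D s v\<bar>) \<longlongrightarrow> 0) net"
    by (intro tendsto_sandwich[OF _ _ tendsto_const *] always_eventually allI abs_le_dual_norm v hom) auto
  hence "((\<lambda>s. ennreal \<bar>D s v\<bar>) \<longlongrightarrow> ennreal 0) net" by simp
  hence "((\<lambda>s. \<bar>D s v\<bar>) \<longlongrightarrow> 0) net" by (subst (asm) tendsto_ennreal_iff) auto
  thus ?thesis by (simp add: tendsto_rabs_zero_iff)
qed

lemma tendsto_0_if_ennreal_le:
  fixes f :: "nat \<Rightarrow> ennreal"
  assumes "\<And>\<epsilon>::real. \<epsilon> > 0 \<Longrightarrow> eventually (\<lambda>n. f n \<le> ennreal \<epsilon>) sequentially"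
  shows "f \<longlonglongrightarrow> 0"
proof (rule order_tendstoI)
  fix a :: ennreal assume "0 < a"
  have "\<exists>\<epsilon>::real. \<epsilon> > 0 \<and> ennreal \<epsilon> < a"
  proof (cases a)
    case (real r)
    thus ?thesis using \<open>0 < a\<close> by (intro exI[of _ "r / 2"]) (auto intro!: ennreal_lessI)
  next
    case top
    thus ?thesis by (intro exI[of _ 1]) simp
  qed
  then obtain \<epsilon> :: real where \<epsilon>: "\<epsilon> > 0" "ennreal \<epsilon> < a" by blast
  show "eventually (\<lambda>n. f n < a) sequentially"
    using assms[OF \<epsilon>(1)] by eventually_elim (use \<epsilon>(2) in auto)
qed simp

text \<open>Completeness of the dual, in the form needed for extension by continuity: all sequences of a
  jointly Cauchy family have the same limit.\<close>

lemma dual_extension: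
  fixes Q :: "(nat \<Rightarrow> functional) set"
  assumes ne: "\<Phi>0 \<in> Q"
    and add: "\<And>\<Phi> n v w. \<Phi> \<in> Q \<Longrightarrow> v \<in> spaceV \<Longrightarrow> w \<in> spaceV \<Longrightarrow> \<Phi> n (\<lambda>x. v x + w x) = \<Phi> n v + \<Phi> n w"
    and scale: "\<And>\<Phi> n c v. \<Phi> \<in> Q \<Longrightarrow> v \<in> spaceV \<Longrightarrow> \<Phi> n (\<lambda>x. c *\<^sub>R v x) = c * \<Phi> n v"
    and bdd: "\<And>\<Phi> n. \<Phi> \<in> Q \<Longrightarrow> \<exists>C\<ge>0. \<forall>v\<in>spaceV. \<bar>\<Phi> n v\<bar> \<le> C * Hm_norm 1 v"
    and Cau: "\<And>\<Phi> \<Psi> \<epsilon>. \<Phi> \<in> Q \<Longrightarrow> \<Psi> \<in> Q \<Longrightarrow> \<epsilon> > 0 \<Longrightarrow>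
       \<exists>N. \<forall>n\<ge>N. \<forall>m\<ge>N. \<forall>v\<in>spaceV. \<bar>\<Phi> n v - \<Psi> m v\<bar> \<le> \<epsilon> * Hm_norm 1 v"
  shows "\<exists>F\<in>dualV. \<forall>\<Phi>\<in>Q. (\<lambda>n. dual_norm (\<lambda>v. \<Phi> n v - F v)) \<longlonglongrightarrow> 0"
proof -
  have conv: "convergent (\<lambda>n. \<Phi>0 n v)" if v: "v \<in> spaceV" for v
  proof -
    have "Cauchy (\<lambda>n. \<Phi>0 n v)"
    proof (rule metric_CauchyI)
      fix e :: real assume e: "e > 0"
      define \<epsilon> where "\<epsilon> = e / (1 + Hm_norm 1 v)"
      have p: "1 + Hm_norm 1 v > 0" using Hm_norm_nonneg[of 1 v] by linarith
      have "\<epsilon> > 0" using e p by (simp add: \<epsilon>_def)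
      from Cau[OF ne ne this] obtain N where
        N: "\<And>n m. n \<ge> N \<Longrightarrow> m \<ge> N \<Longrightarrow> \<bar>\<Phi>0 n v - \<Phi>0 m v\<bar> \<le> \<epsilon> * Hm_norm 1 v" using v by blast
      have "\<epsilon> * Hm_norm 1 v < e" using e p by (simp add: \<epsilon>_def field_simps)
      thus "\<exists>M. \<forall>m\<ge>M. \<forall>n\<ge>M. dist (\<Phi>0 m v) (\<Phi>0 n v) < e"
        using N by (intro exI[of _ N]) (auto simp: dist_real_def intro: le_less_trans)
    qed
    thus ?thesis by (rule Cauchy_convergent)
  qed
  define F where "F v = lim (\<lambda>n. \<Phi>0 n v)" for v
  have F: "(\<lambda>n. \<Phi>0 n v) \<longlonglongrightarrow> F v" if "v \<in> spaceV" for v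
    using conv[OF that] by (simp add: F_def convergent_LIMSEQ_iff)
  have close: "\<exists>N. \<forall>n\<ge>N. \<forall>v\<in>spaceV. \<bar>\<Phi> n v - F v\<bar> \<le> \<epsilon> * Hm_norm 1 v" if \<Phi>: "\<Phi> \<in> Q" and \<epsilon>: "\<epsilon> > 0" for \<Phi> \<epsilon>
  proof -
    obtain N where N: "\<And>n m v. n \<ge> N \<Longrightarrow> m \<ge> N \<Longrightarrow> v \<in> spaceV \<Longrightarrow> \<bar>\<Phi> n v - \<Phi>0 m v\<bar> \<le> \<epsilon> * Hm_norm 1 v"
      using Cau[OF \<Phi> ne \<epsilon>] by blast
    have "\<bar>\<Phi> n v - F v\<bar> \<le> \<epsilon> * Hm_norm 1 v" if "n \<ge> N" "v \<in> spaceV" for n v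
    proof (rule LIMSEQ_le_const2)
      show "(\<lambda>m. \<bar>\<Phi> n v - \<Phi>0 m v\<bar>) \<longlonglongrightarrow> \<bar>\<Phi> n v - F v\<bar>"
        by (intro tendsto_intros F that)
      show "\<exists>M. \<forall>m\<ge>M. \<bar>\<Phi> n v - \<Phi>0 m v\<bar> \<le> \<epsilon> * Hm_norm 1 v"
        using N that by blast
    qed
    thus ?thesis by blast
  qed
  show ?thesis
  proof (intro bexI ballI)
    fix \<Phi> assume \<Phi>: "\<Phi> \<in> Q"
    show "(\<lambda>n. dual_norm (\<lambda>v. \<Phi> n v - F v)) \<longlonglongrightarrow> 0"
    proof (rule tendsto_0_if_ennreal_le)
      fix \<epsilon> :: real assume \<epsilon>: "\<epsilon> > 0"
      obtain N where "\<And>n v. n \<ge> N \<Longrightarrow> v \<in> spaceV \<Longrightarrow> \<bar>\<Phi> n v - F v\<bar> \<le> \<epsilon> * Hm_norm 1 v"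
        using close[OF \<Phi> \<epsilon>] by blast
      hence "dual_norm (\<lambda>v. \<Phi> n v - F v) \<le> ennreal \<epsilon>" if "n \<ge> N" for n
        using that \<epsilon> by (intro dual_norm_leI) auto
      thus "eventually (\<lambda>n. dual_norm (\<lambda>v. \<Phi> n v - F v) \<le> ennreal \<epsilon>) sequentially"
        by (rule eventually_sequentiallyI)
    qed
  next
    have "F (\<lambda>x. v x + w x) = F v + F w" if "v \<in> spaceV" "w \<in> spaceV" for v w
    proof -
      have "(\<lambda>n. \<Phi>0 n (\<lambda>x. v x + w x)) \<longlonglongrightarrow> F v + F w"
        unfolding add[OF ne that] by (intro tendsto_intros F that)
      thus ?thesis unfolding F_def by (simp add: limI)
    qed
    moreover have "F (\<lambda>x. c *\<^sub>R v x) = c * F v" if "v \<in> spaceV" for c v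
    proof -
      have "(\<lambda>n. \<Phi>0 n (\<lambda>x. c *\<^sub>R v x)) \<longlonglongrightarrow> c * F v"
        unfolding scale[OF ne that] by (intro tendsto_intros F that)
      thus ?thesis unfolding F_def by (simp add: limI)
    qed
    moreover have "dual_norm F < \<infinity>"
    proof -
      obtain N where N: "\<And>v. v \<in> spaceV \<Longrightarrow> \<bar>\<Phi>0 N v - F v\<bar> \<le> 1 * Hm_norm 1 v"
        using close[OF ne, of 1] by auto
      obtain C where C: "C \<ge> 0" "\<And>v. v \<in> spaceV \<Longrightarrow> \<bar>\<Phi>0 N v\<bar> \<le> C * Hm_norm 1 v"
        using bdd[OF ne] by blast
      have "\<bar>F v\<bar> \<le> (C + 1) * Hm_norm 1 v" if "v \<in> spaceV" for v
        using N[OF that] C(2)[OF that] by (simp add: distrib_right)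
      hence "dual_norm F \<le> ennreal (C + 1)" using C(1) by (intro dual_norm_leI) auto
      thus ?thesis by (simp add: le_less_trans)
    qed
    ultimately show "F \<in> dualV" by (simp add: dualV_def)
  qed
qed

section \<open>The operators A and B\<close>

lemma pd_diff:
  assumes "f differentiable at x" "g differentiable at x"
  shows "pd i (\<lambda>x. f x - g x) x = pd i f x - pd i g x"
proof -
  have "((\<lambda>x. f x - g x) has_derivative (\<lambda>h. frechet_derivative f (at x) h - frechet_derivative g (at x) h)) (at x)"
    using assms by (intro has_derivative_diff) (simp_all add: frechet_derivative_works)
  from pd_eqI[OF this] show ?thesis by (simp add: pd_def)
qed

lemma pd_trig_field_diff:
  assumes "trig_field f" "trig_field g"
  shows "pd i (\<lambda>x. f x - g x) = (\<lambda>x. pd i f x - pd i g x)"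
  using assms by (simp add: fun_eq_iff pd_diff trig_field_differentiable)

lemma laplacian_diff:
  assumes "trig_field f" "trig_field g"
  shows "laplacian (\<lambda>x. f x - g x) x = laplacian f x - laplacian g x"
  using assms by (simp add: laplacian_def pd_trig_field_diff trig_field_pd sum_subtractf)

lemma advection_diff_left: "advection (\<lambda>x. f x - g x) h x = advection f h x - advection g h x"
  by (simp add: advection_def scaleR_left_diff_distrib sum_subtractf)

lemma advection_diff_right:
  assumes "trig_field g" "trig_field h"
  shows "advection f (\<lambda>x. g x - h x) x = advection f g x - advection f h x"
  using assms by (simp add: advection_def pd_trig_field_diff scaleR_right_diff_distrib sum_subtractf)

lemma trig_field_rep_at:
  assumes "trig_field f"
  obtains N where "k \<in> int_box N" "f = trig_sum (int_box N) (fourier_coeff f)"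
proof -
  obtain n where n: "\<And>N. N \<ge> n \<Longrightarrow> f = trig_sum (int_box N) (fourier_coeff f)"
    using trig_field_eq_trig_sum[OF assms] by metis
  obtain m where "{k} \<subseteq> int_box m" using finite_subset_int_box[of "{k}"] by auto
  hence "k \<in> int_box (max n m)" using int_box_mono[of m "max n m"] by auto
  thus ?thesis using n[of "max n m"] that by simp
qed

lemma fourier_coeff_pd:
  assumes f: "trig_field f"
  shows "fourier_coeff (pd i f) k = symb i k *s fourier_coeff f k"
proof -
  obtain N where N: "k \<in> int_box N" "f = trig_sum (int_box N) (fourier_coeff f)"
    using trig_field_rep_at[OF f] .
  have "complex_of_real (pd i f x $ j) = (\<Sum>k\<in>int_box N. (symb i k *s fourier_coeff f k) $ j * wave k x)" for x j
    using pd_trig_sum_complex[OF N(2), of i x j] by simp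
  from fourier_coeff_of_waves[OF finite_int_box this, of k] N(1) show ?thesis by simp
qed

lemma trig_field_neg_laplacian:
  assumes f: "trig_field f"
  shows "trig_field (\<lambda>x. - laplacian f x)"
proof -
  have *: "(\<lambda>x. complex_of_real (- laplacian f x $ j)) = (\<lambda>x. (-1) * (\<Sum>i\<in>UNIV. complex_of_real (pd i (pd i f) x $ j)))" for j
    by (simp add: laplacian_def)
  have "(\<lambda>x. complex_of_real (pd i (pd i f) x $ j)) \<in> trig_span" for i j
    using trig_field_pd[OF trig_field_pd[OF f]] by (simp add: trig_field_def)
  thus ?thesis
    unfolding trig_field_def vector_uminus_component * by (intro allI trig_span.scale trig_span_sum) auto
qed

lemma fourier_coeff_neg_laplacian:
  assumes f: "trig_field f"
  shows "fourier_coeff (\<lambda>x. - laplacian f x) k = (2 * pi * norm (freq k))\<^sup>2 *\<^sub>R fourier_coeff f k"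
proof -
  have L: "pd i (pd i f) \<in> L2" for i by (intro trig_field_L2 trig_field_pd f)
  have fc: "fourier_coeff (pd i (pd i f)) k = (symb i k)\<^sup>2 *s fourier_coeff f k" for i
    by (simp add: fourier_coeff_pd trig_field_pd f vector_smult_assoc power2_eq_square)
  have s: "(symb i k)\<^sup>2 = - of_real ((norm (symb i k))\<^sup>2)" for i
    by (simp add: symb_def norm_mult power_mult_distrib)
  have "fourier_coeff (\<lambda>x. - laplacian f x) k $ j = of_real ((2 * pi * norm (freq k))\<^sup>2) * fourier_coeff f k $ j" for j
  proof -
    have "fourier_coeff (\<lambda>x. - laplacian f x) k $ j
        = (\<integral>x. - (\<Sum>i\<in>UNIV. wave (- k) x * of_real (pd i (pd i f) x $ j)) \<partial>torus3)"
      unfolding fourier_coeff_nth by (simp add: laplacian_def sum_distrib_left)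
    also have "\<dots> = - (\<Sum>i\<in>UNIV. fourier_coeff (pd i (pd i f)) k $ j)"
      using integrable_wave_times[OF L] by (simp add: fourier_coeff_nth)
    also have "\<dots> = of_real (\<Sum>i\<in>UNIV. (norm (symb i k))\<^sup>2) * fourier_coeff f k $ j"
      unfolding fc by (simp add: s sum_negf sum_distrib_right)
    finally show ?thesis by (simp add: sum_norm_symb)
  qed
  thus ?thesis unfolding scaleR_eq_smult by (simp add: vec_eq_iff)
qed

lemma A_smooth_eq:
  assumes "\<phi> \<in> calV" "v \<in> spaceV"
  shows "A_smooth \<phi> v = l2_inner (\<lambda>x. - laplacian \<phi> x) v"
  unfolding A_smooth_def
  using assms spaceV_subset_spaceH by (intro leray_trig_field trig_field_neg_laplacian) (auto simp: calV_iff)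

lemma B_smooth_eq:
  assumes "\<phi> \<in> calV" "\<psi> \<in> calV" "v \<in> spaceV"
  shows "B_smooth \<phi> \<psi> v = l2_inner (advection \<phi> \<psi>) v"
  unfolding B_smooth_def
  using assms spaceV_subset_spaceH by (intro leray_trig_field trig_field_advection) (auto simp: calV_iff)

lemma A_smooth_bound:
  assumes \<phi>: "\<phi> \<in> calV" and v: "v \<in> spaceV"
  shows "\<bar>A_smooth \<phi> v\<bar> \<le> (2 * pi)\<^sup>2 * Hm_norm 1 \<phi> * Hm_norm 1 v"
proof -
  let ?g = "\<lambda>x. - laplacian \<phi> x"
  have tf: "trig_field \<phi>" using \<phi> by (simp add: calV_iff)
  obtain n where "\<And>N. N \<ge> n \<Longrightarrow> ?g = trig_sum (int_box N) (fourier_coeff ?g)"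
    using trig_field_eq_trig_sum[OF trig_field_neg_laplacian[OF tf]] by metis
  hence rep: "?g = trig_sum (int_box n) (fourier_coeff ?g)" by simp
  let ?a = "\<lambda>k. norm (freq k) * norm (fourier_coeff \<phi> k)"
  let ?b = "\<lambda>k. norm (freq k) * norm (fourier_coeff v k)"
  have "A_smooth \<phi> v = (\<Sum>k\<in>int_box n. fourier_coeff ?g k \<bullet> fourier_coeff v k)"
    unfolding A_smooth_eq[OF \<phi> v] using l2_inner_trig_sum[OF spaceV_L2[OF v], of "int_box n" "fourier_coeff ?g"] rep by simp
  also have "\<bar>\<dots>\<bar> \<le> (\<Sum>k\<in>int_box n. (2 * pi)\<^sup>2 * (\<bar>?a k\<bar> * \<bar>?b k\<bar>))"
  proof (rule order_trans[OF sum_abs], rule sum_mono)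
    fix k
    have "\<bar>fourier_coeff ?g k \<bullet> fourier_coeff v k\<bar> \<le> norm (fourier_coeff ?g k) * norm (fourier_coeff v k)"
      by (rule Cauchy_Schwarz_ineq2)
    also have "\<dots> = (2 * pi)\<^sup>2 * (\<bar>?a k\<bar> * \<bar>?b k\<bar>)"
      by (simp add: fourier_coeff_neg_laplacian[OF tf] abs_mult power2_eq_square)
    finally show "\<bar>fourier_coeff ?g k \<bullet> fourier_coeff v k\<bar> \<le> (2 * pi)\<^sup>2 * (\<bar>?a k\<bar> * \<bar>?b k\<bar>)" .
  qed
  also have "\<dots> \<le> (2 * pi)\<^sup>2 * (L2_set ?a (int_box n) * L2_set ?b (int_box n))"
    unfolding sum_distrib_left[symmetric] by (intro mult_left_mono L2_set_mult_ineq) auto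
  also have "\<dots> \<le> (2 * pi)\<^sup>2 * (Hm_norm 1 \<phi> * Hm_norm 1 v)"
  proof (intro mult_left_mono mult_mono)
    show "L2_set ?a (int_box n) \<le> Hm_norm 1 \<phi>" "L2_set ?b (int_box n) \<le> Hm_norm 1 v"
      unfolding L2_set_def using H1_coeff_bound[OF calV_Hm[OF \<phi>]] H1_coeff_bound[OF spaceV_Hm1[OF v]]
      by (auto intro!: real_le_lsqrt)
  qed auto
  finally show ?thesis by (simp add: mult.assoc)
qed

text \<open>Since the coefficients of the advecting field are orthogonal to their frequencies, the derivative
  can be moved to the test field without integration by parts.\<close>

lemma advection_sum_bound:
  assumes \<phi>: "\<phi> \<in> calV" and v: "v \<in> L2"
    and rep: "\<And>x i. complex_of_real (\<phi> x $ i) = (\<Sum>k\<in>int_box N. fourier_coeff \<phi> k $ i * wave k x)"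
      "\<psi> = trig_sum (int_box N) (fourier_coeff \<psi>)"
  shows "\<bar>l2_inner (advection \<phi> \<psi>) v\<bar> \<le> 2 * pi * (\<Sum>l\<in>int_box N. \<Sum>p\<in>int_box N.
     norm (fourier_coeff \<phi> l) * norm (fourier_coeff \<psi> p) * (norm (freq (l + p)) * norm (fourier_coeff v (l + p))))"
proof -
  let ?B = "int_box N" and ?a = "fourier_coeff \<phi>" and ?b = "fourier_coeff \<psi>" and ?c = "fourier_coeff v"
  define e where "e l p = (\<Sum>i\<in>UNIV. symb i p * ?a l $ i)" for l p
  have point: "complex_of_real (advection \<phi> \<psi> x \<bullet> v x)
     = (\<Sum>l\<in>?B. \<Sum>p\<in>?B. \<Sum>j\<in>UNIV. e l p * ?b p $ j * (wave (l + p) x * of_real (v x $ j)))" for x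
  proof -
    have adv: "complex_of_real (advection \<phi> \<psi> x $ j) = (\<Sum>l\<in>?B. \<Sum>p\<in>?B. e l p * ?b p $ j * wave (l + p) x)" for j
    proof -
      have "complex_of_real (advection \<phi> \<psi> x $ j)
          = (\<Sum>i\<in>UNIV. complex_of_real (\<phi> x $ i) * complex_of_real (pd i \<psi> x $ j))"
        by (simp add: advection_def)
      also have "\<dots> = (\<Sum>i\<in>UNIV. \<Sum>l\<in>?B. \<Sum>p\<in>?B. (symb i p * ?a l $ i) * (?b p $ j * wave (l + p) x))"
        unfolding rep(1) pd_trig_sum_complex[OF rep(2)] sum_product wave_add by (simp add: mult_ac)
      also have "\<dots> = (\<Sum>l\<in>?B. \<Sum>i\<in>UNIV. \<Sum>p\<in>?B. (symb i p * ?a l $ i) * (?b p $ j * wave (l + p) x))"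
        by (rule sum.swap)
      also have "\<dots> = (\<Sum>l\<in>?B. \<Sum>p\<in>?B. \<Sum>i\<in>UNIV. (symb i p * ?a l $ i) * (?b p $ j * wave (l + p) x))"
        by (intro sum.cong refl sum.swap)
      finally show ?thesis by (simp add: e_def sum_distrib_right mult.assoc)
    qed
    have "complex_of_real (advection \<phi> \<psi> x \<bullet> v x) = (\<Sum>j\<in>UNIV. complex_of_real (advection \<phi> \<psi> x $ j) * of_real (v x $ j))"
      by (simp add: inner_vec_def)
    also have "\<dots> = (\<Sum>j\<in>UNIV. \<Sum>l\<in>?B. \<Sum>p\<in>?B. e l p * ?b p $ j * (wave (l + p) x * of_real (v x $ j)))"
      unfolding adv sum_distrib_right by (simp add: mult.assoc)
    also have "\<dots> = (\<Sum>l\<in>?B. \<Sum>j\<in>UNIV. \<Sum>p\<in>?B. e l p * ?b p $ j * (wave (l + p) x * of_real (v x $ j)))"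
      by (rule sum.swap)
    also have "\<dots> = (\<Sum>l\<in>?B. \<Sum>p\<in>?B. \<Sum>j\<in>UNIV. e l p * ?b p $ j * (wave (l + p) x * of_real (v x $ j)))"
      by (intro sum.cong refl sum.swap)
    finally show ?thesis .
  qed
  have cw: "(\<integral>x. wave k x * of_real (v x $ j) \<partial>torus3) = cnj (?c k $ j)" for k j
    unfolding fourier_coeff_nth cnj_integral by (simp add: wave_uminus)
  have "complex_of_real (l2_inner (advection \<phi> \<psi>) v) = (\<integral>x. complex_of_real (advection \<phi> \<psi> x \<bullet> v x) \<partial>torus3)"
    unfolding l2_inner_def by (rule integral_complex_of_real[symmetric])
  also have "\<dots> = (\<Sum>l\<in>?B. \<Sum>p\<in>?B. \<Sum>j\<in>UNIV. e l p * ?b p $ j * cnj (?c (l + p) $ j))"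
    unfolding point using integrable_wave_times[OF v] by (simp add: cw)
  finally have eq: "complex_of_real (l2_inner (advection \<phi> \<psi>) v)
     = (\<Sum>l\<in>?B. \<Sum>p\<in>?B. e l p * (\<Sum>j\<in>UNIV. ?b p $ j * cnj (?c (l + p) $ j)))"
    by (simp add: sum_distrib_left mult.assoc)
  have e: "norm (e l p) \<le> 2 * pi * (norm (freq (l + p)) * norm (?a l))" for l p
  proof -
    have "wave_dot p (?a l) = wave_dot (l + p) (?a l)"
      using \<phi> by (simp add: calV_iff solenoidal_def wave_dot_def distrib_right sum.distrib)
    hence "norm (e l p) = 2 * pi * norm (wave_dot (l + p) (?a l))"
      by (simp add: e_def sum_symb_nth norm_mult)
    thus ?thesis using norm_wave_dot_le[of "l + p" "?a l"] by simp
  qed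
  have ip: "norm (\<Sum>j\<in>UNIV. ?b p $ j * cnj (?c k $ j)) \<le> norm (?b p) * norm (?c k)" for p k
  proof -
    have "norm (\<chi> j. cnj (?c k $ j)) = norm (?c k)" by (simp add: norm_vec_def)
    thus ?thesis using norm_sum_mult_le[of "?b p" "\<chi> j. cnj (?c k $ j)"] by simp
  qed
  have "\<bar>l2_inner (advection \<phi> \<psi>) v\<bar> = norm (complex_of_real (l2_inner (advection \<phi> \<psi>) v))" by simp
  also have "\<dots> \<le> (\<Sum>l\<in>?B. \<Sum>p\<in>?B. norm (e l p * (\<Sum>j\<in>UNIV. ?b p $ j * cnj (?c (l + p) $ j))))"
    unfolding eq by (intro order_trans[OF norm_sum] sum_mono norm_sum)
  also have "\<dots> \<le> (\<Sum>l\<in>?B. \<Sum>p\<in>?B. (2 * pi * (norm (freq (l + p)) * norm (?a l))) * (norm (?b p) * norm (?c (l + p))))"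
    unfolding norm_mult by (intro sum_mono mult_mono e ip) auto
  also have "\<dots> = 2 * pi * (\<Sum>l\<in>?B. \<Sum>p\<in>?B. norm (?a l) * norm (?b p) * (norm (freq (l + p)) * norm (?c (l + p))))"
    by (simp add: sum_distrib_left mult_ac)
  finally show ?thesis .
qed

lemma calV_common_rep:
  assumes "\<phi> \<in> calV" "\<psi> \<in> calV"
  obtains N where "\<And>x i. complex_of_real (\<phi> x $ i) = (\<Sum>k\<in>int_box N. fourier_coeff \<phi> k $ i * wave k x)"
    "\<psi> = trig_sum (int_box N) (fourier_coeff \<psi>)"
proof -
  obtain n where n: "\<And>N x i. N \<ge> n \<Longrightarrow> complex_of_real (\<phi> x $ i) = (\<Sum>k\<in>int_box N. fourier_coeff \<phi> k $ i * wave k x)"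
    using trig_field_eq_trig_sum[of \<phi>] assms(1) unfolding calV_iff by metis
  obtain m where m: "\<And>N. N \<ge> m \<Longrightarrow> \<psi> = trig_sum (int_box N) (fourier_coeff \<psi>)"
    using trig_field_eq_trig_sum[of \<psi>] assms(2) unfolding calV_iff by metis
  show ?thesis by (rule that[of "max n m"]) (use n[of "max n m"] m[of "max n m"] in auto)
qed

lemma B_smooth_bound:
  obtains C where "C \<ge> 0" "\<And>\<phi> \<psi> v. \<phi> \<in> calV \<Longrightarrow> \<psi> \<in> calV \<Longrightarrow> v \<in> spaceV \<Longrightarrow>
     \<bar>B_smooth \<phi> \<psi> v\<bar> \<le> C * Hm_norm 1 \<phi> * Hm_norm 1 \<psi> * Hm_norm 1 v"
proof -
  obtain S :: real where S: "S \<ge> 0" "\<And>G :: (int^3) set. finite G \<Longrightarrow> 0 \<notin> G \<Longrightarrow> (\<Sum>k\<in>G. 1 / norm (freq k) ^ 4) \<le> S\<^sup>2"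
    using lattice_sum_bounded by blast
  have "\<bar>B_smooth \<phi> \<psi> v\<bar> \<le> (2 * pi * S) * Hm_norm 1 \<phi> * Hm_norm 1 \<psi> * Hm_norm 1 v"
    if \<phi>: "\<phi> \<in> calV" and \<psi>: "\<psi> \<in> calV" and v: "v \<in> spaceV" for \<phi> \<psi> v
  proof -
    obtain N where N: "\<And>x i. complex_of_real (\<phi> x $ i) = (\<Sum>k\<in>int_box N. fourier_coeff \<phi> k $ i * wave k x)"
      "\<psi> = trig_sum (int_box N) (fourier_coeff \<psi>)"
      using calV_common_rep[OF \<phi> \<psi>] by metis
    have "(\<Sum>l\<in>int_box N. \<Sum>p\<in>int_box N.
       norm (fourier_coeff \<phi> l) * norm (fourier_coeff \<psi> p) * (norm (freq (l + p)) * norm (fourier_coeff v (l + p))))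
       \<le> S * Hm_norm 1 \<phi> * Hm_norm 1 \<psi> * Hm_norm 1 v"
      by (rule trilinear_bound[OF S])
        (use \<phi> \<psi> v H1_coeff_bound calV_Hm spaceV_Hm1 in \<open>auto simp: calV_iff[unfolded solenoidal_def]\<close>)
    hence "2 * pi * (\<Sum>l\<in>int_box N. \<Sum>p\<in>int_box N.
       norm (fourier_coeff \<phi> l) * norm (fourier_coeff \<psi> p) * (norm (freq (l + p)) * norm (fourier_coeff v (l + p))))
       \<le> 2 * pi * (S * Hm_norm 1 \<phi> * Hm_norm 1 \<psi> * Hm_norm 1 v)" by (rule mult_left_mono) simp
    from order_trans[OF advection_sum_bound[OF \<phi> spaceV_L2[OF v] N] this]
    show ?thesis unfolding B_smooth_eq[OF \<phi> \<psi> v] by (simp add: mult.assoc)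
  qed
  thus ?thesis by (intro that[of "2 * pi * S"]) (use S in auto)
qed

lemma B_smooth_add: "\<phi> \<in> calV \<Longrightarrow> \<psi> \<in> calV \<Longrightarrow> v \<in> L2 \<Longrightarrow> w \<in> L2 \<Longrightarrow>
    B_smooth \<phi> \<psi> (\<lambda>x. v x + w x) = B_smooth \<phi> \<psi> v + B_smooth \<phi> \<psi> w"
  unfolding B_smooth_def
  by (rule l2_inner_add_right) (auto simp: calV_iff intro!: leray_trig_field(1) trig_field_advection)

lemma A_smooth_add: "\<phi> \<in> calV \<Longrightarrow> v \<in> L2 \<Longrightarrow> w \<in> L2 \<Longrightarrow>
    A_smooth \<phi> (\<lambda>x. v x + w x) = A_smooth \<phi> v + A_smooth \<phi> w"
  unfolding A_smooth_def
  by (rule l2_inner_add_right) (auto simp: calV_iff intro!: leray_trig_field(1) trig_field_neg_laplacian)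

lemma approximates_calV: "approximates \<phi> w \<Longrightarrow> \<phi> n \<in> calV"
  by (simp add: approximates_def)

lemma approximates_close:
  assumes a: "approximates \<phi> w" "approximates \<phi>' w" and w: "w \<in> spaceV" and \<epsilon>: "\<epsilon> > 0"
  shows "\<exists>N. \<forall>n\<ge>N. \<forall>m\<ge>N. Hm_norm 1 (\<lambda>x. \<phi> n x - \<phi>' m x) < \<epsilon>"
proof -
  have lim: "(\<lambda>n. Hm_norm 1 (\<lambda>x. \<phi> n x - w x)) \<longlonglongrightarrow> 0" "(\<lambda>n. Hm_norm 1 (\<lambda>x. \<phi>' n x - w x)) \<longlonglongrightarrow> 0"
    using a by (auto simp: approximates_def)
  have "\<epsilon> / 2 > 0" using \<epsilon> by simp
  from LIMSEQ_D[OF lim(1) this] LIMSEQ_D[OF lim(2) this]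
  obtain N N' where N: "\<And>n. n \<ge> N \<Longrightarrow> Hm_norm 1 (\<lambda>x. \<phi> n x - w x) < \<epsilon> / 2"
    "\<And>n. n \<ge> N' \<Longrightarrow> Hm_norm 1 (\<lambda>x. \<phi>' n x - w x) < \<epsilon> / 2"
    by auto
  have "Hm_norm 1 (\<lambda>x. \<phi> n x - \<phi>' m x) < \<epsilon>" if "n \<ge> max N N'" "m \<ge> max N N'" for n m
  proof -
    have "Hm_norm 1 (\<lambda>x. (\<phi> n x - w x) - (\<phi>' m x - w x)) \<le> Hm_norm 1 (\<lambda>x. \<phi> n x - w x) + Hm_norm 1 (\<lambda>x. \<phi>' m x - w x)"
      by (intro Hm_norm_triangle_diff Hm_diff spaceV_Hm1[OF w]
          calV_Hm[OF approximates_calV[OF a(1)]] calV_Hm[OF approximates_calV[OF a(2)]])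
    also have "\<dots> < \<epsilon>" using N(1)[of n] N(2)[of m] that by simp
    finally show ?thesis by simp
  qed
  thus ?thesis by blast
qed

lemma approximates_bounded:
  assumes a: "approximates \<phi> w" and w: "w \<in> spaceV"
  obtains M where "M \<ge> 0" "\<And>n. Hm_norm 1 (\<phi> n) \<le> M"
proof -
  have "(\<lambda>n. Hm_norm 1 (\<lambda>x. \<phi> n x - w x)) \<longlonglongrightarrow> 0" using a by (simp add: approximates_def)
  hence "Bseq (\<lambda>n. Hm_norm 1 (\<lambda>x. \<phi> n x - w x))" by (intro convergent_imp_Bseq convergentI)
  then obtain K where K: "K > 0" "\<And>n. Hm_norm 1 (\<lambda>x. \<phi> n x - w x) \<le> K" by (auto simp: Bseq_def)
  have "Hm_norm 1 (\<phi> n) \<le> K + Hm_norm 1 w" for n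
  proof -
    have *: "(\<lambda>x. (-1) *\<^sub>R w x) \<in> Hm 1" "Hm_norm 1 (\<lambda>x. (-1) *\<^sub>R w x) = Hm_norm 1 w"
      using Hm_scaleR[OF spaceV_Hm1[OF w], of "-1"] by auto
    have "Hm_norm 1 (\<lambda>x. (\<phi> n x - w x) - (-1) *\<^sub>R w x) \<le> Hm_norm 1 (\<lambda>x. \<phi> n x - w x) + Hm_norm 1 (\<lambda>x. (-1) *\<^sub>R w x)"
      by (intro Hm_norm_triangle_diff Hm_diff calV_Hm[OF approximates_calV[OF a]] spaceV_Hm1[OF w] *(1))
    thus ?thesis using K(2)[of n] *(2) by simp
  qed
  thus ?thesis using K(1) by (intro that[of "K + Hm_norm 1 w"]) auto
qed

text \<open>The bound on smooth fields makes the images of all approximating sequences jointly Cauchy in the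
  dual, so the extension exists and the choice operator selects it.\<close>

lemma opA_works:
  assumes w: "w \<in> spaceV"
  shows "opA w \<in> dualV"
    and "approximates \<phi> w \<Longrightarrow> (\<lambda>n. dual_norm (\<lambda>v. A_smooth (\<phi> n) v - opA w v)) \<longlonglongrightarrow> 0"
proof -
  let ?Q = "(\<lambda>\<phi> n. A_smooth (\<phi> n)) ` {\<phi>. approximates \<phi> w}"
  have "\<exists>F\<in>dualV. \<forall>\<Phi>\<in>?Q. (\<lambda>n. dual_norm (\<lambda>v. \<Phi> n v - F v)) \<longlonglongrightarrow> 0"
  proof (rule dual_extension)
    show "(\<lambda>n. A_smooth (trig_sum (int_box n) (fourier_coeff w))) \<in> ?Q"
      using approximates_truncation[OF w] by (intro image_eqI[of _ _ "\<lambda>n. trig_sum (int_box n) (fourier_coeff w)"]) auto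
    show "\<exists>C\<ge>0. \<forall>v\<in>spaceV. \<bar>\<Phi> n v\<bar> \<le> C * Hm_norm 1 v" if "\<Phi> \<in> ?Q" for \<Phi> n
    proof -
      obtain \<phi> where \<phi>: "approximates \<phi> w" "\<Phi> = (\<lambda>n. A_smooth (\<phi> n))" using \<open>\<Phi> \<in> ?Q\<close> by auto
      show ?thesis unfolding \<phi>(2)
        by (rule exI[of _ "(2 * pi)\<^sup>2 * Hm_norm 1 (\<phi> n)"]) (use \<phi> A_smooth_bound approximates_calV in auto)
    qed
    fix \<Phi> \<Psi> and \<epsilon> :: real assume "\<Phi> \<in> ?Q" "\<Psi> \<in> ?Q" "\<epsilon> > 0"
    then obtain \<phi> \<psi> where a: "approximates \<phi> w" "\<Phi> = (\<lambda>n. A_smooth (\<phi> n))" "approximates \<psi> w" "\<Psi> = (\<lambda>n. A_smooth (\<psi> n))"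
      by auto
    have p: "(2 * pi)\<^sup>2 > 0" by simp
    hence "\<epsilon> / (2 * pi)\<^sup>2 > 0" using \<open>\<epsilon> > 0\<close> by (rule divide_pos_pos[rotated])
    from approximates_close[OF a(1,3) w this] obtain N where
      N: "\<And>n m. n \<ge> N \<Longrightarrow> m \<ge> N \<Longrightarrow> Hm_norm 1 (\<lambda>x. \<phi> n x - \<psi> m x) < \<epsilon> / (2 * pi)\<^sup>2" by blast
    have "\<bar>A_smooth (\<phi> n) v - A_smooth (\<psi> m) v\<bar> \<le> \<epsilon> * Hm_norm 1 v" if "n \<ge> N" "m \<ge> N" "v \<in> spaceV" for n m v
    proof -
      have c: "\<phi> n \<in> calV" "\<psi> m \<in> calV" using a approximates_calV by auto
      hence t: "trig_field (\<phi> n)" "trig_field (\<psi> m)" by (auto simp: calV_iff)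
      have "A_smooth (\<phi> n) v - A_smooth (\<psi> m) v
          = l2_inner (\<lambda>x. - laplacian (\<phi> n) x - - laplacian (\<psi> m) x) v"
        unfolding A_smooth_eq[OF c(1) that(3)] A_smooth_eq[OF c(2) that(3)]
        by (rule l2_inner_diff_left[symmetric]) (intro trig_field_L2 trig_field_neg_laplacian t spaceV_L2[OF that(3)])+
      also have "\<dots> = A_smooth (\<lambda>x. \<phi> n x - \<psi> m x) v"
        unfolding A_smooth_eq[OF calV_diff[OF c] that(3)] laplacian_diff[OF t] by simp
      also have "\<bar>\<dots>\<bar> \<le> (2 * pi)\<^sup>2 * Hm_norm 1 (\<lambda>x. \<phi> n x - \<psi> m x) * Hm_norm 1 v"
        by (rule A_smooth_bound[OF calV_diff[OF c] that(3)])
      also have "\<dots> \<le> \<epsilon> * Hm_norm 1 v"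
        using N[OF that(1,2)] p by (intro mult_right_mono) (simp_all add: field_simps)
      finally show ?thesis .
    qed
    thus "\<exists>N. \<forall>n\<ge>N. \<forall>m\<ge>N. \<forall>v\<in>spaceV. \<bar>\<Phi> n v - \<Psi> m v\<bar> \<le> \<epsilon> * Hm_norm 1 v"
      unfolding a(2,4) by blast
  qed (auto simp: A_smooth_def l2_inner_scaleR_right A_smooth_add[unfolded A_smooth_def] approximates_calV spaceV_L2)
  hence "\<exists>F. F \<in> dualV \<and> (\<forall>\<phi>. approximates \<phi> w \<longrightarrow> (\<lambda>n. dual_norm (\<lambda>v. A_smooth (\<phi> n) v - F v)) \<longlonglongrightarrow> 0)"
    by auto
  hence *: "opA w \<in> dualV \<and> (\<forall>\<phi>. approximates \<phi> w \<longrightarrow> (\<lambda>n. dual_norm (\<lambda>v. A_smooth (\<phi> n) v - opA w v)) \<longlonglongrightarrow> 0)"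
    unfolding opA_def by (rule someI_ex)
  thus "opA w \<in> dualV" "approximates \<phi> w \<Longrightarrow> (\<lambda>n. dual_norm (\<lambda>v. A_smooth (\<phi> n) v - opA w v)) \<longlonglongrightarrow> 0"
    by auto
qed

text \<open>As for A; the difference of two values of B is split by bilinearity so that each part contains the
  difference of two approximating fields in one argument.\<close>

lemma opB_works:
  assumes w1: "w1 \<in> spaceV" and w2: "w2 \<in> spaceV"
  shows "opB w1 w2 \<in> dualV"
    and "approximates \<phi> w1 \<Longrightarrow> approximates \<psi> w2 \<Longrightarrow>
      (\<lambda>n. dual_norm (\<lambda>v. B_smooth (\<phi> n) (\<psi> n) v - opB w1 w2 v)) \<longlonglongrightarrow> 0"
proof -
  obtain C where C: "C \<ge> 0" "\<And>\<phi> \<psi> v. \<phi> \<in> calV \<Longrightarrow> \<psi> \<in> calV \<Longrightarrow> v \<in> spaceV \<Longrightarrow>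
     \<bar>B_smooth \<phi> \<psi> v\<bar> \<le> C * Hm_norm 1 \<phi> * Hm_norm 1 \<psi> * Hm_norm 1 v"
    using B_smooth_bound by blast
  let ?Q = "(\<lambda>(\<phi>, \<psi>) n. B_smooth (\<phi> n) (\<psi> n)) ` {(\<phi>, \<psi>). approximates \<phi> w1 \<and> approximates \<psi> w2}"
  have Q: "\<exists>\<phi> \<psi>. approximates \<phi> w1 \<and> approximates \<psi> w2 \<and> \<Phi> = (\<lambda>n. B_smooth (\<phi> n) (\<psi> n))" if "\<Phi> \<in> ?Q" for \<Phi>
    using that by auto
  have "\<exists>F\<in>dualV. \<forall>\<Phi>\<in>?Q. (\<lambda>n. dual_norm (\<lambda>v. \<Phi> n v - F v)) \<longlonglongrightarrow> 0"
  proof (rule dual_extension)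
    show "(\<lambda>n. B_smooth (trig_sum (int_box n) (fourier_coeff w1)) (trig_sum (int_box n) (fourier_coeff w2))) \<in> ?Q"
      using approximates_truncation[OF w1] approximates_truncation[OF w2]
      by (intro image_eqI[of _ _ "(\<lambda>n. trig_sum (int_box n) (fourier_coeff w1), \<lambda>n. trig_sum (int_box n) (fourier_coeff w2))"]) auto
    show "\<Phi> n (\<lambda>x. v x + w x) = \<Phi> n v + \<Phi> n w" if "\<Phi> \<in> ?Q" "v \<in> spaceV" "w \<in> spaceV" for \<Phi> n v w
      using Q[OF that(1)] that by (auto simp: B_smooth_add approximates_calV spaceV_L2)
    show "\<Phi> n (\<lambda>x. c *\<^sub>R v x) = c * \<Phi> n v" if "\<Phi> \<in> ?Q" for \<Phi> n c v
      using Q[OF that] by (auto simp: B_smooth_def l2_inner_scaleR_right)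
    show "\<exists>C\<ge>0. \<forall>v\<in>spaceV. \<bar>\<Phi> n v\<bar> \<le> C * Hm_norm 1 v" if "\<Phi> \<in> ?Q" for \<Phi> n
    proof -
      obtain \<phi> \<psi> where \<phi>: "approximates \<phi> w1" "approximates \<psi> w2" "\<Phi> = (\<lambda>n. B_smooth (\<phi> n) (\<psi> n))"
        using Q[OF \<open>\<Phi> \<in> ?Q\<close>] by blast
      show ?thesis unfolding \<phi>(3)
        by (rule exI[of _ "C * Hm_norm 1 (\<phi> n) * Hm_norm 1 (\<psi> n)"]) (use \<phi> C approximates_calV in auto)
    qed
    fix \<Phi> \<Psi> and \<epsilon> :: real assume "\<Phi> \<in> ?Q" "\<Psi> \<in> ?Q" and \<epsilon>: "\<epsilon> > 0"
    obtain \<phi> \<psi> where a: "approximates \<phi> w1" "approximates \<psi> w2" "\<Phi> = (\<lambda>n. B_smooth (\<phi> n) (\<psi> n))"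
      using Q[OF \<open>\<Phi> \<in> ?Q\<close>] by blast
    obtain \<phi>' \<psi>' where b: "approximates \<phi>' w1" "approximates \<psi>' w2" "\<Psi> = (\<lambda>n. B_smooth (\<phi>' n) (\<psi>' n))"
      using Q[OF \<open>\<Psi> \<in> ?Q\<close>] by blast
    obtain M where M: "M \<ge> 0" "\<And>n. Hm_norm 1 (\<psi> n) \<le> M" by (rule approximates_bounded[OF a(2) w2]) blast
    obtain M' where M': "M' \<ge> 0" "\<And>n. Hm_norm 1 (\<phi>' n) \<le> M'" by (rule approximates_bounded[OF b(1) w1]) blast
    define \<delta> where "\<delta> = \<epsilon> / (C * M + C * M' + 1)"
    have p: "C * M + C * M' + 1 > 0"
      using mult_nonneg_nonneg[OF C(1) M(1)] mult_nonneg_nonneg[OF C(1) M'(1)] by linarith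
    have \<delta>: "\<delta> > 0" using \<epsilon> p by (simp add: \<delta>_def)
    obtain N where N: "\<And>n m. n \<ge> N \<Longrightarrow> m \<ge> N \<Longrightarrow> Hm_norm 1 (\<lambda>x. \<phi> n x - \<phi>' m x) < \<delta>"
      using approximates_close[OF a(1) b(1) w1 \<delta>] by blast
    obtain N' where N': "\<And>n m. n \<ge> N' \<Longrightarrow> m \<ge> N' \<Longrightarrow> Hm_norm 1 (\<lambda>x. \<psi> n x - \<psi>' m x) < \<delta>"
      using approximates_close[OF a(2) b(2) w2 \<delta>] by blast
    have "\<bar>B_smooth (\<phi> n) (\<psi> n) v - B_smooth (\<phi>' m) (\<psi>' m) v\<bar> \<le> \<epsilon> * Hm_norm 1 v"
      if nm: "n \<ge> max N N'" "m \<ge> max N N'" and v: "v \<in> spaceV" for n m v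
    proof -
      have c: "\<phi> n \<in> calV" "\<psi> n \<in> calV" "\<phi>' m \<in> calV" "\<psi>' m \<in> calV" using a b approximates_calV by auto
      hence t: "trig_field (\<phi> n)" "trig_field (\<psi> n)" "trig_field (\<phi>' m)" "trig_field (\<psi>' m)" by (auto simp: calV_iff)
      note L = trig_field_L2[OF trig_field_advection]
      have 1: "B_smooth (\<phi> n) (\<psi> n) v - B_smooth (\<phi>' m) (\<psi> n) v = B_smooth (\<lambda>x. \<phi> n x - \<phi>' m x) (\<psi> n) v"
        unfolding B_smooth_eq[OF c(1,2) v] B_smooth_eq[OF c(3,2) v] B_smooth_eq[OF calV_diff[OF c(1,3)] c(2) v]
        by (subst l2_inner_diff_left[symmetric]) (auto simp: advection_diff_left[abs_def] L t spaceV_L2 v)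
      have 2: "B_smooth (\<phi>' m) (\<psi> n) v - B_smooth (\<phi>' m) (\<psi>' m) v = B_smooth (\<phi>' m) (\<lambda>x. \<psi> n x - \<psi>' m x) v"
        unfolding B_smooth_eq[OF c(3,2) v] B_smooth_eq[OF c(3,4) v] B_smooth_eq[OF c(3) calV_diff[OF c(2,4)] v]
        by (subst l2_inner_diff_left[symmetric]) (auto simp: advection_diff_right[OF t(2,4), abs_def] L t spaceV_L2 v)
      have "\<bar>B_smooth (\<phi> n) (\<psi> n) v - B_smooth (\<phi>' m) (\<psi>' m) v\<bar>
         \<le> \<bar>B_smooth (\<lambda>x. \<phi> n x - \<phi>' m x) (\<psi> n) v\<bar> + \<bar>B_smooth (\<phi>' m) (\<lambda>x. \<psi> n x - \<psi>' m x) v\<bar>"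
        unfolding 1[symmetric] 2[symmetric] by linarith
      also have "\<dots> \<le> C * Hm_norm 1 (\<lambda>x. \<phi> n x - \<phi>' m x) * Hm_norm 1 (\<psi> n) * Hm_norm 1 v
          + C * Hm_norm 1 (\<phi>' m) * Hm_norm 1 (\<lambda>x. \<psi> n x - \<psi>' m x) * Hm_norm 1 v"
        by (intro add_mono C(2) calV_diff c v)
      also have "\<dots> \<le> C * \<delta> * M * Hm_norm 1 v + C * M' * \<delta> * Hm_norm 1 v"
        using N[of n m] N'[of n m] nm C(1) M M' \<delta>
        by (intro add_mono mult_right_mono mult_mono mult_left_mono) auto
      also have "\<dots> = (C * M + C * M') * \<delta> * Hm_norm 1 v" by (simp add: algebra_simps)
      also have "\<dots> \<le> \<epsilon> * Hm_norm 1 v"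
        using p \<epsilon> by (intro mult_right_mono) (auto simp: \<delta>_def field_simps)
      finally show ?thesis .
    qed
    thus "\<exists>N. \<forall>n\<ge>N. \<forall>m\<ge>N. \<forall>v\<in>spaceV. \<bar>\<Phi> n v - \<Psi> m v\<bar> \<le> \<epsilon> * Hm_norm 1 v"
      unfolding a(3) b(3) by blast
  qed
  hence "\<exists>F. F \<in> dualV \<and> (\<forall>\<phi> \<psi>. approximates \<phi> w1 \<longrightarrow> approximates \<psi> w2 \<longrightarrow>
      (\<lambda>n. dual_norm (\<lambda>v. B_smooth (\<phi> n) (\<psi> n) v - F v)) \<longlonglongrightarrow> 0)"
    by auto
  hence *: "opB w1 w2 \<in> dualV \<and> (\<forall>\<phi> \<psi>. approximates \<phi> w1 \<longrightarrow> approximates \<psi> w2 \<longrightarrow>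
      (\<lambda>n. dual_norm (\<lambda>v. B_smooth (\<phi> n) (\<psi> n) v - opB w1 w2 v)) \<longlonglongrightarrow> 0)"
    unfolding opB_def by (rule someI_ex)
  thus "opB w1 w2 \<in> dualV" "approximates \<phi> w1 \<Longrightarrow> approximates \<psi> w2 \<Longrightarrow>
      (\<lambda>n. dual_norm (\<lambda>v. B_smooth (\<phi> n) (\<psi> n) v - opB w1 w2 v)) \<longlonglongrightarrow> 0"
    by auto
qed

lemma dualV_scale: "F \<in> dualV \<Longrightarrow> v \<in> spaceV \<Longrightarrow> F (\<lambda>x. c *\<^sub>R v x) = c * F v"
  by (simp add: dualV_def)

lemma A_smooth_scale: "A_smooth \<phi> (\<lambda>x. c *\<^sub>R v x) = c * A_smooth \<phi> v"
  and B_smooth_scale: "B_smooth \<phi> \<psi> (\<lambda>x. c *\<^sub>R v x) = c * B_smooth \<phi> \<psi> v"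
  by (simp_all add: A_smooth_def B_smooth_def l2_inner_scaleR_right)

lemma opA_tendsto:
  assumes w: "w \<in> spaceV" and v: "v \<in> calV" and a: "approximates \<phi> w"
  shows "(\<lambda>n. A_smooth (\<phi> n) v) \<longlonglongrightarrow> opA w v"
proof -
  have "(\<lambda>n. A_smooth (\<phi> n) v - opA w v) \<longlonglongrightarrow> 0"
    using opA_works(2)[OF w a] dualV_scale[OF opA_works(1)[OF w] calV_spaceV[OF v]]
    by (intro dual_norm_tendsto_0_pointwise[OF v, where D="\<lambda>n v. A_smooth (\<phi> n) v - opA w v"])
      (auto simp: A_smooth_scale right_diff_distrib)
  thus ?thesis by (simp add: LIM_zero_iff)
qed

lemma opB_tendsto:
  assumes w: "w1 \<in> spaceV" "w2 \<in> spaceV" and v: "v \<in> calV"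
    and a: "approximates \<phi> w1" "approximates \<psi> w2"
  shows "(\<lambda>n. l2_inner (advection (\<phi> n) (\<psi> n)) v) \<longlonglongrightarrow> opB w1 w2 v"
proof -
  have "(\<lambda>n. B_smooth (\<phi> n) (\<psi> n) v - opB w1 w2 v) \<longlonglongrightarrow> 0"
    using opB_works(2)[OF w a] dualV_scale[OF opB_works(1)[OF w] calV_spaceV[OF v]]
    by (intro dual_norm_tendsto_0_pointwise[OF v, where D="\<lambda>n v. B_smooth (\<phi> n) (\<psi> n) v - opB w1 w2 v"])
      (auto simp: B_smooth_scale right_diff_distrib)
  thus ?thesis using B_smooth_eq[OF approximates_calV[OF a(1)] approximates_calV[OF a(2)] calV_spaceV[OF v]]
    by (simp add: LIM_zero_iff)
qed

text \<open>Tested against a trigonometric field, A becomes an explicit finite sum, which persists in the limit.\<close>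

lemma opA_trig_sum:
  assumes w: "w \<in> spaceV" and F: "finite F" and v: "trig_sum F c \<in> calV"
  shows "opA w (trig_sum F c) = (\<Sum>k\<in>F. (2 * pi * norm (freq k))\<^sup>2 * (c k \<bullet> fourier_coeff w k))"
proof -
  let ?\<phi> = "\<lambda>n. trig_sum (int_box n) (fourier_coeff w)"
  have a: "approximates ?\<phi> w" by (rule approximates_truncation[OF w])
  have "A_smooth (?\<phi> n) (trig_sum F c) = (\<Sum>k\<in>F. (2 * pi * norm (freq k))\<^sup>2 * (c k \<bullet> fourier_coeff (?\<phi> n) k))" for n
  proof -
    have \<phi>: "?\<phi> n \<in> calV" by (rule spaceV_truncation_calV[OF w])
    hence t: "trig_field (?\<phi> n)" by (simp add: calV_iff)
    have "A_smooth (?\<phi> n) (trig_sum F c) = l2_inner (trig_sum F c) (\<lambda>x. - laplacian (?\<phi> n) x)"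
      unfolding A_smooth_eq[OF \<phi> calV_spaceV[OF v]] by (rule l2_inner_commute)
    also have "\<dots> = (\<Sum>k\<in>F. c k \<bullet> fourier_coeff (\<lambda>x. - laplacian (?\<phi> n) x) k)"
      by (intro l2_inner_trig_sum trig_field_L2 trig_field_neg_laplacian t)
    finally show ?thesis by (simp add: fourier_coeff_neg_laplacian[OF t])
  qed
  moreover have "(\<lambda>n. \<Sum>k\<in>F. (2 * pi * norm (freq k))\<^sup>2 * (c k \<bullet> fourier_coeff (?\<phi> n) k))
      \<longlonglongrightarrow> (\<Sum>k\<in>F. (2 * pi * norm (freq k))\<^sup>2 * (c k \<bullet> fourier_coeff w k))"
    by (intro tendsto_intros fourier_coeff_tendsto Fourier_series_converges spaceV_L2[OF w]) auto
  ultimately show ?thesis using opA_tendsto[OF w v a] LIMSEQ_unique by fastforce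
qed

section \<open>Weighted estimates\<close>

text \<open>The weight of a sum of two frequencies is distributed, up to the factor K, onto one of the two
  arguments of B; the other one is measured in the norm of V only. This is why the estimate is linear in
  the weighted norm Z.\<close>

lemma opB_weighted_bound:
  fixes w :: "int^3 \<Rightarrow> real"
  assumes S: "S \<ge> 0" "\<And>G :: (int^3) set. finite G \<Longrightarrow> 0 \<notin> G \<Longrightarrow> (\<Sum>k\<in>G. 1 / norm (freq k) ^ 4) \<le> S\<^sup>2"
    and w: "\<And>k. w k \<ge> 0" "\<And>k. w (- k) = w k" "\<And>l p. w (l + p) \<le> K * (w l + w p)" "K \<ge> 0"
    and f: "f \<in> spaceV" "Hm_norm 1 f \<le> M" and g: "g \<in> spaceV" "Hm_norm 1 g \<le> M"
    and Z: "Z \<ge> 0" "\<And>G. finite G \<Longrightarrow> (\<Sum>k\<in>G. (norm (freq k) * (w k * norm (fourier_coeff f k)))\<^sup>2) \<le> Z\<^sup>2"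
      "\<And>G. finite G \<Longrightarrow> (\<Sum>k\<in>G. (norm (freq k) * (w k * norm (fourier_coeff g k)))\<^sup>2) \<le> Z\<^sup>2"
    and d: "hermitian d" "solenoidal d"
  shows "\<bar>opB f g (trig_sum (int_box n) (\<lambda>k. (w k)\<^sup>2 *\<^sub>R d k))\<bar>
    \<le> 4 * pi * S * K * Z * M * L2_set (\<lambda>k. norm (freq k) * (w k * norm (d k))) (int_box n)"
proof -
  define c where "c k = (w k)\<^sup>2 *\<^sub>R d k" for k
  define v where "v = trig_sum (int_box n) c"
  define X where "X = L2_set (\<lambda>k. norm (freq k) * (w k * norm (d k))) (int_box n)"
  have c: "hermitian c" "solenoidal c"
    unfolding c_def using d w(2) by (auto intro: hermitian_scaleR solenoidal_scaleR)
  have v: "v \<in> calV" unfolding v_def by (intro calV_trig_sum c) auto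
  have M: "M \<ge> 0" using f(2) Hm_norm_nonneg[of 1 f] by linarith
  let ?f = "\<lambda>i. trig_sum (int_box i) (fourier_coeff f)"
  let ?g = "\<lambda>i. trig_sum (int_box i) (fourier_coeff g)"
  define z where "z k = (if k \<in> int_box n then norm (freq k) * (w k * norm (d k)) else 0)" for k
  have z0: "z k \<ge> 0" for k using w(1) by (simp add: z_def)
  have zX: "(\<Sum>k\<in>G. (z k)\<^sup>2) \<le> X\<^sup>2" if G: "finite G" for G
  proof -
    have "(\<Sum>k\<in>G. (z k)\<^sup>2) = (\<Sum>k\<in>G \<inter> int_box n. (z k)\<^sup>2)"
      using G by (intro sum.mono_neutral_right) (auto simp: z_def)
    also have "\<dots> \<le> (\<Sum>k\<in>int_box n. (z k)\<^sup>2)" by (rule sum_mono2) auto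
    also have "\<dots> = X\<^sup>2" by (simp add: z_def X_def L2_set_def sum_nonneg)
    finally show ?thesis .
  qed
  have X: "X \<ge> 0" by (simp add: X_def L2_set_nonneg)
  have fc_v: "norm (freq k) * norm (fourier_coeff v k) = w k * z k" for k
    unfolding v_def using fourier_coeff_trig_sum[OF finite_int_box symmetric_int_box c(1), of n k]
    by (simp add: z_def c_def power2_eq_square)
  have bound: "\<bar>l2_inner (advection (?f i) (?g i)) v\<bar> \<le> 4 * pi * S * K * Z * M * X" for i
  proof -
    define x where "x k = norm (fourier_coeff (?f i) k)" for k
    define y where "y k = norm (fourier_coeff (?g i) k)" for k
    have cut: "fourier_coeff (?f i) k = (if k \<in> int_box i then fourier_coeff f k else 0)"
      "fourier_coeff (?g i) k = (if k \<in> int_box i then fourier_coeff g k else 0)" for k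
      by (intro fourier_coeff_trig_sum hermitian_fourier_coeff finite_int_box symmetric_int_box)+
    have x: "0 \<le> x k" "x k \<le> norm (fourier_coeff f k)" and y: "0 \<le> y k" "y k \<le> norm (fourier_coeff g k)" for k
      by (auto simp: x_def y_def cut)
    have 0: "x 0 = 0" "y 0 = 0"
      using x[of 0] y[of 0] spaceV_solenoidal[OF f(1)] spaceV_solenoidal[OF g(1)] by (auto simp: solenoidal_def)
    have le: "(\<Sum>k\<in>int_box i. (norm (freq k) * x k)\<^sup>2) \<le> M\<^sup>2" "(\<Sum>k\<in>int_box i. (norm (freq k) * y k)\<^sup>2) \<le> M\<^sup>2"
    proof -
      have "(\<Sum>k\<in>int_box i. (norm (freq k) * x k)\<^sup>2) \<le> (\<Sum>k\<in>int_box i. (norm (freq k) * norm (fourier_coeff f k))\<^sup>2)"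
        by (intro sum_mono power_mono mult_left_mono x mult_nonneg_nonneg) auto
      also have "\<dots> \<le> (Hm_norm 1 f)\<^sup>2" by (intro H1_coeff_bound spaceV_Hm1 f finite_int_box)
      also have "\<dots> \<le> M\<^sup>2" by (intro power_mono f) auto
      finally show "(\<Sum>k\<in>int_box i. (norm (freq k) * x k)\<^sup>2) \<le> M\<^sup>2" .
      have "(\<Sum>k\<in>int_box i. (norm (freq k) * y k)\<^sup>2) \<le> (\<Sum>k\<in>int_box i. (norm (freq k) * norm (fourier_coeff g k))\<^sup>2)"
        by (intro sum_mono power_mono mult_left_mono y mult_nonneg_nonneg) auto
      also have "\<dots> \<le> (Hm_norm 1 g)\<^sup>2" by (intro H1_coeff_bound spaceV_Hm1 g finite_int_box)
      also have "\<dots> \<le> M\<^sup>2" by (intro power_mono g) auto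
      finally show "(\<Sum>k\<in>int_box i. (norm (freq k) * y k)\<^sup>2) \<le> M\<^sup>2" .
    qed
    have leZ: "(\<Sum>k\<in>int_box i. (norm (freq k) * (w k * x k))\<^sup>2) \<le> Z\<^sup>2" "(\<Sum>k\<in>int_box i. (norm (freq k) * (w k * y k))\<^sup>2) \<le> Z\<^sup>2"
    proof -
      have "(\<Sum>k\<in>int_box i. (norm (freq k) * (w k * x k))\<^sup>2) \<le> (\<Sum>k\<in>int_box i. (norm (freq k) * (w k * norm (fourier_coeff f k)))\<^sup>2)"
        by (intro sum_mono power_mono mult_left_mono x mult_nonneg_nonneg w) auto
      thus "(\<Sum>k\<in>int_box i. (norm (freq k) * (w k * x k))\<^sup>2) \<le> Z\<^sup>2" using Z(2)[OF finite_int_box[of i]] by linarith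
      have "(\<Sum>k\<in>int_box i. (norm (freq k) * (w k * y k))\<^sup>2) \<le> (\<Sum>k\<in>int_box i. (norm (freq k) * (w k * norm (fourier_coeff g k)))\<^sup>2)"
        by (intro sum_mono power_mono mult_left_mono y mult_nonneg_nonneg w) auto
      thus "(\<Sum>k\<in>int_box i. (norm (freq k) * (w k * y k))\<^sup>2) \<le> Z\<^sup>2" using Z(3)[OF finite_int_box[of i]] by linarith
    qed
    have rep: "complex_of_real (?f i x $ j) = (\<Sum>k\<in>int_box i. fourier_coeff (?f i) k $ j * wave k x)" for x j
      unfolding trig_sum_complex[OF symmetric_int_box hermitian_fourier_coeff] by (intro sum.cong) (simp_all add: cut)
    have rep': "?g i = trig_sum (int_box i) (fourier_coeff (?g i))"
      by (simp add: trig_sum_def fun_eq_iff cut)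
    have "\<bar>l2_inner (advection (?f i) (?g i)) v\<bar> \<le> 2 * pi * (\<Sum>l\<in>int_box i. \<Sum>p\<in>int_box i. x l * y p * (w (l + p) * z (l + p)))"
      using advection_sum_bound[OF spaceV_truncation_calV[OF f(1)] calV_L2[OF v] rep rep']
      unfolding fc_v x_def y_def .
    also have "\<dots> \<le> 2 * pi * (\<Sum>l\<in>int_box i. \<Sum>p\<in>int_box i. x l * y p * (K * (w l + w p) * z (l + p)))"
      by (intro mult_left_mono sum_mono mult_right_mono w(3) z0 mult_nonneg_nonneg x y) auto
    also have "\<dots> = 2 * pi * K * ((\<Sum>l\<in>int_box i. \<Sum>p\<in>int_box i. (w l * x l) * y p * z (l + p))
        + (\<Sum>l\<in>int_box i. \<Sum>p\<in>int_box i. x l * (w p * y p) * z (l + p)))"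
      by (simp add: sum_distrib_left sum.distrib[symmetric] algebra_simps)
    also have "\<dots> \<le> 2 * pi * K * (S * Z * M * X + S * M * Z * X)"
    proof (intro mult_left_mono add_mono)
      show "(\<Sum>l\<in>int_box i. \<Sum>p\<in>int_box i. (w l * x l) * y p * z (l + p)) \<le> S * Z * M * X"
        by (rule trilinear_bound[OF S finite_int_box]) (use 0 le leZ Z(1) M X zX in auto)
      show "(\<Sum>l\<in>int_box i. \<Sum>p\<in>int_box i. x l * (w p * y p) * z (l + p)) \<le> S * M * Z * X"
        by (rule trilinear_bound[OF S finite_int_box]) (use 0 le leZ Z(1) M X zX in auto)
    qed (use w(4) in auto)
    finally show ?thesis by (simp add: algebra_simps)
  qed
  have "(\<lambda>i. \<bar>l2_inner (advection (?f i) (?g i)) v\<bar>) \<longlonglongrightarrow> \<bar>opB f g v\<bar>"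
    by (intro tendsto_rabs opB_tendsto f g v approximates_truncation)
  hence "\<bar>opB f g v\<bar> \<le> 4 * pi * S * K * Z * M * X"
    by (rule LIMSEQ_le_const2) (use bound in blast)
  thus ?thesis by (simp add: v_def c_def[abs_def] X_def)
qed

text \<open>The equation is tested with the weighted increment between the two times. The pairing of the test
  field with A u is coercive: its increment dominates the square of X. The mean value theorem in time bounds
  the increment by the right-hand side G, which is at most a multiple of X, and one factor X cancels.\<close>

lemma voigt_increment_bound:
  fixes w :: "int^3 \<Rightarrow> real" and u :: "real \<Rightarrow> vfield"
  assumes \<alpha>: "\<alpha> > 0" and u: "\<And>r. u r \<in> spaceV"
    and w: "\<And>k. w (- k) = w k"
    and deriv: "\<And>r. has_dual_deriv (\<lambda>s v. \<alpha>\<^sup>2 * opA (u s) v + l2_inner (u s) v) (G r) r"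
    and G: "\<And>r v c. v \<in> spaceV \<Longrightarrow> G r (\<lambda>x. c *\<^sub>R v x) = c * G r v"
    and d_def: "\<And>k. d k = fourier_coeff (u s) k - fourier_coeff (u t) k"
    and X_def: "X = L2_set (\<lambda>k. norm (freq k) * (w k * norm (d k))) (int_box n)"
    and B: "\<And>r. r \<in> closed_segment t s \<Longrightarrow> \<bar>G r (trig_sum (int_box n) (\<lambda>k. (w k)\<^sup>2 *\<^sub>R d k))\<bar> \<le> B * X" "B \<ge> 0"
  shows "(2 * pi * \<alpha>)\<^sup>2 * X \<le> B * \<bar>s - t\<bar>"
proof -
  define c where "c k = (w k)\<^sup>2 *\<^sub>R d k" for k
  define v where "v = trig_sum (int_box n) c"
  have d: "hermitian d" "solenoidal d"
    unfolding d_def[abs_def] by (intro hermitian_diff hermitian_fourier_coeff solenoidal_diff spaceV_solenoidal u)+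
  have c: "hermitian c" "solenoidal c"
    unfolding c_def using d w by (auto intro: hermitian_scaleR solenoidal_scaleR)
  have v: "v \<in> calV" unfolding v_def by (intro calV_trig_sum c) auto
  define g where "g r = \<alpha>\<^sup>2 * opA (u r) v + l2_inner (u r) v" for r
  have g_eq: "g r = (\<Sum>k\<in>int_box n. (\<alpha>\<^sup>2 * (2 * pi * norm (freq k))\<^sup>2 + 1) * (c k \<bullet> fourier_coeff (u r) k))" for r
  proof -
    have "opA (u r) v = (\<Sum>k\<in>int_box n. (2 * pi * norm (freq k))\<^sup>2 * (c k \<bullet> fourier_coeff (u r) k))"
      using opA_trig_sum[OF u[of r] finite_int_box] v unfolding v_def by blast
    moreover have "l2_inner (u r) v = (\<Sum>k\<in>int_box n. c k \<bullet> fourier_coeff (u r) k)"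
      unfolding v_def by (subst l2_inner_commute) (rule l2_inner_trig_sum[OF spaceV_L2[OF u]])
    ultimately show ?thesis
      by (simp add: g_def sum_distrib_left sum.distrib[symmetric] algebra_simps)
  qed
  have DERIV: "(g has_field_derivative G r v) (at r)" for r
  proof -
    let ?D = "\<lambda>h v. (\<alpha>\<^sup>2 * opA (u (r + h)) v + l2_inner (u (r + h)) v - (\<alpha>\<^sup>2 * opA (u r) v + l2_inner (u r) v)) / h - G r v"
    have "((\<lambda>h. ?D h v) \<longlongrightarrow> 0) (at 0)"
    proof (rule dual_norm_tendsto_0_pointwise[OF v])
      show "((\<lambda>h. dual_norm (?D h)) \<longlongrightarrow> 0) (at 0)" using deriv[of r] by (simp add: has_dual_deriv_def)
      show "?D h (\<lambda>x. c *\<^sub>R v x) = c * ?D h v" for h c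
        unfolding G[OF calV_spaceV[OF v]] dualV_scale[OF opA_works(1)[OF u] calV_spaceV[OF v]] l2_inner_scaleR_right
        by (simp add: algebra_simps add_divide_distrib diff_divide_distrib)
    qed
    hence "((\<lambda>h. (g (r + h) - g r) / h - G r v) \<longlongrightarrow> 0) (at 0)" by (simp add: g_def)
    hence "((\<lambda>h. (g (r + h) - g r) / h) \<longlongrightarrow> G r v) (at 0)" by (simp add: LIM_zero_iff)
    thus ?thesis by (simp add: DERIV_def)
  qed
  have "norm (g s - g t) \<le> (B * X) * norm (s - t)"
  proof (rule field_differentiable_bound[of "closed_segment t s"])
    show "(g has_field_derivative G r v) (at r within closed_segment t s)" for r
      using DERIV by (rule has_field_derivative_at_within)
    show "norm (G r v) \<le> B * X" if "r \<in> closed_segment t s" for r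
      using B(1)[OF that] by (simp add: v_def c_def[abs_def])
  qed auto
  moreover have "g s - g t = (\<Sum>k\<in>int_box n. (\<alpha>\<^sup>2 * (2 * pi * norm (freq k))\<^sup>2 + 1) * (c k \<bullet> d k))"
    unfolding g_eq by (simp add: d_def inner_diff_right right_diff_distrib sum_subtractf)
  moreover have "(\<Sum>k\<in>int_box n. (\<alpha>\<^sup>2 * (2 * pi * norm (freq k))\<^sup>2 + 1) * (c k \<bullet> d k)) \<ge> (2 * pi * \<alpha>)\<^sup>2 * X\<^sup>2"
  proof -
    have "(2 * pi * \<alpha>)\<^sup>2 * X\<^sup>2 = (\<Sum>k\<in>int_box n. \<alpha>\<^sup>2 * (2 * pi * norm (freq k))\<^sup>2 * (c k \<bullet> d k))"
      by (simp add: X_def L2_set_def sum_nonneg sum_distrib_left c_def power_mult_distrib power2_norm_eq_inner[symmetric] mult_ac)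
    also have "\<dots> \<le> (\<Sum>k\<in>int_box n. (\<alpha>\<^sup>2 * (2 * pi * norm (freq k))\<^sup>2 + 1) * (c k \<bullet> d k))"
      by (intro sum_mono mult_right_mono) (auto simp: c_def)
    finally show ?thesis .
  qed
  ultimately have "(2 * pi * \<alpha>)\<^sup>2 * X\<^sup>2 \<le> B * X * \<bar>s - t\<bar>" by simp
  hence *: "X * ((2 * pi * \<alpha>)\<^sup>2 * X) \<le> X * (B * \<bar>s - t\<bar>)" by (simp add: power2_eq_square mult_ac)
  have "X \<ge> 0" by (simp add: X_def L2_set_nonneg)
  show ?thesis
  proof (cases "X = 0")
    case False
    hence "X > 0" using \<open>X \<ge> 0\<close> by simp
    thus ?thesis using * by (simp only: mult_le_cancel_left_pos)
  qed (use B(2) in simp)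
qed

section \<open>Propagation of regularity\<close>

text \<open>A bounded substitute for the power of the frequency. Boundedness makes the weighted norms of
  elements of V finite before any regularity is known, and the almost subadditivity of the power survives
  with a constant that does not depend on the cut-off N.\<close>

definition cut_weight :: "nat \<Rightarrow> real \<Rightarrow> int^3 \<Rightarrow> real" where
  "cut_weight r N k = min (norm (freq k)) N ^ r"

lemma cut_weight_nonneg: "N \<ge> 0 \<Longrightarrow> cut_weight r N k \<ge> 0"
  and cut_weight_le: "N \<ge> 0 \<Longrightarrow> cut_weight r N k \<le> norm (freq k) ^ r"
  and cut_weight_le_const: "N \<ge> 0 \<Longrightarrow> cut_weight r N k \<le> N ^ r"
  and cut_weight_uminus: "cut_weight r N (- k) = cut_weight r N k"
  and cut_weight_eq: "norm (freq k) \<le> N \<Longrightarrow> cut_weight r N k = norm (freq k) ^ r"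
  by (auto simp: cut_weight_def intro: power_mono)

lemma cut_weight_add:
  assumes N: "N \<ge> 0"
  shows "cut_weight r N (l + p) \<le> 2 ^ r * (cut_weight r N l + cut_weight r N p)"
proof -
  let ?a = "min (norm (freq l)) N" and ?b = "min (norm (freq p)) N"
  have "norm (freq (l + p)) \<le> norm (freq l) + norm (freq p)"
    unfolding freq_add by (rule norm_triangle_ineq)
  hence "min (norm (freq (l + p))) N \<le> 2 * max ?a ?b"
    using norm_ge_zero[of "freq l"] norm_ge_zero[of "freq p"] N by linarith
  hence "cut_weight r N (l + p) \<le> (2 * max ?a ?b) ^ r"
    unfolding cut_weight_def using N by (intro power_mono) auto
  also have "\<dots> = 2 ^ r * max ?a ?b ^ r" by (rule power_mult_distrib)
  also have "max ?a ?b ^ r \<le> ?a ^ r + ?b ^ r"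
    using N by (simp add: max_def)
  finally show ?thesis by (simp add: cut_weight_def)
qed

lemma L2_set_le_iff: "B \<ge> 0 \<Longrightarrow> L2_set f G \<le> B \<longleftrightarrow> (\<Sum>k\<in>G. (f k)\<^sup>2) \<le> B\<^sup>2"
  unfolding L2_set_def by (metis real_sqrt_le_iff real_sqrt_abs abs_of_nonneg)

text \<open>A differentiable curve is continuous, and its norm is bounded on compact intervals.\<close>

lemma Hm_norm_C1_curve_bounded:
  assumes "C1_curve spaceV (Hm_norm 1) u"
  obtains M where "M > 0" "\<And>t. t \<in> {-T..T} \<Longrightarrow> Hm_norm 1 (u t) \<le> M"
proof -
  from assms obtain u' where u: "\<And>t. u t \<in> spaceV" and u': "\<And>t. u' t \<in> spaceV"
    and lim: "\<And>t. ((\<lambda>h. Hm_norm 1 (\<lambda>x. (1 / h) *\<^sub>R (u (t + h) x - u t x) - u' t x)) \<longlongrightarrow> 0) (at 0)"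
    unfolding C1_curve_def cont_curve_def by blast
  have H: "u t \<in> Hm 1" "u' t \<in> Hm 1" for t using u u' spaceV_Hm1 by auto
  have "isCont (\<lambda>t. Hm_norm 1 (u t)) t" for t
  proof -
    let ?q = "\<lambda>h x. (1 / h) *\<^sub>R (u (t + h) x - u t x) - u' t x"
    have q: "?q h \<in> Hm 1" for h by (intro Hm_diff Hm_scaleR H)
    have "((\<lambda>h. Hm_norm 1 (u (t + h)) - Hm_norm 1 (u t)) \<longlongrightarrow> 0) (at 0)"
    proof (rule Lim_null_comparison)
      show "\<forall>\<^sub>F h in at 0. norm (Hm_norm 1 (u (t + h)) - Hm_norm 1 (u t)) \<le> \<bar>h\<bar> * Hm_norm 1 (?q h) + \<bar>h\<bar> * Hm_norm 1 (u' t)"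
      proof -
        have "\<forall>\<^sub>F h in at (0::real). h \<noteq> 0" by (simp add: eventually_at_filter)
        thus ?thesis
        proof eventually_elim
          fix h :: real assume h: "h \<noteq> 0"
          have dH: "(\<lambda>x. u (t + h) x - u t x) \<in> Hm 1" by (intro Hm_diff H)
          have "Hm_norm 1 (\<lambda>x. h *\<^sub>R ?q h x - (- h) *\<^sub>R u' t x) \<le> Hm_norm 1 (\<lambda>x. h *\<^sub>R ?q h x) + Hm_norm 1 (\<lambda>x. (- h) *\<^sub>R u' t x)"
            by (intro Hm_norm_triangle_diff Hm_scaleR(1) q H)
          also have "\<dots> = \<bar>h\<bar> * Hm_norm 1 (?q h) + \<bar>h\<bar> * Hm_norm 1 (u' t)"
            unfolding Hm_scaleR(2)[OF q] Hm_scaleR(2)[OF H(2)] by simp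
          also have "(\<lambda>x. h *\<^sub>R ?q h x - (- h) *\<^sub>R u' t x) = (\<lambda>x. u (t + h) x - u t x)"
            using h by (simp add: fun_eq_iff scaleR_right_diff_distrib)
          finally have le: "Hm_norm 1 (\<lambda>x. u (t + h) x - u t x) \<le> \<bar>h\<bar> * Hm_norm 1 (?q h) + \<bar>h\<bar> * Hm_norm 1 (u' t)" .
          have n: "Hm_norm 1 (\<lambda>x. (-1) *\<^sub>R f x) = Hm_norm 1 f" "(\<lambda>x. (-1) *\<^sub>R f x) \<in> Hm 1" if "f \<in> Hm 1" for f
            using Hm_scaleR[OF that, of "-1"] by auto
          have "Hm_norm 1 (\<lambda>x. (u (t + h) x - u t x) - (-1) *\<^sub>R u t x) \<le> Hm_norm 1 (\<lambda>x. u (t + h) x - u t x) + Hm_norm 1 (u t)"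
            using Hm_norm_triangle_diff[OF dH n(2)[OF H(1)[of t]]] n(1)[OF H(1)[of t]] by simp
          moreover have "Hm_norm 1 (\<lambda>x. u (t + h) x - (u (t + h) x - u t x)) \<le> Hm_norm 1 (u (t + h)) + Hm_norm 1 (\<lambda>x. u (t + h) x - u t x)"
            by (intro Hm_norm_triangle_diff dH H)
          ultimately show "norm (Hm_norm 1 (u (t + h)) - Hm_norm 1 (u t)) \<le> \<bar>h\<bar> * Hm_norm 1 (?q h) + \<bar>h\<bar> * Hm_norm 1 (u' t)"
            using le by (simp add: abs_le_iff)
        qed
      qed
      have "((\<lambda>h::real. \<bar>h\<bar>) \<longlongrightarrow> 0) (at 0)" by (rule tendsto_rabs_zero) (rule tendsto_ident_at)
      thus "((\<lambda>h. \<bar>h\<bar> * Hm_norm 1 (?q h) + \<bar>h\<bar> * Hm_norm 1 (u' t)) \<longlongrightarrow> 0) (at 0)"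
        using tendsto_add[OF tendsto_mult[OF _ lim[of t]] tendsto_mult[OF _ tendsto_const[of "Hm_norm 1 (u' t)"]]]
        by fastforce
    qed
    hence "((\<lambda>h. Hm_norm 1 (u (t + h))) \<longlongrightarrow> Hm_norm 1 (u t)) (at 0)" by (simp add: LIM_zero_iff)
    thus ?thesis by (simp add: isCont_iff)
  qed
  hence "continuous_on {-T..T} (\<lambda>t. Hm_norm 1 (u t))"
    by (simp add: continuous_at_imp_continuous_on)
  hence "bounded ((\<lambda>t. Hm_norm 1 (u t)) ` {-T..T})"
    by (intro compact_imp_bounded compact_continuous_image) auto
  then obtain M where M: "\<forall>x\<in>(\<lambda>t. Hm_norm 1 (u t)) ` {-T..T}. norm x \<le> M"
    unfolding bounded_iff by blast
  show ?thesis
  proof (rule that[of "\<bar>M\<bar> + 1"])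
    show "Hm_norm 1 (u t) \<le> \<bar>M\<bar> + 1" if "t \<in> {-T..T}" for t
      using bspec[OF M imageI[OF that]] by simp
  qed simp
qed

lemma fourier_coeff_cong_AE:
  assumes "f \<in> L2" "g \<in> L2" "AE x in torus3. f x = g x"
  shows "fourier_coeff f k = fourier_coeff g k"
proof -
  have "AE x in torus3. f x - g x = 0" using assms(3) by eventually_elim simp
  hence "l2_norm (\<lambda>x. f x - g x) = l2_norm (\<lambda>x. 0)"
    using assms by (intro l2_norm_cong_AE) (auto intro: L2_continuous)
  also have "\<dots> = 0" by (simp add: l2_norm_def l2_inner_def)
  finally show ?thesis
    using norm_fourier_coeff_le[of "\<lambda>x. f x - g x" k] assms by (auto simp: fourier_coeff_diff)
qed

text \<open>The two unknowns are indexed by a Boolean, as they satisfy the same estimates. Let R be the supremum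
  of the weighted increments over the time segment and the frequency boxes; it is finite because the cut
  weight is bounded. At every time of the segment the weighted norms are at most Z + R, so that the increment
  bound gives R \<le> \<theta> (Z + R) with \<theta> = L times the length of the segment, and \<theta> \<le> 1/2. Hence
  R \<le> 2 \<theta> Z, whatever the cut-off.\<close>

lemma voigt_increment_regular:
  fixes q :: "bool \<Rightarrow> real \<Rightarrow> vfield" and A :: "bool \<Rightarrow> real"
  assumes S: "S \<ge> 0" "\<And>G :: (int^3) set. finite G \<Longrightarrow> 0 \<notin> G \<Longrightarrow> (\<Sum>k\<in>G. 1 / norm (freq k) ^ 4) \<le> S\<^sup>2"
    and q: "\<And>i \<rho>. q i \<rho> \<in> spaceV"
    and a: "a > 0" "\<And>i. a \<le> A i"
    and deriv: "\<And>i \<rho>. has_dual_deriv (\<lambda>s v. (A i)\<^sup>2 * opA (q i s) v + l2_inner (q i s) v) (H i \<rho>) \<rho>"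
    and H: "\<And>i \<rho>. \<exists>i1 i2 i3 i4. H i \<rho> = (\<lambda>v. opB (q i1 \<rho>) (q i2 \<rho>) v - opB (q i3 \<rho>) (q i4 \<rho>) v)"
    and M: "M \<ge> 0" "\<And>i \<rho>. \<rho> \<in> closed_segment t s \<Longrightarrow> Hm_norm 1 (q i \<rho>) \<le> M"
    and L_def: "L = 8 * pi * S * 2 ^ r * M / (2 * pi * a)\<^sup>2"
    and small: "L * \<bar>s - t\<bar> \<le> 1 / 2"
    and Z: "Z \<ge> 0" "\<And>i G. finite G \<Longrightarrow> (\<Sum>k\<in>G. (norm (freq k) ^ Suc r * norm (fourier_coeff (q i t) k))\<^sup>2) \<le> Z\<^sup>2"
    and G: "finite G"
  shows "(\<Sum>k\<in>G. (norm (freq k) ^ Suc r * norm (fourier_coeff (q i s) k - fourier_coeff (q i t) k))\<^sup>2)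
     \<le> (2 * L * \<bar>s - t\<bar> * Z)\<^sup>2"
proof -
  \<comment> \<open>A cut-off above all frequencies in G, where the weight is then the full power.\<close>
  define N where "N = (\<Sum>k\<in>G. norm (freq k))"
  have N: "N \<ge> 0" by (simp add: N_def sum_nonneg)
  define w where "w = cut_weight r N"
  have w0: "w k \<ge> 0" and w_le: "w k \<le> norm (freq k) ^ r" and w_leN: "w k \<le> N ^ r" and w_m: "w (- k) = w k" for k
    unfolding w_def using N by (simp_all add: cut_weight_nonneg cut_weight_le cut_weight_le_const cut_weight_uminus)
  have w_add: "w (l + p) \<le> 2 ^ r * (w l + w p)" for l p
    unfolding w_def by (rule cut_weight_add[OF N])
  define d where "d i \<rho> k = fourier_coeff (q i \<rho>) k - fourier_coeff (q i t) k" for i \<rho> k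
  define X where "X i \<rho> n = L2_set (\<lambda>k. norm (freq k) * (w k * norm (d i \<rho> k))) (int_box n)" for i \<rho> n
  let ?I = "closed_segment t s"
  have X0: "X i \<rho> n \<ge> 0" for i \<rho> n by (simp add: X_def L2_set_nonneg)
  have apriori: "X i \<rho> n \<le> N ^ r * (2 * M)" if \<rho>: "\<rho> \<in> ?I" for i \<rho> n
  proof -
    let ?f = "\<lambda>x. q i \<rho> x - q i t x"
    have f: "?f \<in> Hm 1" "Hm_norm 1 ?f \<le> 2 * M"
    proof -
      show "?f \<in> Hm 1" by (intro Hm_diff spaceV_Hm1 q)
      have "Hm_norm 1 ?f \<le> Hm_norm 1 (q i \<rho>) + Hm_norm 1 (q i t)"
        by (intro Hm_norm_triangle_diff spaceV_Hm1 q)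
      thus "Hm_norm 1 ?f \<le> 2 * M" using M(2)[OF \<rho>, of i] M(2)[of t i] by simp
    qed
    have "X i \<rho> n \<le> L2_set (\<lambda>k. N ^ r * (norm (freq k) * norm (fourier_coeff ?f k))) (int_box n)"
      unfolding X_def
    proof (rule L2_set_mono)
      fix k
      have "fourier_coeff ?f k = d i \<rho> k" by (simp add: d_def fourier_coeff_diff spaceV_L2 q)
      moreover have "w k * (norm (freq k) * norm (d i \<rho> k)) \<le> N ^ r * (norm (freq k) * norm (d i \<rho> k))"
        by (intro mult_right_mono w_leN) auto
      ultimately show "norm (freq k) * (w k * norm (d i \<rho> k)) \<le> N ^ r * (norm (freq k) * norm (fourier_coeff ?f k))"
        by (simp add: mult_ac)
    qed (simp add: w0)
    also have "\<dots> = N ^ r * L2_set (\<lambda>k. norm (freq k) * norm (fourier_coeff ?f k)) (int_box n)"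
      using N by (simp add: L2_set_right_distrib)
    also have "\<dots> \<le> N ^ r * Hm_norm 1 ?f"
      using H1_coeff_bound[OF f(1) finite_int_box[of n]] N
      by (intro mult_left_mono) (simp_all add: L2_set_le_iff)
    also have "\<dots> \<le> N ^ r * (2 * M)" using f(2) N by (intro mult_left_mono) auto
    finally show ?thesis .
  qed
  define Y where "Y = {X i \<rho> n | i \<rho> n. \<rho> \<in> ?I}"
  define R where "R = Sup Y"
  have "bdd_above Y" unfolding Y_def bdd_above_def using apriori by blast
  hence XR: "X i \<rho> n \<le> R" if "\<rho> \<in> ?I" for i \<rho> n
    unfolding R_def by (intro cSup_upper) (use that in \<open>auto simp: Y_def\<close>)
  have R0: "R \<ge> 0" using X0[of True t 0] XR[of t True 0] by simp
  have le_X: "L2_set (\<lambda>k. norm (freq k) * (w k * norm (d i \<rho> k))) F \<le> R" if F: "finite F" and \<rho>: "\<rho> \<in> ?I" for i \<rho> F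
  proof -
    obtain n where n: "F \<subseteq> int_box n" using finite_subset_int_box[OF F] .
    have "L2_set (\<lambda>k. norm (freq k) * (w k * norm (d i \<rho> k))) F \<le> X i \<rho> n"
      unfolding L2_set_def X_def by (intro real_sqrt_le_mono sum_mono2 n) auto
    thus ?thesis using XR[OF \<rho>, of i n] by linarith
  qed
  have ZR: "(\<Sum>k\<in>F. (norm (freq k) * (w k * norm (fourier_coeff (q i \<rho>) k)))\<^sup>2) \<le> (Z + R)\<^sup>2"
    if F: "finite F" and \<rho>: "\<rho> \<in> ?I" for i \<rho> F
  proof -
    have "L2_set (\<lambda>k. norm (freq k) * (w k * norm (fourier_coeff (q i \<rho>) k))) F
      \<le> L2_set (\<lambda>k. norm (freq k) ^ Suc r * norm (fourier_coeff (q i t) k) + norm (freq k) * (w k * norm (d i \<rho> k))) F"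
    proof (rule L2_set_mono)
      fix k
      have "norm (fourier_coeff (q i \<rho>) k) \<le> norm (fourier_coeff (q i t) k) + norm (d i \<rho> k)"
        unfolding d_def using norm_triangle_ineq[of "fourier_coeff (q i t) k" "fourier_coeff (q i \<rho>) k - fourier_coeff (q i t) k"] by simp
      hence "norm (freq k) * (w k * norm (fourier_coeff (q i \<rho>) k)) \<le> norm (freq k) * (w k * (norm (fourier_coeff (q i t) k) + norm (d i \<rho> k)))"
        by (intro mult_left_mono w0) auto
      also have "\<dots> = norm (freq k) * (w k * norm (fourier_coeff (q i t) k)) + norm (freq k) * (w k * norm (d i \<rho> k))"
        by (simp add: algebra_simps)
      also have "norm (freq k) * (w k * norm (fourier_coeff (q i t) k)) \<le> norm (freq k) * (norm (freq k) ^ r * norm (fourier_coeff (q i t) k))"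
        by (intro mult_left_mono mult_right_mono w_le) auto
      finally show "norm (freq k) * (w k * norm (fourier_coeff (q i \<rho>) k))
        \<le> norm (freq k) ^ Suc r * norm (fourier_coeff (q i t) k) + norm (freq k) * (w k * norm (d i \<rho> k))"
        by (simp add: mult.assoc)
    qed (simp add: w0)
    also have "\<dots> \<le> L2_set (\<lambda>k. norm (freq k) ^ Suc r * norm (fourier_coeff (q i t) k)) F
        + L2_set (\<lambda>k. norm (freq k) * (w k * norm (d i \<rho> k))) F"
      by (rule L2_set_triangle_ineq)
    also have "\<dots> \<le> Z + R"
    proof (rule add_mono)
      show "L2_set (\<lambda>k. norm (freq k) ^ Suc r * norm (fourier_coeff (q i t) k)) F \<le> Z"
        using Z(2)[OF F, of i] by (subst L2_set_le_iff[OF Z(1)])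
    qed (rule le_X[OF F \<rho>])
    finally show ?thesis using Z(1) R0 by (subst (asm) L2_set_le_iff) auto
  qed
  have opB_le: "\<bar>opB (q i1 \<rho>) (q i2 \<rho>) (trig_sum (int_box n) (\<lambda>k. (w k)\<^sup>2 *\<^sub>R d i \<rho>' k))\<bar>
     \<le> 4 * pi * S * 2 ^ r * (Z + R) * M * X i \<rho>' n" if "\<rho> \<in> ?I" for i i1 i2 \<rho> \<rho>' n
    unfolding X_def
  proof (rule opB_weighted_bound[OF S w0 w_m w_add])
    show "hermitian (d i \<rho>')" "solenoidal (d i \<rho>')"
      unfolding d_def[abs_def] by (intro hermitian_diff hermitian_fourier_coeff solenoidal_diff spaceV_solenoidal q)+
  qed (use q M that Z(1) R0 ZR in auto)
  have step: "X i \<rho> n \<le> L * \<bar>s - t\<bar> * (Z + R)" if \<rho>: "\<rho> \<in> ?I" for i \<rho> n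
  proof -
    let ?B = "8 * pi * S * 2 ^ r * (Z + R) * M"
    have B0: "?B \<ge> 0" using S(1) Z(1) R0 M(1) by simp
    have "(2 * pi * A i)\<^sup>2 * X i \<rho> n \<le> ?B * \<bar>\<rho> - t\<bar>"
    proof (rule voigt_increment_bound[OF _ q w_m deriv _ _ X_def])
      show "A i > 0" using a less_le_trans by blast
      show "H i \<sigma> (\<lambda>x. c *\<^sub>R v x) = c * H i \<sigma> v" if "v \<in> spaceV" for \<sigma> v c
      proof -
        obtain i1 i2 i3 i4 where "H i \<sigma> = (\<lambda>v. opB (q i1 \<sigma>) (q i2 \<sigma>) v - opB (q i3 \<sigma>) (q i4 \<sigma>) v)" using H by blast
        thus ?thesis using dualV_scale[OF opB_works(1)[OF q q] that] by (simp add: right_diff_distrib)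
      qed
      show "\<bar>H i \<sigma> (trig_sum (int_box n) (\<lambda>k. (w k)\<^sup>2 *\<^sub>R d i \<rho> k))\<bar> \<le> ?B * X i \<rho> n" if "\<sigma> \<in> closed_segment t \<rho>" for \<sigma>
      proof -
        have \<sigma>: "\<sigma> \<in> ?I" using that \<rho> by (meson ends_in_segment(1) subset_closed_segment subsetD)
        obtain i1 i2 i3 i4 where H': "H i \<sigma> = (\<lambda>v. opB (q i1 \<sigma>) (q i2 \<sigma>) v - opB (q i3 \<sigma>) (q i4 \<sigma>) v)" using H by blast
        show ?thesis unfolding H' using opB_le[OF \<sigma>, of i1 i2 n i \<rho>] opB_le[OF \<sigma>, of i3 i4 n i \<rho>] by linarith
      qed
    qed (simp_all add: d_def B0)
    moreover have "?B * \<bar>\<rho> - t\<bar> \<le> ?B * \<bar>s - t\<bar>"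
      using segment_bound(1)[OF \<rho>] by (intro mult_left_mono B0) simp
    moreover have "(2 * pi * a)\<^sup>2 * X i \<rho> n \<le> (2 * pi * A i)\<^sup>2 * X i \<rho> n"
      using a by (intro mult_right_mono power_mono X0 mult_left_mono) auto
    ultimately have le: "(2 * pi * a)\<^sup>2 * X i \<rho> n \<le> ?B * \<bar>s - t\<bar>" by linarith
    have "(2 * pi * a)\<^sup>2 > 0" using a(1) by simp
    hence "X i \<rho> n \<le> ?B * \<bar>s - t\<bar> / (2 * pi * a)\<^sup>2" using le by (simp only: pos_le_divide_eq mult.commute)
    also have "\<dots> = L * \<bar>s - t\<bar> * (Z + R)" by (simp add: L_def)
    finally show ?thesis .
  qed
  have "R \<le> L * \<bar>s - t\<bar> * (Z + R)"
    unfolding R_def[unfolded Y_def] by (rule cSup_least) (use step in \<open>auto simp: R_def Y_def\<close>)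
  moreover have "L * \<bar>s - t\<bar> * R \<le> 1 / 2 * R" by (intro mult_right_mono small R0)
  ultimately have R: "R \<le> 2 * L * \<bar>s - t\<bar> * Z" by (simp add: distrib_left)
  have wG: "w k = norm (freq k) ^ r" if "k \<in> G" for k
  proof -
    have "norm (freq k) \<le> N" unfolding N_def using G that by (intro member_le_sum) auto
    thus ?thesis unfolding w_def by (rule cut_weight_eq)
  qed
  have "(\<Sum>k\<in>G. (norm (freq k) ^ Suc r * norm (d i s k))\<^sup>2) = (\<Sum>k\<in>G. (norm (freq k) * (w k * norm (d i s k)))\<^sup>2)"
    by (intro sum.cong) (simp_all add: wG mult.assoc)
  also have "\<dots> \<le> R\<^sup>2" using le_X[OF G, of s i] by (simp add: L2_set_le_iff[OF R0])
  also have "\<dots> \<le> (2 * L * \<bar>s - t\<bar> * Z)\<^sup>2" by (intro power_mono R R0)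
  finally show ?thesis by (simp add: d_def)
qed

theorem theorem6p3:
  fixes \<alpha> \<alpha>\<^sub>M :: real and m :: nat
    and u_in b_in :: vfield and u b :: "real \<Rightarrow> vfield"
  assumes "\<alpha> > 0" and "\<alpha>\<^sub>M > 0" and "m \<ge> 1"
    and "u_in \<in> Hm m \<inter> spaceV" and "b_in \<in> Hm m \<inter> spaceV"
    and "mhd_voigt_solution \<alpha> \<alpha>\<^sub>M u_in b_in u b"
  shows "cont_curve (Hm m \<inter> spaceV) (Hm_norm m) u \<and>
         cont_curve (Hm m \<inter> spaceV) (Hm_norm m) b"
proof -
  obtain r where m: "m = Suc r" using \<open>m \<ge> 1\<close> by (cases m) auto
  obtain S :: real where S: "S \<ge> 0" "\<And>G :: (int^3) set. finite G \<Longrightarrow> 0 \<notin> G \<Longrightarrow> (\<Sum>k\<in>G. 1 / norm (freq k) ^ 4) \<le> S\<^sup>2"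
    using lattice_sum_bounded by blast
  note sol = assms(6)[unfolded mhd_voigt_solution_def]
  define q where "q i = (if i then u else b)" for i :: bool
  define A where "A i = (if i then \<alpha> else \<alpha>\<^sub>M)" for i :: bool
  define H where "H i \<rho> = (if i then (\<lambda>v. opB (b \<rho>) (b \<rho>) v - opB (u \<rho>) (u \<rho>) v)
    else (\<lambda>v. opB (b \<rho>) (u \<rho>) v - opB (u \<rho>) (b \<rho>) v))" for i :: bool and \<rho>
  define a where "a = min \<alpha> \<alpha>\<^sub>M"
  have C1: "C1_curve spaceV (Hm_norm 1) (q i)" for i using sol by (simp add: q_def)
  hence q: "q i \<rho> \<in> spaceV" for i \<rho> by (simp add: C1_curve_def)
  have a: "a > 0" "a \<le> A i" for i using assms(1,2) by (auto simp: a_def A_def)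
  have deriv: "has_dual_deriv (\<lambda>s v. (A i)\<^sup>2 * opA (q i s) v + l2_inner (q i s) v) (H i \<rho>) \<rho>" for i \<rho>
    using sol by (cases i) (simp_all add: A_def q_def H_def)
  have H: "\<exists>i1 i2 i3 i4. H i \<rho> = (\<lambda>v. opB (q i1 \<rho>) (q i2 \<rho>) v - opB (q i3 \<rho>) (q i4 \<rho>) v)" for i \<rho>
  proof (cases i)
    case True
    show ?thesis
      by (rule exI[of _ False], rule exI[of _ False], rule exI[of _ True], rule exI[of _ True])
        (use True in \<open>simp add: H_def q_def\<close>)
  next
    case False
    show ?thesis
      by (rule exI[of _ False], rule exI[of _ True], rule exI[of _ True], rule exI[of _ False])
        (use False in \<open>simp add: H_def q_def\<close>)
  qed
  define reg where "reg t Z \<longleftrightarrow> Z \<ge> 0 \<and> (\<forall>i G. finite G \<longrightarrow>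
      (\<Sum>k\<in>G. (norm (freq k) ^ m * norm (fourier_coeff (q i t) k))\<^sup>2) \<le> Z\<^sup>2)" for t Z
  \<comment> \<open>On a bounded time interval the admissible step length 1/(2L) is uniform, since the norms in V
    are bounded there.\<close>
  have local_est: "\<exists>L\<ge>0. \<forall>t\<in>{-T..T}. \<forall>s\<in>{-T..T}. \<forall>Z i G. L * \<bar>s - t\<bar> \<le> 1 / 2 \<longrightarrow> reg t Z \<longrightarrow> finite G \<longrightarrow>
      (\<Sum>k\<in>G. (norm (freq k) ^ m * norm (fourier_coeff (q i s) k - fourier_coeff (q i t) k))\<^sup>2)
        \<le> (2 * L * \<bar>s - t\<bar> * Z)\<^sup>2" for T
  proof -
    obtain M1 where M1: "M1 > 0" "\<And>t. t \<in> {-T..T} \<Longrightarrow> Hm_norm 1 (q True t) \<le> M1"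
      using Hm_norm_C1_curve_bounded[OF C1] by blast
    obtain M2 where M2: "M2 > 0" "\<And>t. t \<in> {-T..T} \<Longrightarrow> Hm_norm 1 (q False t) \<le> M2"
      using Hm_norm_C1_curve_bounded[OF C1] by blast
    define M where "M = M1 + M2"
    have M: "M \<ge> 0" "Hm_norm 1 (q i t) \<le> M" if "t \<in> {-T..T}" for i t
      using M1 M2 that by (cases i; force simp: M_def)+
    define L where "L = 8 * pi * S * 2 ^ r * M / (2 * pi * a)\<^sup>2"
    have M0: "M \<ge> 0" using M1(1) M2(1) by (simp add: M_def)
    have "L \<ge> 0" unfolding L_def using S(1) M0 by simp
    moreover have "(\<Sum>k\<in>G. (norm (freq k) ^ m * norm (fourier_coeff (q i s) k - fourier_coeff (q i t) k))\<^sup>2)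
        \<le> (2 * L * \<bar>s - t\<bar> * Z)\<^sup>2"
      if ts: "t \<in> {-T..T}" "s \<in> {-T..T}" and small: "L * \<bar>s - t\<bar> \<le> 1 / 2" and reg: "reg t Z" and G: "finite G" for t s Z i G
    proof -
      have sub: "closed_segment t s \<subseteq> {-T..T}"
        using ts by (intro closed_segment_subset) auto
      show ?thesis
        unfolding m
        by (rule voigt_increment_regular[OF S q a deriv H M0 _ L_def small _ _ G])
          (use reg sub M(2) in \<open>auto simp: reg_def m\<close>)
    qed
    ultimately show ?thesis by blast
  qed
  have norm_step: "reg s (Z + Y)"
    if reg: "reg t Z" and Y: "Y \<ge> 0"
      and d: "\<And>i G. finite G \<Longrightarrow> (\<Sum>k\<in>G. (norm (freq k) ^ m * norm (fourier_coeff (q i s) k - fourier_coeff (q i t) k))\<^sup>2) \<le> Y\<^sup>2"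
    for t s Z Y
  proof -
    have Z: "Z \<ge> 0" using reg by (simp add: reg_def)
    have "(\<Sum>k\<in>G. (norm (freq k) ^ m * norm (fourier_coeff (q i s) k))\<^sup>2) \<le> (Z + Y)\<^sup>2" if G: "finite G" for i G
    proof -
      have "L2_set (\<lambda>k. norm (freq k) ^ m * norm (fourier_coeff (q i s) k)) G
        \<le> L2_set (\<lambda>k. norm (freq k) ^ m * norm (fourier_coeff (q i t) k)
            + norm (freq k) ^ m * norm (fourier_coeff (q i s) k - fourier_coeff (q i t) k)) G"
      proof (rule L2_set_mono)
        fix k
        have "norm (fourier_coeff (q i s) k) \<le> norm (fourier_coeff (q i t) k) + norm (fourier_coeff (q i s) k - fourier_coeff (q i t) k)"
          using norm_triangle_ineq[of "fourier_coeff (q i t) k" "fourier_coeff (q i s) k - fourier_coeff (q i t) k"] by simp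
        thus "norm (freq k) ^ m * norm (fourier_coeff (q i s) k) \<le> norm (freq k) ^ m * norm (fourier_coeff (q i t) k)
            + norm (freq k) ^ m * norm (fourier_coeff (q i s) k - fourier_coeff (q i t) k)"
          unfolding distrib_left[symmetric] by (rule mult_left_mono) simp
      qed simp
      also have "\<dots> \<le> L2_set (\<lambda>k. norm (freq k) ^ m * norm (fourier_coeff (q i t) k)) G
          + L2_set (\<lambda>k. norm (freq k) ^ m * norm (fourier_coeff (q i s) k - fourier_coeff (q i t) k)) G"
        by (rule L2_set_triangle_ineq)
      also have "\<dots> \<le> Z + Y"
        using reg G d[OF G] by (intro add_mono) (simp_all add: L2_set_le_iff Z Y reg_def)
      finally show ?thesis using Z Y by (subst (asm) L2_set_le_iff) auto
    qed
    thus ?thesis using Z Y by (simp add: reg_def)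
  qed
  have reg0: "\<exists>Z. reg 0 Z"
  proof -
    have fc: "fourier_coeff (u 0) k = fourier_coeff u_in k" "fourier_coeff (b 0) k = fourier_coeff b_in k" for k
      using sol assms(4,5) q[of True 0] q[of False 0]
      by (auto intro!: fourier_coeff_cong_AE spaceV_L2 simp: q_def)
    obtain Z1 where Z1: "Z1 \<ge> 0" "\<And>F. finite F \<Longrightarrow> (\<Sum>k\<in>F. (norm (freq k) ^ m * norm (fourier_coeff u_in k))\<^sup>2) \<le> Z1\<^sup>2"
      using Hm_coeff_bound[of u_in m] assms(4) by blast
    obtain Z2 where Z2: "Z2 \<ge> 0" "\<And>F. finite F \<Longrightarrow> (\<Sum>k\<in>F. (norm (freq k) ^ m * norm (fourier_coeff b_in k))\<^sup>2) \<le> Z2\<^sup>2"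
      using Hm_coeff_bound[of b_in m] assms(5) by blast
    have sq: "Z1\<^sup>2 \<le> (Z1 + Z2)\<^sup>2" "Z2\<^sup>2 \<le> (Z1 + Z2)\<^sup>2" using Z1(1) Z2(1) by (intro power_mono; simp)+
    have "reg 0 (Z1 + Z2)"
      unfolding reg_def
    proof (intro conjI allI impI)
      fix i and G :: "(int^3) set" assume "finite G"
      thus "(\<Sum>k\<in>G. (norm (freq k) ^ m * norm (fourier_coeff (q i 0) k))\<^sup>2) \<le> (Z1 + Z2)\<^sup>2"
        using Z1(2)[of G] Z2(2)[of G] sq by (cases i) (simp_all add: q_def fc)
    qed (use Z1 Z2 in simp)
    thus ?thesis by blast
  qed
  \<comment> \<open>Regularity is carried from time 0 to time t in n equal steps of admissible length.\<close>
  have reg: "\<exists>Z. reg t Z" for t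
  proof -
    define T where "T = \<bar>t\<bar>"
    obtain L where L: "L \<ge> 0" "\<And>t s Z i G. t \<in> {-T..T} \<Longrightarrow> s \<in> {-T..T} \<Longrightarrow> L * \<bar>s - t\<bar> \<le> 1 / 2 \<Longrightarrow> reg t Z \<Longrightarrow> finite G \<Longrightarrow>
      (\<Sum>k\<in>G. (norm (freq k) ^ m * norm (fourier_coeff (q i s) k - fourier_coeff (q i t) k))\<^sup>2) \<le> (2 * L * \<bar>s - t\<bar> * Z)\<^sup>2"
      using local_est[of T] by blast
    obtain n :: nat where n: "real n > 2 * L * T" using reals_Archimedean2 by blast
    have n0: "real n > 0" using n L(1) by (smt (verit) T_def abs_ge_zero mult_nonneg_nonneg)
    define \<tau> where "\<tau> j = real j * (t / n)" for j :: nat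
    have "j \<le> n \<Longrightarrow> \<exists>Z. reg (\<tau> j) Z" for j
    proof (induction j)
      case 0
      thus ?case using reg0 by (simp add: \<tau>_def)
    next
      case (Suc j)
      then obtain Z where Z: "reg (\<tau> j) Z" by auto
      have in_T: "\<tau> i \<in> {-T..T}" if "i \<le> n" for i
      proof -
        have "\<bar>\<tau> i\<bar> = real i / real n * T" by (simp add: \<tau>_def T_def abs_mult)
        also have "\<dots> \<le> 1 * T" using that n0 by (intro mult_right_mono) (auto simp: T_def)
        finally show ?thesis by (auto simp: abs_le_iff)
      qed
      have "\<tau> (Suc j) - \<tau> j = t / n" unfolding \<tau>_def left_diff_distrib[symmetric] by simp
      hence "L * \<bar>\<tau> (Suc j) - \<tau> j\<bar> = L * (T / real n)" by (simp only: T_def abs_divide abs_of_nat)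
      moreover have "L * (T / real n) \<le> 1 / 2" using n n0 by (simp add: field_simps)
      ultimately have small: "L * \<bar>\<tau> (Suc j) - \<tau> j\<bar> \<le> 1 / 2" by simp
      have "reg (\<tau> (Suc j)) (Z + 2 * L * \<bar>\<tau> (Suc j) - \<tau> j\<bar> * Z)"
        by (rule norm_step[OF Z])
          (use L in_T Suc.prems small Z in \<open>auto simp: reg_def\<close>)
      thus ?case by blast
    qed
    hence "\<exists>Z. reg (\<tau> n) Z" by simp
    thus ?thesis using n0 by (simp add: \<tau>_def)
  qed
  \<comment> \<open>The increment estimate at a regular time is a local Lipschitz bound, hence gives continuity.\<close>
  have "cont_curve (Hm m \<inter> spaceV) (Hm_norm m) (q i)" for i
    unfolding cont_curve_def
  proof (intro conjI allI)
    fix t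
    obtain Z where Z: "reg t Z" using reg by blast
    hence Z0: "Z \<ge> 0" and Zb: "\<And>G. finite G \<Longrightarrow> (\<Sum>k\<in>G. (norm (freq k) ^ m * norm (fourier_coeff (q i t) k))\<^sup>2) \<le> Z\<^sup>2"
      by (auto simp: reg_def)
    have sol0: "fourier_coeff (q i s) 0 = 0" for s
      using spaceV_solenoidal[OF q[of i s]] by (simp add: solenoidal_def)
    have "q i t \<in> Hm m" by (rule Hm_of_coeff_bound(1)[OF spaceV_L2[OF q] sol0 Z0 Zb])
    thus "q i t \<in> Hm m \<inter> spaceV" using q by blast
    define T where "T = \<bar>t\<bar> + 1"
    obtain L where L: "L \<ge> 0" "\<And>t s Z i G. t \<in> {-T..T} \<Longrightarrow> s \<in> {-T..T} \<Longrightarrow> L * \<bar>s - t\<bar> \<le> 1 / 2 \<Longrightarrow> reg t Z \<Longrightarrow> finite G \<Longrightarrow>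
      (\<Sum>k\<in>G. (norm (freq k) ^ m * norm (fourier_coeff (q i s) k - fourier_coeff (q i t) k))\<^sup>2) \<le> (2 * L * \<bar>s - t\<bar> * Z)\<^sup>2"
      using local_est[of T] by blast
    define c where "c = sqrt (card {js :: 3 list. length js \<le> m}) * (2 * pi) ^ m"
    show "((\<lambda>s. Hm_norm m (\<lambda>x. q i s x - q i t x)) \<longlongrightarrow> 0) (at t)"
    proof (rule Lim_null_comparison)
      have "((\<lambda>s. L * \<bar>s - t\<bar>) \<longlongrightarrow> L * \<bar>t - t\<bar>) (at t)" by (intro tendsto_intros)
      hence "\<forall>\<^sub>F s in at t. L * \<bar>s - t\<bar> < 1 / 2" by (rule order_tendstoD) simp
      moreover have "((\<lambda>s. \<bar>s - t\<bar>) \<longlongrightarrow> \<bar>t - t\<bar>) (at t)" by (intro tendsto_intros)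
      hence "\<forall>\<^sub>F s in at t. \<bar>s - t\<bar> < 1" by (rule order_tendstoD) simp
      ultimately show "\<forall>\<^sub>F s in at t. norm (Hm_norm m (\<lambda>x. q i s x - q i t x)) \<le> c * (2 * L * \<bar>s - t\<bar> * Z)"
      proof eventually_elim
        case (elim s)
        have "t \<in> {-T..T}" "s \<in> {-T..T}" using elim(2) by (auto simp: T_def abs_if split: if_splits)
        hence bnd: "(\<Sum>k\<in>G. (norm (freq k) ^ m * norm (fourier_coeff (q i s) k - fourier_coeff (q i t) k))\<^sup>2) \<le> (2 * L * \<bar>s - t\<bar> * Z)\<^sup>2"
          if "finite G" for G using L(2) elim(1) Z that by auto
        have fc: "fourier_coeff (\<lambda>x. q i s x - q i t x) k = fourier_coeff (q i s) k - fourier_coeff (q i t) k" for k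
          by (intro fourier_coeff_diff spaceV_L2 q)
        have "Hm_norm m (\<lambda>x. q i s x - q i t x) \<le> sqrt (card {js :: 3 list. length js \<le> m}) * ((2 * pi) ^ m * (2 * L * \<bar>s - t\<bar> * Z))"
          by (rule Hm_of_coeff_bound(2)) (use bnd L(1) Z0 in \<open>auto simp: fc sol0 intro: L2_diff spaceV_L2 q\<close>)
        thus ?case by (simp add: c_def mult.assoc)
      qed
      have "((\<lambda>s. c * (2 * L * \<bar>s - t\<bar> * Z)) \<longlongrightarrow> c * (2 * L * \<bar>t - t\<bar> * Z)) (at t)" by (intro tendsto_intros)
      thus "((\<lambda>s. c * (2 * L * \<bar>s - t\<bar> * Z)) \<longlongrightarrow> 0) (at t)" by simp
    qed
  qed
  from this[of True] this[of False] show ?thesis by (simp add: q_def)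
qed

end
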